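(* Fix a prime $p\geq 3$ and, for $n\ge1$, let $t^\omega(n,p) := \operatorname{rank}\, \widetilde{\mathrm{H}}_{n-1}\big(|\mathcal{T}^\omega_{2n}(\mathbb{Q})|/\Gamma_{2n}^\omega(p);\mathbb{Z}\big)$. For every $n\geq 1$, $$t^\omega(n,p)\geq p^{n^2}\left(\frac{p-1}{2}\right)^n.$$
   Context: $\mathbb{Z}^{2n}$, $\mathbb{Q}^{2n}$ carry the standard symplectic form $\omega$ ($\omega(\vec e_i,\vec e_j)=\omega(\vec f_i,\vec f_j)=0$, $\omega(\vec e_i,\vec f_j)=\delta_{ij}$). $\Gamma_{2n}^\omega(p)=\ker(\mathrm{Sp}_{2n}(\mathbb{Z})\to\mathrm{Sp}_{2n}(\mathbb{Z}/p\mathbb{Z}))$. The symplectic Tits building $\mathcal{T}^\omega_{2n}(\mathbb{Q})$ is the order complex of the poset of proper nonzero isotropic subspaces of $\mathbb{Q}^{2n}$ (subspaces $U$ with $\omega|_U\equiv0$) ordered by inclusion; $|\cdot|$ denotes geometric realization and $|\mathcal{T}^\omega_{2n}(\mathbb{Q})|/\Gamma_{2n}^\omega(p)$ is the topological quotient by the induced action. *)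

theory Defs
  imports
    "HOL-Homology.Homology"
    "HOL-Library.Extended_Nat"
    "HOL-Library.Extended_Real"
    "HOL-Computational_Algebra.Primes"
    "HOL-Number_Theory.Cong"
    "Jordan_Normal_Form.VS_Connect"
begin

section \<open>Symplectic form, symplectic groups, congruence subgroup\<close>

text \<open>The coordinates \<open>0, \<dots>, n-1\<close> are those of \<open>e\<^sub>1, \<dots>, e\<^sub>n\<close>, and
  \<open>n, \<dots>, 2n-1\<close> are those of \<open>f\<^sub>1, \<dots>, f\<^sub>n\<close>.\<close>

definition symp_form :: "nat \<Rightarrow> 'a::comm_ring_1 vec \<Rightarrow> 'a vec \<Rightarrow> 'a" where
  "symp_form n u v = (\<Sum>i<n. vec_index u i * vec_index v (n + i) - vec_index u (n + i) * vec_index v i)"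

lemma symp_form_std_basis:
  assumes "i < n" "j < n"
  shows "symp_form n (unit_vec (2*n) i) (unit_vec (2*n) j) = 0"
    and "symp_form n (unit_vec (2*n) (n+i)) (unit_vec (2*n) (n+j)) = 0"
    and "symp_form n (unit_vec (2*n) i) (unit_vec (2*n) (n+j)) = (if i = j then 1 else 0)"
proof -
  show "symp_form n (unit_vec (2*n) i) (unit_vec (2*n) j) = 0"
    unfolding symp_form_def using assms by (intro sum.neutral) simp
  show "symp_form n (unit_vec (2*n) (n+i)) (unit_vec (2*n) (n+j)) = 0"
    unfolding symp_form_def using assms by (intro sum.neutral) simp
  have "symp_form n (unit_vec (2*n) i) (unit_vec (2*n) (n+j)) =
      (\<Sum>k<n. if k = i then (if i = j then 1 else 0) else 0)"
    unfolding symp_form_def using assms by (intro sum.cong) auto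
  with assms show "symp_form n (unit_vec (2*n) i) (unit_vec (2*n) (n+j)) = (if i = j then 1 else 0)"
    by simp
qed

definition Sp_int :: "nat \<Rightarrow> int mat monoid" where
  "Sp_int n =
     \<lparr>carrier = {A \<in> carrier_mat (2*n) (2*n).
        \<forall>u \<in> carrier_vec (2*n). \<forall>v \<in> carrier_vec (2*n).
          symp_form n (A *\<^sub>v u) (A *\<^sub>v v) = symp_form n u v},
      monoid.mult = (*), one = 1\<^sub>m (2*n)\<rparr>"

text \<open>Matrices over \<open>\<int>/p\<close> are represented by integer matrices with entries in \<open>{0..<p}\<close>.\<close>

definition reduce_mat :: "nat \<Rightarrow> int mat \<Rightarrow> int mat" where
  "reduce_mat p = map_mat (\<lambda>a. a mod int p)"

definition Sp_mod :: "nat \<Rightarrow> nat \<Rightarrow> int mat monoid" where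
  "Sp_mod n p =
     \<lparr>carrier = {A \<in> carrier_mat (2*n) (2*n). elements_mat A \<subseteq> {0..<int p} \<and>
        (\<forall>u \<in> carrier_vec (2*n). \<forall>v \<in> carrier_vec (2*n).
          [symp_form n (A *\<^sub>v u) (A *\<^sub>v v) = symp_form n u v] (mod int p))},
      monoid.mult = (\<lambda>A B. reduce_mat p (A * B)), one = reduce_mat p (1\<^sub>m (2*n))\<rparr>"

definition congruence_subgroup :: "nat \<Rightarrow> nat \<Rightarrow> int mat set" where
  "congruence_subgroup n p = kernel (Sp_int n) (Sp_mod n p) (reduce_mat p)"

section \<open>The symplectic Tits building\<close>

definition isotropic_subspaces :: "nat \<Rightarrow> rat vec set set" where
  "isotropic_subspaces n =
     {U. VectorSpace.subspace class_ring U (module_vec TYPE(rat) (2*n)) \<and>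
         (\<forall>u\<in>U. \<forall>v\<in>U. symp_form n u v = 0)}"

definition tits_poset :: "nat \<Rightarrow> rat vec set set" where
  "tits_poset n = {U \<in> isotropic_subspaces n. U \<noteq> {0\<^sub>v (2*n)} \<and> U \<noteq> carrier_vec (2*n)}"

text \<open>Abstract simplicial complexes are given by their set of (finite, nonempty) simplices.\<close>

definition order_complex :: "'a set set \<Rightarrow> 'a set set set" where
  "order_complex P = {C. C \<subseteq> P \<and> finite C \<and> C \<noteq> {} \<and> chain\<^sub>\<subseteq> C}"

definition tits_building :: "nat \<Rightarrow> rat vec set set set" where
  "tits_building n = order_complex (tits_poset n)"

section \<open>Geometric realization\<close>

text \<open>Points are given by their barycentric coordinates. The realization carries the weak
  topology: a set is open iff it meets every closed simplex in an open subset of that simplex.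
  The product topology on functions restricts to the Euclidean topology on each closed simplex,
  because simplices are finite.\<close>

definition closed_simplex :: "'v set \<Rightarrow> ('v \<Rightarrow> real) set" where
  "closed_simplex \<sigma> = {t. (\<forall>v. 0 \<le> t v) \<and> (\<forall>v. v \<notin> \<sigma> \<longrightarrow> t v = 0) \<and> (\<Sum>v\<in>\<sigma>. t v) = 1}"

definition realization :: "'v set set \<Rightarrow> ('v \<Rightarrow> real) topology" where
  "realization K = topology (\<lambda>U. U \<subseteq> (\<Union>\<sigma>\<in>K. closed_simplex \<sigma>) \<and>
     (\<forall>\<sigma>\<in>K. openin (top_of_set (closed_simplex \<sigma>)) (U \<inter> closed_simplex \<sigma>)))"

lemma openin_realization:
  "openin (realization K) U \<longleftrightarrow> U \<subseteq> (\<Union>\<sigma>\<in>K. closed_simplex \<sigma>) \<and>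
     (\<forall>\<sigma>\<in>K. openin (top_of_set (closed_simplex \<sigma>)) (U \<inter> closed_simplex \<sigma>))"
proof -
  have "istopology (\<lambda>U. U \<subseteq> (\<Union>\<sigma>\<in>K. closed_simplex \<sigma>) \<and>
     (\<forall>\<sigma>\<in>K. openin (top_of_set (closed_simplex \<sigma>)) (U \<inter> closed_simplex \<sigma>)))"
    unfolding istopology_def
  proof (intro conjI allI impI ballI)
    fix S T \<sigma>
    assume S: "S \<subseteq> (\<Union>\<sigma>\<in>K. closed_simplex \<sigma>) \<and>
       (\<forall>\<sigma>\<in>K. openin (top_of_set (closed_simplex \<sigma>)) (S \<inter> closed_simplex \<sigma>))"
      and T: "T \<subseteq> (\<Union>\<sigma>\<in>K. closed_simplex \<sigma>) \<and>
       (\<forall>\<sigma>\<in>K. openin (top_of_set (closed_simplex \<sigma>)) (T \<inter> closed_simplex \<sigma>))"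
    then show "S \<inter> T \<subseteq> (\<Union>\<sigma>\<in>K. closed_simplex \<sigma>)" by blast
    assume "\<sigma> \<in> K"
    then have "openin (top_of_set (closed_simplex \<sigma>))
        ((S \<inter> closed_simplex \<sigma>) \<inter> (T \<inter> closed_simplex \<sigma>))"
      using S T by (blast intro: openin_Int)
    moreover have "(S \<inter> closed_simplex \<sigma>) \<inter> (T \<inter> closed_simplex \<sigma>) = S \<inter> T \<inter> closed_simplex \<sigma>"
      by blast
    ultimately show "openin (top_of_set (closed_simplex \<sigma>)) (S \<inter> T \<inter> closed_simplex \<sigma>)"
      by simp
  next
    fix \<U> :: "('a \<Rightarrow> real) set set" and \<sigma>
    assume \<U>: "\<forall>S\<in>\<U>. S \<subseteq> (\<Union>\<sigma>\<in>K. closed_simplex \<sigma>) \<and>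
       (\<forall>\<sigma>\<in>K. openin (top_of_set (closed_simplex \<sigma>)) (S \<inter> closed_simplex \<sigma>))"
    then show "\<Union>\<U> \<subseteq> (\<Union>\<sigma>\<in>K. closed_simplex \<sigma>)" by blast
    assume "\<sigma> \<in> K"
    then have "openin (top_of_set (closed_simplex \<sigma>)) (\<Union>S\<in>\<U>. S \<inter> closed_simplex \<sigma>)"
      using \<U> by (blast intro: openin_Union)
    moreover have "(\<Union>S\<in>\<U>. S \<inter> closed_simplex \<sigma>) = \<Union>\<U> \<inter> closed_simplex \<sigma>"
      by blast
    ultimately show "openin (top_of_set (closed_simplex \<sigma>)) (\<Union>\<U> \<inter> closed_simplex \<sigma>)"
      by simp
  qed
  then show ?thesis
    by (simp add: realization_def topology_inverse')
qed

lemma topspace_realization: "topspace (realization K) = (\<Union>\<sigma>\<in>K. closed_simplex \<sigma>)"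
proof (rule subset_antisym)
  show "topspace (realization K) \<subseteq> (\<Union>\<sigma>\<in>K. closed_simplex \<sigma>)"
    using openin_topspace[of "realization K"] by (simp only: openin_realization)
  have "openin (realization K) (\<Union>\<sigma>\<in>K. closed_simplex \<sigma>)"
    unfolding openin_realization
  proof (intro conjI ballI)
    fix \<sigma> assume "\<sigma> \<in> K"
    then have "(\<Union>\<sigma>\<in>K. closed_simplex \<sigma>) \<inter> closed_simplex \<sigma> = closed_simplex \<sigma>" by blast
    then show "openin (top_of_set (closed_simplex \<sigma>)) ((\<Union>\<sigma>\<in>K. closed_simplex \<sigma>) \<inter> closed_simplex \<sigma>)"
      by simp
  qed simp
  then show "(\<Union>\<sigma>\<in>K. closed_simplex \<sigma>) \<subseteq> topspace (realization K)"
    by (rule openin_subset)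
qed

text \<open>The affine extension of a map of vertices to a point with finite support.\<close>

definition realization_map :: "('v \<Rightarrow> 'w) \<Rightarrow> ('v \<Rightarrow> real) \<Rightarrow> ('w \<Rightarrow> real)" where
  "realization_map f t = (\<lambda>w. \<Sum>v | t v \<noteq> 0 \<and> f v = w. t v)"

section \<open>The quotient space\<close>

definition quotient_topology :: "'a topology \<Rightarrow> ('a \<Rightarrow> 'b) \<Rightarrow> 'b topology" where
  "quotient_topology X f =
     topology (\<lambda>U. U \<subseteq> f ` topspace X \<and> openin X {x \<in> topspace X. f x \<in> U})"

lemma openin_quotient_topology:
  "openin (quotient_topology X f) U \<longleftrightarrow>
     U \<subseteq> f ` topspace X \<and> openin X {x \<in> topspace X. f x \<in> U}"
proof -
  have "istopology (\<lambda>U. U \<subseteq> f ` topspace X \<and> openin X {x \<in> topspace X. f x \<in> U})"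
    unfolding istopology_def
  proof (intro conjI allI impI)
    fix S T
    assume S: "S \<subseteq> f ` topspace X \<and> openin X {x \<in> topspace X. f x \<in> S}"
      and T: "T \<subseteq> f ` topspace X \<and> openin X {x \<in> topspace X. f x \<in> T}"
    then show "S \<inter> T \<subseteq> f ` topspace X" by blast
    have "{x \<in> topspace X. f x \<in> S \<inter> T} =
        {x \<in> topspace X. f x \<in> S} \<inter> {x \<in> topspace X. f x \<in> T}" by blast
    with S T show "openin X {x \<in> topspace X. f x \<in> S \<inter> T}" by (simp add: openin_Int)
  next
    fix \<U>
    assume \<U>: "\<forall>S\<in>\<U>. S \<subseteq> f ` topspace X \<and> openin X {x \<in> topspace X. f x \<in> S}"
    then show "\<Union>\<U> \<subseteq> f ` topspace X" by blast
    have "{x \<in> topspace X. f x \<in> \<Union>\<U>} = (\<Union>S\<in>\<U>. {x \<in> topspace X. f x \<in> S})" by blast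
    with \<U> show "openin X {x \<in> topspace X. f x \<in> \<Union>\<U>}" by auto
  qed
  then show ?thesis
    by (simp add: quotient_topology_def topology_inverse')
qed

lemma quotient_map_quotient_topology: "quotient_map X (quotient_topology X f) f"
proof -
  have "openin (quotient_topology X f) (f ` topspace X)"
  proof -
    have "{x \<in> topspace X. f x \<in> f ` topspace X} = topspace X" by blast
    then show ?thesis by (simp add: openin_quotient_topology)
  qed
  then have "f ` topspace X \<subseteq> topspace (quotient_topology X f)"
    by (rule openin_subset)
  moreover have "topspace (quotient_topology X f) \<subseteq> f ` topspace X"
    using openin_topspace[of "quotient_topology X f"] by (simp only: openin_quotient_topology)
  ultimately have "topspace (quotient_topology X f) = f ` topspace X"
    by (rule subset_antisym[rotated])
  then show ?thesis
    by (simp add: quotient_map_def openin_quotient_topology)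
qed

definition act_subspace :: "int mat \<Rightarrow> rat vec set \<Rightarrow> rat vec set" where
  "act_subspace A U = (\<lambda>u. map_mat rat_of_int A *\<^sub>v u) ` U"

definition building_orbit :: "nat \<Rightarrow> nat \<Rightarrow> (rat vec set \<Rightarrow> real) \<Rightarrow> (rat vec set \<Rightarrow> real) set" where
  "building_orbit n p x = {realization_map (act_subspace A) x | A. A \<in> congruence_subgroup n p}"

definition tits_quotient :: "nat \<Rightarrow> nat \<Rightarrow> (rat vec set \<Rightarrow> real) set topology" where
  "tits_quotient n p = quotient_topology (realization (tits_building n)) (building_orbit n p)"

section \<open>Ranks\<close>

definition int_independent :: "('a, 'b) monoid_scheme \<Rightarrow> 'a set \<Rightarrow> bool" where
  "int_independent G S \<longleftrightarrow> finite S \<and> S \<subseteq> carrier G \<and>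
     (\<forall>c :: 'a \<Rightarrow> int. finprod G (\<lambda>x. x [^]\<^bsub>G\<^esub> c x) S = \<one>\<^bsub>G\<^esub> \<longrightarrow> (\<forall>x\<in>S. c x = 0))"

definition abelian_rank :: "('a, 'b) monoid_scheme \<Rightarrow> enat" where
  "abelian_rank G = (SUP S \<in> {S. int_independent G S}. enat (card S))"

definition t_omega :: "nat \<Rightarrow> nat \<Rightarrow> enat" where
  "t_omega n p = abelian_rank (reduced_homology_group (int n - 1) (tits_quotient n p))"

end

theory Submission
  imports Defs "HOL-Library.Function_Algebras"
begin

text \<open>Fix the isotropic flag \<open>C\<close> of the \<open>e\<^sub>i\<close>. A rational frame of \<open>2n\<close> lines spans an apartment, that
  is, a sphere \<open>S\<^sup>n\<^sup>-\<^sup>1\<close> in the building, and hence a class in the quotient. Conversely, for a chamber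
  \<open>D\<^sub>0 \<subset> \<dots> \<subset> D\<^sub>n\<^sub>-\<^sub>1\<close>, collapsing the complement of the open orbit cell of \<open>D\<close> to a point gives a map from the
  quotient to \<open>S\<^sup>n\<^sup>-\<^sup>1\<close>, because the total barycentric weight of the orbit of \<open>D\<^sub>k\<close> is an invariant
  continuous function. If \<open>D\<close> is opposite to \<open>C\<close> modulo \<open>p\<close>, the apartment of \<open>C\<close> and \<open>D\<close> meets the chambers
  that are opposite to \<open>C\<close> modulo \<open>p\<close> only in \<open>D\<close>. Thus for pairwise inequivalent opposite chambers
  the matrix of degrees of these maps is the identity and the classes are independent.

  Such chambers are spanned by the vectors \<open>u (p e\<^sub>j + d\<^sub>j f\<^sub>j)\<close>, where \<open>u\<close> runs through representatives modulo \<open>p\<close> of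
  the unipotent radical of the stabilizer of \<open>C\<close> (\<open>p ^ (n\<^sup>2)\<close> choices) and \<open>1 \<le> d\<^sub>j \<le> (p - 1) / 2\<close>; these vectors are
  primitive since \<open>p\<close> and \<open>d\<^sub>j\<close> are coprime. The products \<open>d\<^sub>0 \<dots> d\<^sub>k\<close> modulo sign are the orientations of
  the subspaces \<open>D\<^sub>k\<close> modulo \<open>p\<close>, so they separate orbits.\<close>

section \<open>Detecting homology classes by degrees\<close>

text \<open>That an apartment avoids the orbits of other chambers is a statement about lattices.
  Because \<open>p\<close> and \<open>d\<^sub>j\<close> are coprime, the frame vectors that span a
  vertex of the apartment form a basis of its lattice points, so a congruence matrix carrying one
  such subspace to another does so through an integral matrix \<open>M\<close>. Modulo
  \<open>p\<close> the \<open>f\<close>-coordinates forget the isotropic vectors and the summand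
  with factor \<open>p\<close>; what remains is a congruence between \<open>M\<close> times a
  triangular matrix with diagonal \<open>d\<close> and one with diagonal \<open>d'\<close>. A vertex
  other than the expected one would give a zero column, although the \<open>d'\<close> are units.
  Over the integers \<open>M\<close> is invertible, so its determinant is a sign; this sign is the
  reason for stopping at \<open>d\<^sub>j \<le> (p - 1) / 2\<close>. The exponent is
  \<open>n\<^sup>2 = n (n - 1) / 2 + n (n + 1) / 2\<close>: a unitriangular and a symmetric matrix
  are chosen modulo \<open>p\<close>. No homology of the building or of the quotient is computed.
  Classes and functionals both come from maps between spheres and the quotient, so the quotient
  needs no cell structure.\<close>

lemma hom_finprod_pow:
  assumes G: "comm_group G" and H: "comm_group H" and h: "h \<in> hom G H"
    and "finite S" "S \<subseteq> carrier G"
  shows "h (finprod G (\<lambda>x. x [^]\<^bsub>G\<^esub> (c x :: int)) S) = finprod H (\<lambda>x. h x [^]\<^bsub>H\<^esub> c x) S"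
proof -
  interpret G: comm_group G by fact
  interpret H: comm_group H by fact
  interpret group_hom G H h
    by (simp add: group_hom_def group_hom_axioms_def h)
  from \<open>finite S\<close> \<open>S \<subseteq> carrier G\<close> show ?thesis
  proof (induction S rule: finite_induct)
    case (insert x F)
    then have "(\<lambda>x. x [^]\<^bsub>G\<^esub> c x) \<in> F \<rightarrow> carrier G" "(\<lambda>x. h x [^]\<^bsub>H\<^esub> c x) \<in> F \<rightarrow> carrier H"
      by auto
    with insert show ?case
      by (simp add: hom_int_pow)
  qed simp
qed

lemma comm_group_reduced_homology_group: "comm_group (reduced_homology_group p X)"
  unfolding reduced_homology_group_def
  by (simp add: group.abelian_subgroup_generated abelian_homology_group)

text \<open>Applying \<open>h i\<close> to a relation among the \<open>x j\<close> kills every term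
  except that of \<open>x i\<close>, and \<open>a\<close> has infinite order, so each coefficient
  vanishes.\<close>

lemma card_le_abelian_rank_if_dual_maps:
  fixes h :: "'i \<Rightarrow> 'g \<Rightarrow> 'h"
  assumes G: "comm_group G" and H: "comm_group H"
    and a: "a \<in> carrier H" "\<And>c::int. a [^]\<^bsub>H\<^esub> c = \<one>\<^bsub>H\<^esub> \<Longrightarrow> c = 0"
    and "finite I"
    and x: "\<And>i. i \<in> I \<Longrightarrow> x i \<in> carrier G"
    and h: "\<And>i. i \<in> I \<Longrightarrow> h i \<in> hom G H"
    and diag: "\<And>i. i \<in> I \<Longrightarrow> h i (x i) = a"
    and off: "\<And>i j. i \<in> I \<Longrightarrow> j \<in> I \<Longrightarrow> i \<noteq> j \<Longrightarrow> h i (x j) = \<one>\<^bsub>H\<^esub>"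
  shows "enat (card I) \<le> abelian_rank G"
proof -
  interpret G: comm_group G by fact
  interpret H: comm_group H by fact
  have a1: "a \<noteq> \<one>\<^bsub>H\<^esub>"
    using a(2)[of 1] a(1) by (auto simp: H.int_pow_1)
  have inj: "inj_on x I"
    using diag off a1 by (metis inj_onI)
  have "int_independent G (x ` I)"
    unfolding int_independent_def
  proof (intro conjI allI impI ballI)
    show "finite (x ` I)" using \<open>finite I\<close> by simp
    have off': "h i (x j) = \<one>\<^bsub>H\<^esub>" if "i \<in> I" "j \<in> I" "x i \<noteq> x j" for i j
      using off that by metis
    have hdiag': "h i z = a" if "i \<in> I" "j \<in> I" "z = x j" "x i = x j" for i j z
      using diag that by metis
    show sub: "x ` I \<subseteq> carrier G" using x by auto
    fix c :: "'g \<Rightarrow> int" and y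
    assume eq: "finprod G (\<lambda>x. x [^]\<^bsub>G\<^esub> c x) (x ` I) = \<one>\<^bsub>G\<^esub>" and "y \<in> x ` I"
    then obtain i where i: "i \<in> I" "y = x i" by auto
    interpret group_hom G H "h i"
      by (simp add: group_hom_def group_hom_axioms_def h i)
    have "\<one>\<^bsub>H\<^esub> = finprod H (\<lambda>z. h i z [^]\<^bsub>H\<^esub> c z) (x ` I)"
      using hom_finprod_pow[OF G H h[OF i(1)] _ sub, of c] \<open>finite I\<close> eq by simp
    also have "\<dots> = finprod H (\<lambda>z. if x i = z then a [^]\<^bsub>H\<^esub> c z else \<one>\<^bsub>H\<^esub>) (x ` I)"
      using i diag off' a(1) hdiag' by (intro H.finprod_cong') auto
    also have "\<dots> = a [^]\<^bsub>H\<^esub> c (x i)"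
      by (rule H.finprod_singleton) (use i \<open>finite I\<close> a(1) in auto)
    finally show "c y = 0" using a(2) i by metis
  qed
  moreover have "card (x ` I) = card I" using inj by (rule card_image)
  ultimately show ?thesis
    unfolding abelian_rank_def by (metis (mono_tags, lifting) SUP_upper mem_Collect_eq)
qed

text \<open>The composite \<open>\<phi> i \<circ> \<alpha> j\<close> multiplies a generator of the
  infinite cyclic reduced homology of the sphere by its degree, so an identity matrix of degrees
  makes the \<open>\<phi> i\<close> dual to the images of that generator. Reduced homology covers
  \<open>q = 0\<close>, the sphere of two points, which is the case \<open>n = 1\<close>.\<close>

lemma card_le_rank_reduced_homology_if_sphere_maps:
  fixes \<alpha> :: "'i \<Rightarrow> (nat \<Rightarrow> real) \<Rightarrow> 'a" and \<phi> :: "'i \<Rightarrow> 'a \<Rightarrow> nat \<Rightarrow> real"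
  assumes "finite I"
    and \<alpha>: "\<And>i. i \<in> I \<Longrightarrow> continuous_map (nsphere q) X (\<alpha> i)"
    and \<phi>: "\<And>i. i \<in> I \<Longrightarrow> continuous_map X (nsphere q) (\<phi> i)"
    and diag: "\<And>i. i \<in> I \<Longrightarrow> Brouwer_degree2 q (\<phi> i \<circ> \<alpha> i) = 1"
    and off: "\<And>i j. i \<in> I \<Longrightarrow> j \<in> I \<Longrightarrow> i \<noteq> j \<Longrightarrow> Brouwer_degree2 q (\<phi> i \<circ> \<alpha> j) = 0"
  shows "enat (card I) \<le> abelian_rank (reduced_homology_group (int q) X)"
proof -
  let ?H = "reduced_homology_group (int q) (nsphere q)"
  interpret H: comm_group ?H by (rule comm_group_reduced_homology_group)
  obtain a where a: "a \<in> carrier ?H" and aeq: "subgroup_generated ?H {a} = ?H"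
    using cyclic_reduced_homology_group_nsphere [of q q] by (auto simp: cyclic_group_def)
  have "H.ord a = 0"
    by (simp add: a aeq iso_finite [OF reduced_homology_group_nsphere(1)] flip: H.infinite_cyclic_subgroup_order)
  then have a0: "c = 0" if "a [^]\<^bsub>?H\<^esub> (c::int) = \<one>\<^bsub>?H\<^esub>" for c
    using that a by (simp add: H.int_pow_eq_id)
  let ?x = "\<lambda>i. hom_induced (int q) (nsphere q) {} X {} (\<alpha> i) a"
  let ?h = "\<lambda>i. hom_induced (int q) X {} (nsphere q) {} (\<phi> i)"
  have hx: "?h i (?x j) = a [^]\<^bsub>?H\<^esub> Brouwer_degree2 q (\<phi> i \<circ> \<alpha> j)" if "i \<in> I" "j \<in> I" for i j
  proof -
    have "hom_induced (int q) (nsphere q) {} (nsphere q) {} (\<phi> i \<circ> \<alpha> j) = ?h i \<circ> hom_induced (int q) (nsphere q) {} X {} (\<alpha> j)"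
      using \<alpha> \<phi> that by (intro hom_induced_compose_empty)
    then show ?thesis using Brouwer_degree2[OF a, of "\<phi> i \<circ> \<alpha> j"] by simp
  qed
  show ?thesis
  proof (rule card_le_abelian_rank_if_dual_maps[where H = ?H and a = a and x = ?x and h = ?h])
    show "?h i (?x i) = a" if "i \<in> I" for i
      using hx[OF that that] diag[OF that] a by (simp add: H.int_pow_1)
    show "?h i (?x j) = \<one>\<^bsub>?H\<^esub>" if "i \<in> I" "j \<in> I" "i \<noteq> j" for i j
      using hx[OF that(1,2)] off[OF that] by simp
  qed (use a a0 \<open>finite I\<close> in \<open>auto simp: comm_group_reduced_homology_group hom_induced_reduced_hom hom_induced_reduced\<close>)
qed

section \<open>Normalized maps into the sphere and their degrees\<close>

definition sphere_proj :: "nat \<Rightarrow> (nat \<Rightarrow> real) \<Rightarrow> nat \<Rightarrow> real" where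
  "sphere_proj q x = (\<lambda>i. x i / sqrt (\<Sum>j\<le>q. x j ^ 2))"

lemma sphere_proj_eq: "x \<in> topspace (nsphere q) \<Longrightarrow> sphere_proj q x = x"
  by (auto simp: sphere_proj_def nsphere)

lemma continuous_map_sphere_proj:
  assumes f: "\<And>i. continuous_map X euclideanreal (\<lambda>x. f x i)"
    and z: "\<And>x i. x \<in> topspace X \<Longrightarrow> i > q \<Longrightarrow> f x i = 0"
    and nz: "\<And>x. x \<in> topspace X \<Longrightarrow> \<exists>i\<le>q. f x i \<noteq> 0"
  shows "continuous_map X (nsphere q) (\<lambda>x. sphere_proj q (f x))"
proof -
  have pos: "(\<Sum>j\<le>q. f x j ^ 2) > 0" if x: "x \<in> topspace X" for x
  proof -
    obtain i where "i \<le> q" "f x i \<noteq> 0" using nz[OF x] by auto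
    then show ?thesis by (intro sum_pos2[of _ i]) auto
  qed
  have cs: "continuous_map X euclideanreal (\<lambda>x. sqrt (\<Sum>j\<le>q. f x j ^ 2))"
    by (rule continuous_map_compose[of X euclideanreal "\<lambda>x. \<Sum>j\<le>q. f x j ^ 2" euclideanreal sqrt, unfolded o_def])
       (auto intro!: continuous_map_sum continuous_map_real_pow f continuous_on_real_sqrt)
  have "continuous_map X euclideanreal (\<lambda>x. f x k / sqrt (\<Sum>j\<le>q. f x j ^ 2))" for k
    using pos by (intro continuous_map_real_divide f cs) (metis less_irrefl real_sqrt_gt_0_iff)
  moreover have "(\<Sum>i\<le>q. (f x i / sqrt (\<Sum>j\<le>q. f x j ^ 2))\<^sup>2) = 1" if "x \<in> topspace X" for x
    using pos[OF that] by (simp add: power_divide flip: sum_divide_distrib)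
  ultimately show ?thesis
    using z by (auto simp: sphere_proj_def nsphere continuous_map_in_subtopology continuous_map_componentwise_UNIV)
qed

text \<open>The segment from \<open>f x\<close> to \<open>x\<close> misses the origin because
  \<open>f x\<close> is never a nonpositive multiple of \<open>x\<close>; normalizing these segments
  gives a homotopy to the identity.\<close>

lemma Brouwer_degree2_sphere_proj_eq_1:
  assumes f: "\<And>i. continuous_map (nsphere q) euclideanreal (\<lambda>x. f x i)"
    and z: "\<And>x i. x \<in> topspace (nsphere q) \<Longrightarrow> i > q \<Longrightarrow> f x i = 0"
    and na: "\<And>x c. x \<in> topspace (nsphere q) \<Longrightarrow> c \<ge> 0 \<Longrightarrow> \<exists>i\<le>q. f x i \<noteq> - c * x i"
  shows "Brouwer_degree2 q (\<lambda>x. sphere_proj q (f x)) = 1"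
proof -
  let ?h = "\<lambda>z. sphere_proj q (\<lambda>i. (1 - fst z) * f (snd z) i + fst z * snd z i)"
  let ?P = "prod_topology (top_of_set {0..1::real}) (nsphere q)"
  have c1: "continuous_map ?P euclideanreal (\<lambda>z. fst z)"
    using continuous_map_fst[of "top_of_set {0..1::real}" "nsphere q"]
    by (metis continuous_map_into_fulltopology)
  have "continuous_map ?P (nsphere q) ?h"
  proof (rule continuous_map_sphere_proj)
    fix i
    show "continuous_map ?P euclideanreal (\<lambda>z. (1 - fst z) * f (snd z) i + fst z * snd z i)"
      using continuous_map_compose[OF continuous_map_snd f[of i]] c1
        continuous_map_compose[OF continuous_map_snd continuous_map_nsphere_projection[of q i]]
      by (intro continuous_intros) (auto simp: o_def)
  next
    fix z i assume "z \<in> topspace ?P" "q < i"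
    then show "(1 - fst z) * f (snd z) i + fst z * snd z i = 0"
      using assms(2)[of "snd z" i] by (auto simp: nsphere)
  next
    fix z assume z: "z \<in> topspace ?P"
    then have t: "0 \<le> fst z" "fst z \<le> 1" and x: "snd z \<in> topspace (nsphere q)" by auto
    show "\<exists>i\<le>q. (1 - fst z) * f (snd z) i + fst z * snd z i \<noteq> 0"
    proof (cases "fst z = 1")
      case True
      have "(\<Sum>i\<le>q. (snd z i)\<^sup>2) = 1" using x by (auto simp: nsphere)
      then have "\<exists>i\<le>q. snd z i \<noteq> 0"
        by (metis (no_types, lifting) atMost_iff power_zero_numeral sum.neutral zero_neq_one)
      with True show ?thesis by auto
    next
      case False
      then have lt: "1 - fst z > 0" using t by auto
      \<comment> \<open>\<open>(1 - t) f x + t x = 0\<close> would mean \<open>f x = - c x\<close>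
        with \<open>c = t / (1 - t)\<close>.\<close>
      then have "fst z / (1 - fst z) \<ge> 0" using t by simp
      from na[OF x this] obtain i where "i \<le> q" "f (snd z) i \<noteq> - (fst z / (1 - fst z)) * snd z i" by auto
      then show ?thesis using lt by (intro exI[of _ i]) (auto simp: field_simps)
    qed
  qed
  then have "homotopic_with (\<lambda>x. True) (nsphere q) (nsphere q) (\<lambda>x. sphere_proj q (f x)) (sphere_proj q)"
    unfolding homotopic_with_def
    by (intro exI[of _ ?h]) auto
  then have "Brouwer_degree2 q (\<lambda>x. sphere_proj q (f x)) = Brouwer_degree2 q (sphere_proj q)"
    by (rule Brouwer_degree2_homotopic)
  also have "\<dots> = Brouwer_degree2 q id"
    by (rule Brouwer_degree2_eq) (simp add: sphere_proj_eq)
  finally show ?thesis by simp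
qed

section \<open>Maps from and into realizations\<close>

lemma continuous_map_closed_simplex_realization:
  assumes "\<sigma> \<in> K"
  shows "continuous_map (top_of_set (closed_simplex \<sigma>)) (realization K) id"
  unfolding continuous_map
proof (intro conjI allI impI)
  show "id ` topspace (top_of_set (closed_simplex \<sigma>)) \<subseteq> topspace (realization K)"
    using assms by (auto simp: topspace_realization)
  fix U assume "openin (realization K) U"
  then have "openin (top_of_set (closed_simplex \<sigma>)) (U \<inter> closed_simplex \<sigma>)"
    using assms by (simp add: openin_realization)
  moreover have "{x \<in> topspace (top_of_set (closed_simplex \<sigma>)). id x \<in> U} = U \<inter> closed_simplex \<sigma>"
    by auto
  ultimately show "openin (top_of_set (closed_simplex \<sigma>)) {x \<in> topspace (top_of_set (closed_simplex \<sigma>)). id x \<in> U}"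
    by simp
qed

lemma continuous_map_from_realization:
  assumes "\<And>\<sigma>. \<sigma> \<in> K \<Longrightarrow> continuous_map (top_of_set (closed_simplex \<sigma>)) Z f"
  shows "continuous_map (realization K) Z f"
  unfolding continuous_map
proof (intro conjI allI impI)
  show "f ` topspace (realization K) \<subseteq> topspace Z"
    using assms by (fastforce simp: topspace_realization continuous_map_def)
  fix U assume U: "openin Z U"
  show "openin (realization K) {x \<in> topspace (realization K). f x \<in> U}"
    unfolding openin_realization
  proof (intro conjI ballI)
    show "{x \<in> topspace (realization K). f x \<in> U} \<subseteq> (\<Union>\<sigma>\<in>K. closed_simplex \<sigma>)"
      by (auto simp: topspace_realization)
    fix \<sigma> assume \<sigma>: "\<sigma> \<in> K"
    have "openin (top_of_set (closed_simplex \<sigma>)) {x \<in> topspace (top_of_set (closed_simplex \<sigma>)). f x \<in> U}"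
      using assms[OF \<sigma>] U by (rule openin_continuous_map_preimage)
    moreover have "{x \<in> topspace (top_of_set (closed_simplex \<sigma>)). f x \<in> U}
        = {x \<in> topspace (realization K). f x \<in> U} \<inter> closed_simplex \<sigma>"
      using \<sigma> by (auto simp: topspace_realization)
    ultimately show "openin (top_of_set (closed_simplex \<sigma>)) ({x \<in> topspace (realization K). f x \<in> U} \<inter> closed_simplex \<sigma>)"
      by simp
  qed
qed

lemma continuous_map_into_closed_simplex:
  assumes "\<And>v. continuous_map X euclideanreal (\<lambda>x. f x v)"
    and "\<And>x. x \<in> topspace X \<Longrightarrow> f x \<in> closed_simplex \<sigma>"
  shows "continuous_map X (top_of_set (closed_simplex \<sigma>)) f"
  using assms
  by (auto simp: continuous_map_in_subtopology continuous_map_componentwise_UNIV simp flip: euclidean_product_topology)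

lemma continuous_map_closed_simplex_coordinate:
  "continuous_map (top_of_set (closed_simplex \<sigma>)) euclideanreal (\<lambda>t. t v)"
  by (rule continuous_map_from_subtopology)
     (auto simp flip: euclidean_product_topology intro: continuous_map_product_projection)

lemma closed_simplex_sum_if:
  assumes "t \<in> closed_simplex \<sigma>" "finite \<sigma>"
  shows "(\<Sum>v | t v \<noteq> 0 \<and> Q v. t v) = (\<Sum>v\<in>\<sigma>. if Q v then t v else 0)"
proof -
  have "(\<Sum>v | t v \<noteq> 0 \<and> Q v. t v) = (\<Sum>v\<in>{v\<in>\<sigma>. Q v}. t v)"
    using assms by (intro sum.mono_neutral_left) (auto simp: closed_simplex_def)
  also have "\<dots> = (\<Sum>v\<in>\<sigma>. if Q v then t v else 0)"
    using assms(2) by (simp add: sum.inter_filter)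
  finally show ?thesis .
qed

lemma continuous_map_Min:
  assumes "finite F" "F \<noteq> {}" "\<And>i. i \<in> F \<Longrightarrow> continuous_map X euclideanreal (f i)"
  shows "continuous_map X euclideanreal (\<lambda>x. Min ((\<lambda>i. f i x) ` F))"
  using assms
proof (induction F rule: finite_ne_induct)
  case (insert a F)
  then have "continuous_map X euclideanreal (\<lambda>x. min (f a x) (Min ((\<lambda>i. f i x) ` F)))"
    by (intro continuous_map_real_min) auto
  then show ?case using insert by simp
qed simp

lemma continuous_map_Max_insert:
  assumes "finite F" "\<And>i. i \<in> F \<Longrightarrow> continuous_map X euclideanreal (f i)"
  shows "continuous_map X euclideanreal (\<lambda>x. Max (insert c ((\<lambda>i. f i x) ` F)))"
  using assms
proof (induction F rule: finite_induct)
  case (insert a F)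
  then have "continuous_map X euclideanreal (\<lambda>x. max (f a x) (Max (insert c ((\<lambda>i. f i x) ` F))))"
    by (intro continuous_map_real_max) auto
  moreover have "Max (insert c (insert y S)) = max y (Max (insert c S))" if "finite S" for y :: real and S
    using that by (subst insert_commute) simp
  ultimately show ?case using insert.hyps by simp
qed simp

section \<open>Apartments as spheres\<close>

text \<open>\<open>S\<close> is the set of coordinates that a face of the cube fixes at +1 or -1, so
  a larger \<open>S\<close> belongs to a smaller face; the signs are kept apart.\<close>

definition faces :: "nat \<Rightarrow> nat set set" where
  "faces n = Pow {..<n} - {{}}"

text \<open>The apartment is the barycentric subdivision of the boundary of the cube \<open>[-1,1]\<^sup>n\<close>: the vertex
  \<open>V S e\<close> corresponds to the vector with entries \<open>\<plusminus>1\<close> (signs \<open>e\<close>) on \<open>S\<close> and \<open>0\<close> elsewhere. Its barycentric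
  coordinate at \<open>x\<close> is proportional to the gap between the absolute values of \<open>x\<close> on \<open>S\<close> and off \<open>S\<close>.\<close>

definition cube_weight :: "nat \<Rightarrow> nat set \<Rightarrow> (nat \<Rightarrow> real) \<Rightarrow> real" where
  "cube_weight n S x = max 0 (Min ((\<lambda>i. \<bar>x i\<bar>) ` S) - Max (insert 0 ((\<lambda>i. \<bar>x i\<bar>) ` ({..<n} - S))))"

definition cube_map :: "nat \<Rightarrow> (nat set \<Rightarrow> (nat \<Rightarrow> bool) \<Rightarrow> 'v) \<Rightarrow> (nat \<Rightarrow> real) \<Rightarrow> 'v \<Rightarrow> real" where
  "cube_map n V x v = (\<Sum>S\<in>faces n. if V S (\<lambda>i. 0 < x i) = v then cube_weight n S x else 0) / (\<Sum>S\<in>faces n. cube_weight n S x)"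

lemma finite_faces [simp]: "finite (faces n)"
  by (simp add: faces_def)

lemma facesD: "S \<in> faces n \<Longrightarrow> finite S \<and> S \<noteq> {} \<and> S \<subseteq> {..<n}"
  by (auto simp: faces_def intro: finite_subset)

lemma cube_weight_nonneg: "0 \<le> cube_weight n S x"
  by (simp add: cube_weight_def)

lemma cube_weight_pos_iff:
  assumes "S \<in> faces n"
  shows "0 < cube_weight n S x \<longleftrightarrow> (\<forall>i\<in>S. x i \<noteq> 0 \<and> (\<forall>j\<in>{..<n}-S. \<bar>x j\<bar> < \<bar>x i\<bar>))"
proof -
  have "0 < cube_weight n S x \<longleftrightarrow> Max (insert 0 ((\<lambda>i. \<bar>x i\<bar>) ` ({..<n} - S))) < Min ((\<lambda>i. \<bar>x i\<bar>) ` S)"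
    by (simp add: cube_weight_def less_max_iff_disj del: Max_insert Max_less_iff Min_gr_iff)
  also have "\<dots> \<longleftrightarrow> (\<forall>a \<in> (\<lambda>i. \<bar>x i\<bar>) ` S. \<forall>b \<in> insert 0 ((\<lambda>i. \<bar>x i\<bar>) ` ({..<n} - S)). b < a)"
    using facesD[OF assms] by (subst Min_gr_iff) (auto simp: Max_less_iff simp del: Max_insert)
  finally show ?thesis by auto
qed

text \<open>An index only in \<open>S\<close> and an index only in \<open>S'\<close> would each have
  the strictly larger absolute value.\<close>

lemma chain_cube_weight_support: "chain\<^sub>\<subseteq> {S \<in> faces n. 0 < cube_weight n S x}"
  unfolding chain_subset_def
proof (intro ballI, rule ccontr)
  fix S S' assume S: "S \<in> {S \<in> faces n. 0 < cube_weight n S x}" and S': "S' \<in> {S \<in> faces n. 0 < cube_weight n S x}"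
    and "\<not> (S \<subseteq> S' \<or> S' \<subseteq> S)"
  then obtain i j where ij: "i \<in> S" "i \<notin> S'" "j \<in> S'" "j \<notin> S" by auto
  then have "i < n" "j < n" using S S' facesD by auto
  then have "\<bar>x j\<bar> < \<bar>x i\<bar>" "\<bar>x i\<bar> < \<bar>x j\<bar>"
    using S S' ij by (auto simp: cube_weight_pos_iff)
  then show False by simp
qed

text \<open>The coordinates of maximal absolute value form such a set.\<close>

lemma cube_weight_support_nonempty:
  assumes "i < n" "x i \<noteq> 0"
  shows "\<exists>S\<in>faces n. 0 < cube_weight n S x"
proof -
  define M where "M = Max ((\<lambda>i. \<bar>x i\<bar>) ` {..<n})"
  have M: "\<bar>x j\<bar> \<le> M" if "j < n" for j
    unfolding M_def using that by (intro Max_ge) auto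
  have "M \<in> (\<lambda>i. \<bar>x i\<bar>) ` {..<n}"
    unfolding M_def using assms by (intro Max_in) auto
  then have ne: "{j\<in>{..<n}. \<bar>x j\<bar> = M} \<noteq> {}" by auto
  then have F: "{j\<in>{..<n}. \<bar>x j\<bar> = M} \<in> faces n" by (auto simp: faces_def)
  moreover have "0 < M" using M[of i] assms by auto
  then have "0 < cube_weight n {j\<in>{..<n}. \<bar>x j\<bar> = M} x"
    unfolding cube_weight_pos_iff[OF F] using M by (auto simp: less_le)
  ultimately show ?thesis by blast
qed

lemma cube_weight_sum_pos:
  assumes "i < n" "x i \<noteq> 0"
  shows "0 < (\<Sum>S\<in>faces n. cube_weight n S x)"
  using cube_weight_support_nonempty[of i n x, OF assms] by (auto intro: sum_pos2 cube_weight_nonneg)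

lemma continuous_map_cube_weight:
  assumes "\<And>i. continuous_map X euclideanreal (\<lambda>x. x i)" "S \<in> faces n"
  shows "continuous_map X euclideanreal (cube_weight n S)"
proof -
  have a: "continuous_map X euclideanreal (\<lambda>x. \<bar>x i\<bar>)" for i
    using assms(1) by (intro continuous_map_real_abs)
  show ?thesis unfolding cube_weight_def[abs_def]
    by (intro continuous_map_real_max continuous_map_diff continuous_map_Min continuous_map_Max_insert a)
       (use facesD[OF assms(2)] in auto)
qed

text \<open>On the chamber \<open>x 0 > x 1 > ... > x (n - 1) > 0\<close> the gap at
  \<open>{..k}\<close> lies between neighbouring coordinates, so the weights invert the passage to
  partial sums. The entry \<open>x n = 0\<close> is a sentinel: for \<open>k = n - 1\<close> no
  coordinate is left outside \<open>{..k}\<close> and the maximum is the inserted 0.\<close>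

lemma cube_weight_flag:
  assumes dec: "\<And>k. k < n \<Longrightarrow> x (Suc k) < x k" and "x n = 0"
  shows "k < n \<Longrightarrow> 0 < x k" and "k < n \<Longrightarrow> cube_weight n {..k} x = x k - x (Suc k)"
proof -
  have mono: "x l \<le> x k" if "k \<le> l" "l \<le> n" for k l
    using that
  proof (induction l rule: dec_induct)
    case (step m) then show ?case using dec[of m] by auto
  qed simp
  have pos: "0 < x k" if "k < n" for k
    using mono[of "Suc k" n] dec[of k] assms(2) that by auto
  show "k < n \<Longrightarrow> 0 < x k" by (rule pos)
  assume k: "k < n"
  have "Min ((\<lambda>i. \<bar>x i\<bar>) ` {..k}) = x k"
  proof (rule Min_eqI)
    show "x k \<in> (\<lambda>i. \<bar>x i\<bar>) ` {..k}"
      using pos[OF k] by (auto simp: image_iff intro!: bexI[of _ k])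
  qed (use k mono in \<open>auto intro: order_trans[OF mono abs_ge_self]\<close>)
  moreover have "Max (insert 0 ((\<lambda>i. \<bar>x i\<bar>) ` ({..<n} - {..k}))) = x (Suc k)"
  proof (rule Max_eqI)
    fix y assume "y \<in> insert 0 ((\<lambda>i. \<bar>x i\<bar>) ` ({..<n} - {..k}))"
    then consider "y = 0" | j where "j < n" "Suc k \<le> j" "y = \<bar>x j\<bar>" by fastforce
    then show "y \<le> x (Suc k)"
    proof cases
      case 1
      then show ?thesis using mono[of "Suc k" n] k \<open>x n = 0\<close> by simp
    next
      case 2
      then show ?thesis using mono[of "Suc k" j] pos[of j] by simp
    qed
  next
    show "x (Suc k) \<in> insert 0 ((\<lambda>i. \<bar>x i\<bar>) ` ({..<n} - {..k}))"
    proof (cases "Suc k = n")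
      case False
      then have "x (Suc k) = \<bar>x (Suc k)\<bar>" "Suc k \<in> {..<n} - {..k}" using pos[of "Suc k"] k by auto
      then show ?thesis by blast
    qed (use assms in simp)
  qed simp
  ultimately show "cube_weight n {..k} x = x k - x (Suc k)"
    using dec[OF k] by (simp add: cube_weight_def del: Max_insert)
qed

lemma nsphere_nonzero:
  assumes "x \<in> topspace (nsphere q)"
  shows "\<exists>i<Suc q. x i \<noteq> 0"
proof -
  have "(\<Sum>i\<le>q. (x i)\<^sup>2) = 1" using assms by (auto simp: nsphere)
  then show ?thesis
    by (metis (no_types, lifting) atMost_iff le_imp_less_Suc power_zero_numeral sum.neutral zero_neq_one)
qed

lemma closedin_nonpos_finite:
  assumes "\<And>i. i \<in> F \<Longrightarrow> continuous_map X euclideanreal (g i)"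
  shows "closedin X {x \<in> topspace X. \<forall>i\<in>F. g i x \<le> 0}"
proof (cases "F = {}")
  case False
  have "closedin X (\<Inter>i\<in>F. {x \<in> topspace X. g i x \<in> {..0}})"
    using False assms by (intro closedin_INT closedin_continuous_map_preimage[where Y = euclideanreal]) auto
  moreover have "(\<Inter>i\<in>F. {x \<in> topspace X. g i x \<in> {..0}}) = {x \<in> topspace X. \<forall>i\<in>F. g i x \<le> 0}"
    using False by auto
  ultimately show ?thesis by simp
qed auto

lemma weights_in_closed_simplex:
  fixes w :: "'s \<Rightarrow> real" and V :: "'s \<Rightarrow> 'v"
  assumes "finite F" "\<And>S. S \<in> F \<Longrightarrow> 0 \<le> w S" "0 < (\<Sum>S\<in>F. w S)"
    and "C \<subseteq> F" "\<And>S. S \<in> F - C \<Longrightarrow> w S = 0"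
  shows "(\<lambda>v. (\<Sum>S\<in>F. if V S = v then w S else 0) / (\<Sum>S\<in>F. w S)) \<in> closed_simplex (V ` C)"
proof -
  have fC: "finite C" using assms finite_subset by blast
  have "(\<Sum>v\<in>V ` C. \<Sum>S\<in>F. if V S = v then w S else 0) = (\<Sum>S\<in>F. \<Sum>v\<in>V ` C. if V S = v then w S else 0)"
    by (rule sum.swap)
  also have "\<dots> = (\<Sum>S\<in>F. w S)"
    using fC assms(5) by (intro sum.cong) (auto simp: sum.delta')
  finally have "(\<Sum>v\<in>V ` C. (\<Sum>S\<in>F. if V S = v then w S else 0) / (\<Sum>S\<in>F. w S)) = 1"
    using assms(3) by (simp flip: sum_divide_distrib)
  moreover have "(\<Sum>S\<in>F. if V S = v then w S else 0) = 0" if "v \<notin> V ` C" for v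
    using that assms(5) by (intro sum.neutral) (auto simp: image_iff)
  moreover have "0 \<le> (\<Sum>S\<in>F. if V S = v then w S else 0)" for v
    using assms(2) by (intro sum_nonneg) auto
  ultimately show ?thesis
    using assms(3) by (auto simp: closed_simplex_def)
qed

lemma cube_map_in_closed_simplex:
  assumes "x \<in> topspace (nsphere q)"
  shows "cube_map (Suc q) V x \<in> closed_simplex ((\<lambda>S. V S (\<lambda>i. 0 < x i)) ` {S \<in> faces (Suc q). 0 < cube_weight (Suc q) S x})"
proof -
  obtain i where i: "i < Suc q" "x i \<noteq> 0" using nsphere_nonzero[OF assms] by auto
  show ?thesis
    unfolding cube_map_def[abs_def]
    by (rule weights_in_closed_simplex)
       (use cube_weight_sum_pos[of i "Suc q" x, OF i] in \<open>auto simp: cube_weight_nonneg order_antisym not_less\<close>)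
qed

text \<open>Signs jump, and in the weak topology continuity of the coordinates does not suffice.
  Hence the sphere is covered by finitely many closed pieces, one for each sign pattern
  \<open>E\<close> and chain \<open>C\<close>; on a piece the map takes values in a single closed
  simplex, where coordinates do suffice, and the pieces are pasted.\<close>

lemma continuous_map_cube_map:
  fixes V :: "nat set \<Rightarrow> (nat \<Rightarrow> bool) \<Rightarrow> 'v"
  assumes V_cong: "\<And>S e e'. S \<in> faces (Suc q) \<Longrightarrow> (\<And>i. i \<in> S \<Longrightarrow> e i = e' i) \<Longrightarrow> V S e = V S e'"
    and simplex: "\<And>C e. C \<subseteq> faces (Suc q) \<Longrightarrow> C \<noteq> {} \<Longrightarrow> chain\<^sub>\<subseteq> C \<Longrightarrow> (\<lambda>S. V S e) ` C \<in> K"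
  shows "continuous_map (nsphere q) (realization K) (cube_map (Suc q) V)"
proof -
  let ?n = "Suc q" and ?X = "nsphere q"
  define J where "J = Pow {..<?n} \<times> {C. C \<subseteq> faces ?n \<and> C \<noteq> {} \<and> chain\<^sub>\<subseteq> C}"
  \<comment> \<open>Weak inequalities make the pieces closed; a point with a zero coordinate lies in
    pieces of both signs.\<close>
  define T where "T = (\<lambda>(E, C). {x \<in> topspace ?X. \<forall>i\<in>{..<?n}. (if i \<in> E then - x i else x i) \<le> 0}
      \<inter> {x \<in> topspace ?X. \<forall>S\<in>faces ?n - C. cube_weight ?n S x \<le> 0})"
  have proj: "continuous_map ?X euclideanreal (\<lambda>x. x i)" for i
    by (rule continuous_map_nsphere_projection)
  have cw: "continuous_map ?X euclideanreal (cube_weight ?n S)" if "S \<in> faces ?n" for S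
    using proj that by (rule continuous_map_cube_weight)
  have "finite {C. C \<subseteq> faces ?n \<and> C \<noteq> {} \<and> chain\<^sub>\<subseteq> C}"
    by (rule finite_subset[of _ "Pow (faces ?n)"]) auto
  then have fJ: "finite J" by (simp add: J_def)
  show ?thesis
  proof (rule pasting_lemma_closed[where I = J and T = T and f = "\<lambda>_. cube_map ?n V"])
    show "closedin ?X (T i)" for i
    proof (cases i)
      case (Pair E C)
      have "continuous_map ?X euclideanreal (\<lambda>x. if i \<in> E then - x i else x i)" for i
        using proj[of i] by (cases "i \<in> E") (auto intro: continuous_map_minus)
      then show ?thesis
        unfolding T_def Pair prod.case
        by (intro closedin_Int closedin_nonpos_finite cw) auto
    qed
  next
    fix i assume "i \<in> J"
    then obtain E C where i: "i = (E, C)" and E: "E \<subseteq> {..<?n}" and C: "C \<subseteq> faces ?n" "C \<noteq> {}" "chain\<^sub>\<subseteq> C"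
      by (auto simp: J_def)
    define g where "g = (\<lambda>x v. (\<Sum>S\<in>faces ?n. if V S (\<lambda>i. i \<in> E) = v then cube_weight ?n S x else 0) / (\<Sum>S\<in>faces ?n. cube_weight ?n S x))"
    let ?\<sigma> = "(\<lambda>S. V S (\<lambda>i. i \<in> E)) ` C"
    let ?Y = "subtopology ?X (T i)"
    have tot: "0 < (\<Sum>S\<in>faces ?n. cube_weight ?n S x)" if "x \<in> topspace ?X" for x
      using nsphere_nonzero[OF that] cube_weight_sum_pos by blast
    have gx: "cube_map ?n V x v = g x v" if x: "x \<in> topspace ?Y" for x v
    proof -
      \<comment> \<open>Only sets of positive weight contribute. They contain no zero coordinate, so
        on them \<open>E\<close> gives the true signs and the value of \<open>0 < x i\<close> at
        zero is irrelevant.\<close>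
      have "V S (\<lambda>i. 0 < x i) = V S (\<lambda>i. i \<in> E)" if "S \<in> faces ?n" "cube_weight ?n S x \<noteq> 0" for S
      proof (rule V_cong[OF that(1)])
        fix j assume j: "j \<in> S"
        have "0 < cube_weight ?n S x" using that cube_weight_nonneg[of ?n S x] by linarith
        then have "x j \<noteq> 0" using j by (simp add: cube_weight_pos_iff that)
        moreover have "j < ?n" using j facesD[OF that(1)] by auto
        then have "(if j \<in> E then - x j else x j) \<le> 0" using x by (simp add: T_def i)
        ultimately show "(0 < x j) = (j \<in> E)" by (auto split: if_splits)
      qed
      then show ?thesis
        unfolding cube_map_def g_def by (intro arg_cong2[where f = "(/)"] sum.cong) (auto, metis+)
    qed
    have "continuous_map ?Y (top_of_set (closed_simplex ?\<sigma>)) g"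
    proof (rule continuous_map_into_closed_simplex)
      fix v
      have cw': "continuous_map ?Y euclideanreal (cube_weight ?n S)" if "S \<in> faces ?n" for S
        using cw[OF that] by (rule continuous_map_from_subtopology)
      have "continuous_map ?Y euclideanreal (\<lambda>x. if V S (\<lambda>i. i \<in> E) = v then cube_weight ?n S x else 0)" if "S \<in> faces ?n" for S
        using cw'[OF that] by (cases "V S (\<lambda>i. i \<in> E) = v") (auto simp: eta_contract_eq)
      then show "continuous_map ?Y euclideanreal (\<lambda>x. g x v)"
        unfolding g_def using tot cw'
        by (intro continuous_map_real_divide continuous_map_sum) (auto simp: less_le)
    next
      fix x assume x: "x \<in> topspace ?Y"
      then show "g x \<in> closed_simplex ?\<sigma>"
        unfolding g_def using tot C
        by (intro weights_in_closed_simplex) (auto simp: cube_weight_nonneg T_def i order_antisym)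
    qed
    then have "continuous_map ?Y (realization K) (id \<circ> g)"
      by (rule continuous_map_compose) (intro continuous_map_closed_simplex_realization simplex C)
    then show "continuous_map ?Y (realization K) (cube_map ?n V)"
      by (rule continuous_map_eq) (auto simp: gx)
  next
    fix x assume x: "x \<in> topspace ?X"
    let ?j = "({i. i < ?n \<and> 0 < x i}, {S \<in> faces ?n. 0 < cube_weight ?n S x})"
    have ne: "\<exists>S\<in>faces ?n. 0 < cube_weight ?n S x"
      using nsphere_nonzero[OF x] cube_weight_support_nonempty[of _ ?n x] by blast
    have "?j \<in> J"
      using chain_cube_weight_support[of ?n x] ne by (auto simp: J_def)
    moreover have "x \<in> T ?j" using x by (auto simp: T_def)
    ultimately show "\<exists>j. j \<in> J \<and> x \<in> T j \<and> cube_map ?n V x = cube_map ?n V x" by blast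
  qed (use fJ in auto)
qed

section \<open>Orbit weights and the collapse onto a sphere\<close>

definition label_weight :: "('v \<Rightarrow> bool) \<Rightarrow> ('v \<Rightarrow> real) \<Rightarrow> real" where
  "label_weight Q t = (\<Sum>v | t v \<noteq> 0 \<and> Q v. t v)"

lemma label_weight_cube_map:
  assumes x: "x \<in> topspace (nsphere q)"
  shows "label_weight Q (cube_map (Suc q) V x) =
    (\<Sum>S\<in>faces (Suc q). if Q (V S (\<lambda>i. 0 < x i)) then cube_weight (Suc q) S x else 0) / (\<Sum>S\<in>faces (Suc q). cube_weight (Suc q) S x)"
proof -
  let ?F = "faces (Suc q)" and ?w = "\<lambda>S. cube_weight (Suc q) S x" and ?V = "\<lambda>S. V S (\<lambda>i. 0 < x i)"
  let ?\<sigma> = "?V ` {S \<in> ?F. 0 < ?w S}"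
  have w0: "?w S = 0" if "\<not> 0 < ?w S" for S
    using that cube_weight_nonneg[of "Suc q" S x] by linarith
  have f: "finite ?\<sigma>" by simp
  have "label_weight Q (cube_map (Suc q) V x) = (\<Sum>v\<in>?\<sigma>. if Q v then cube_map (Suc q) V x v else 0)"
    unfolding label_weight_def using cube_map_in_closed_simplex[OF x] f by (rule closed_simplex_sum_if)
  also have "\<dots> = (\<Sum>v\<in>?\<sigma>. \<Sum>S\<in>?F. if Q v \<and> ?V S = v then ?w S else 0) / (\<Sum>S\<in>?F. ?w S)"
    unfolding cube_map_def sum_divide_distrib[of _ ?\<sigma>] by (intro sum.cong) auto
  also have "(\<Sum>v\<in>?\<sigma>. \<Sum>S\<in>?F. if Q v \<and> ?V S = v then ?w S else 0) = (\<Sum>S\<in>?F. \<Sum>v\<in>?\<sigma>. if Q v \<and> ?V S = v then ?w S else 0)"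
    by (rule sum.swap)
  also have "\<dots> = (\<Sum>S\<in>?F. if Q (?V S) then ?w S else 0)"
  proof (rule sum.cong)
    fix S assume S: "S \<in> ?F"
    have "(\<Sum>v\<in>?\<sigma>. if Q v \<and> ?V S = v then ?w S else 0) = (\<Sum>v\<in>?\<sigma>. if ?V S = v then (if Q v then ?w S else 0) else 0)"
      by (intro sum.cong) auto
    also have "\<dots> = (if ?V S \<in> ?\<sigma> then (if Q (?V S) then ?w S else 0) else 0)"
      using f by (rule sum.delta')
    also have "\<dots> = (if Q (?V S) then ?w S else 0)"
      using w0[of S] S by auto
    finally show "(\<Sum>v\<in>?\<sigma>. if Q v \<and> ?V S = v then ?w S else 0) = (if Q (?V S) then ?w S else 0)" .
  qed simp
  finally show ?thesis .
qed

text \<open>Infinitely many vertices may carry the label, so this is no finite sum of coordinates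
  globally; on each closed simplex it is, and the weak topology asks for no more.\<close>

lemma continuous_map_label_weight:
  assumes "\<And>\<sigma>. \<sigma> \<in> K \<Longrightarrow> finite \<sigma>"
  shows "continuous_map (realization K) euclideanreal (label_weight Q)"
proof (rule continuous_map_from_realization)
  fix \<sigma> assume \<sigma>: "\<sigma> \<in> K"
  have "continuous_map (top_of_set (closed_simplex \<sigma>)) euclideanreal (\<lambda>t. if Q v then t v else 0)" for v
    using continuous_map_closed_simplex_coordinate by (cases "Q v") auto
  then have "continuous_map (top_of_set (closed_simplex \<sigma>)) euclideanreal (\<lambda>t. \<Sum>v\<in>\<sigma>. if Q v then t v else 0)"
    using assms[OF \<sigma>] by (intro continuous_map_sum) auto
  then show "continuous_map (top_of_set (closed_simplex \<sigma>)) euclideanreal (label_weight Q)"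
    by (rule continuous_map_eq) (auto simp: label_weight_def closed_simplex_sum_if assms[OF \<sigma>])
qed

lemma label_weight_nonneg:
  assumes "t \<in> topspace (realization K)"
  shows "0 \<le> label_weight Q t"
  using assms by (auto simp: label_weight_def topspace_realization closed_simplex_def intro: sum_nonneg)

text \<open>In cube coordinates the point of a chamber with barycentric coordinates \<open>s\<close> has entries
  \<open>x\<^sub>i = s\<^sub>i + \<dots> + s\<^sub>n\<^sub>-\<^sub>1\<close>. With \<open>c\<close> the barycenter, the collapse sends it to the direction of
  \<open>2 n (min s) x - c\<close>, which is \<open>-c\<close> on the boundary and never a nonpositive multiple of \<open>x\<close>.\<close>

definition flag_vec :: "nat \<Rightarrow> (nat \<Rightarrow> real) \<Rightarrow> nat \<Rightarrow> real" where
  "flag_vec n s i = (if i < n then 2 * real n * Min (s ` {..<n}) * (\<Sum>k\<in>{i..<n}. s k) - real (n - i) / real n else 0)"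

lemma flag_vec_degenerate:
  assumes "0 < n" "\<And>k. k < n \<Longrightarrow> 0 \<le> s k" "k < n" "s k \<le> 0"
  shows "flag_vec n s = (\<lambda>i. if i < n then - (real (n - i) / real n) else 0)"
proof -
  have "s k = 0" using assms by force
  then have "Min (s ` {..<n}) = 0"
    using assms by (intro Min_eqI) (auto simp: image_iff intro!: bexI[of _ k])
  then show ?thesis by (auto simp: flag_vec_def)
qed

text \<open>Serves twice: \<open>u = 0\<close> shows that the vector can be normalized, and
  \<open>u = c x\<close> that it is no nonpositive multiple of \<open>x\<close>. Suppose it equals
  \<open>- u\<close>. If some \<open>s k\<close> vanishes, then \<open>u\<close> is the barycenter,
  and \<open>v\<close> makes all \<open>s k\<close> positive. If all are positive, then
  \<open>u = c x\<close> with \<open>x\<close> the partial sums of \<open>s\<close>, so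
  \<open>x\<close> is proportional to the barycenter and every \<open>s k\<close> is
  \<open>1 / n\<close>. There the factor \<open>2 n (min s)\<close> is 2, which is too large; any
  constant above \<open>n\<close> would serve in place of \<open>2 n\<close>.\<close>

lemma flag_vec_neq:
  fixes s u :: "nat \<Rightarrow> real" and n :: nat
  assumes n: "0 < n" and s0: "\<And>k. k < n \<Longrightarrow> 0 \<le> s k"
    and sum1: "(\<And>k. k < n \<Longrightarrow> 0 < s k) \<Longrightarrow> (\<Sum>k<n. s k) = 1"
    and u: "(\<And>k. k < n \<Longrightarrow> 0 < s k) \<Longrightarrow> \<exists>c\<ge>0. \<forall>k<n. u k = c * (\<Sum>j\<in>{k..<n}. s j)"
    and v: "(\<And>k. k < n \<Longrightarrow> u k = real (n - k) / real n) \<Longrightarrow> (\<And>k. k < n \<Longrightarrow> 0 < s k)"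
  shows "\<exists>i<n. flag_vec n s i \<noteq> - u i"
proof (rule ccontr)
  assume "\<not> ?thesis"
  then have eq: "flag_vec n s i = - u i" if "i < n" for i using that by blast
  have pos: "0 < s k" if "k < n" for k
  proof (rule ccontr)
    assume "\<not> 0 < s k"
    then have "flag_vec n s = (\<lambda>i. if i < n then - (real (n - i) / real n) else 0)"
      using that by (intro flag_vec_degenerate[OF n s0 that]) auto
    then have "u k = real (n - k) / real n" if "k < n" for k using eq[OF that] that by simp
    from v[OF this] that \<open>\<not> 0 < s k\<close> show False by blast
  qed
  obtain c where c: "c \<ge> 0" "\<And>k. k < n \<Longrightarrow> u k = c * (\<Sum>j\<in>{k..<n}. s j)" using u pos by blast
  define m where "m = Min (s ` {..<n})"
  have e: "(2 * real n * m + c) * (\<Sum>k\<in>{i..<n}. s k) = real (n - i) / real n" if "i < n" for i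
    using eq[OF that] c(2)[OF that] that by (simp add: flag_vec_def m_def algebra_simps)
  \<comment> \<open>Coordinate 0, where the partial sum and the entry of the barycenter are both
    1.\<close>
  have one: "2 * real n * m + c = 1"
    using e[OF n] sum1 pos n by (simp add: atLeast0LessThan)
  \<comment> \<open>Differences of neighbouring coordinates.\<close>
  have s: "s k = 1 / real n" if "k < n" for k
  proof (cases "Suc k < n")
    case True
    have "(\<Sum>j\<in>{k..<n}. s j) = s k + (\<Sum>j\<in>{Suc k..<n}. s j)"
      using that by (simp add: sum.atLeast_Suc_lessThan)
    then show ?thesis using e[OF that] e[OF True] one that True
      by (simp add: of_nat_diff diff_divide_distrib add_divide_distrib)
  next
    case False
    then have "n = Suc k" using that by simp
    then show ?thesis using e[OF that] one by simp
  qed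
  have "m \<in> s ` {..<n}" unfolding m_def using n by (intro Min_in) auto
  then have "m = 1 / real n" using s by auto
  with one c(1) n show False by simp
qed

text \<open>The topological half, for any complex and any orbit map. \<open>P i k\<close> marks the
  orbit of vertex \<open>k\<close> of chamber \<open>i\<close>. By \<open>inv\<close> the collapse
  for \<open>i\<close> descends to the quotient; by \<open>full\<close> its weights sum to 1
  wherever all are positive. By \<open>own\<close> the apartment of \<open>i\<close> carries these
  labels only on the standard chamber with positive signs, which gives degree 1. By
  \<open>off\<close> the apartment of \<open>j\<close> lacks a label of \<open>i\<close>, so there
  the collapse is constant.\<close>

theorem card_le_rank_quotient_if_flags:
  fixes V :: "'i \<Rightarrow> nat set \<Rightarrow> (nat \<Rightarrow> bool) \<Rightarrow> 'v" and P :: "'i \<Rightarrow> nat \<Rightarrow> 'v \<Rightarrow> bool"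
    and orb :: "('v \<Rightarrow> real) \<Rightarrow> 'o"
  assumes I: "finite I" and n: "n = Suc q"
    and fin: "\<And>\<sigma>. \<sigma> \<in> K \<Longrightarrow> finite \<sigma>"
    and V_cong: "\<And>i S e e'. i \<in> I \<Longrightarrow> S \<in> faces n \<Longrightarrow> (\<And>j. j \<in> S \<Longrightarrow> e j = e' j) \<Longrightarrow> V i S e = V i S e'"
    and simplex: "\<And>i C e. i \<in> I \<Longrightarrow> C \<subseteq> faces n \<Longrightarrow> C \<noteq> {} \<Longrightarrow> chain\<^sub>\<subseteq> C \<Longrightarrow> (\<lambda>S. V i S e) ` C \<in> K"
    and own: "\<And>i k S e. i \<in> I \<Longrightarrow> k < n \<Longrightarrow> S \<in> faces n \<Longrightarrow> P i k (V i S e) \<longleftrightarrow> S = {..k} \<and> (\<forall>j\<le>k. e j)"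
    and off: "\<And>i j. i \<in> I \<Longrightarrow> j \<in> I \<Longrightarrow> i \<noteq> j \<Longrightarrow> \<exists>k<n. \<forall>S\<in>faces n. \<forall>e. \<not> P i k (V j S e)"
    and inv: "\<And>x y i k. x \<in> topspace (realization K) \<Longrightarrow> y \<in> topspace (realization K) \<Longrightarrow> orb x = orb y
        \<Longrightarrow> i \<in> I \<Longrightarrow> k < n \<Longrightarrow> label_weight (P i k) x = label_weight (P i k) y"
    and full: "\<And>i \<sigma> v. i \<in> I \<Longrightarrow> \<sigma> \<in> K \<Longrightarrow> (\<And>k. k < n \<Longrightarrow> \<exists>v\<in>\<sigma>. P i k v) \<Longrightarrow> v \<in> \<sigma> \<Longrightarrow> \<exists>!k. k < n \<and> P i k v"
  shows "enat (card I) \<le> abelian_rank (reduced_homology_group (int q) (quotient_topology (realization K) orb))"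
proof -
  let ?R = "realization K"
  let ?X = "quotient_topology ?R orb"
  define s where "s = (\<lambda>i t k. label_weight (P i k) t)"
  define \<psi> where "\<psi> = (\<lambda>i t. sphere_proj q (flag_vec n (s i t)))"
  have n0: "0 < n" using n by simp
  have s0: "0 \<le> s i t k" if "t \<in> topspace ?R" for i t k
    using that by (auto simp: s_def intro: label_weight_nonneg)
  have sum1: "(\<Sum>k<n. s i t k) = 1" if i: "i \<in> I" and t: "t \<in> topspace ?R" and pos: "\<And>k. k < n \<Longrightarrow> 0 < s i t k" for i t
  proof -
    obtain \<sigma> where \<sigma>: "\<sigma> \<in> K" "t \<in> closed_simplex \<sigma>" using t by (auto simp: topspace_realization)
    have st: "s i t k = (\<Sum>v\<in>\<sigma>. if P i k v then t v else 0)" for k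
      unfolding s_def label_weight_def using \<sigma> fin by (intro closed_simplex_sum_if) auto
    have "\<exists>v\<in>\<sigma>. P i k v" if "k < n" for k
    proof (rule ccontr)
      assume "\<not> ?thesis"
      then have "s i t k = 0" unfolding st by (intro sum.neutral) auto
      with pos[OF that] show False by simp
    qed
    from full[OF i \<sigma>(1) this] have u: "\<exists>!k. k < n \<and> P i k v" if "v \<in> \<sigma>" for v using that by blast
    have "(\<Sum>k<n. s i t k) = (\<Sum>v\<in>\<sigma>. \<Sum>k<n. if P i k v then t v else 0)"
      unfolding st by (rule sum.swap)
    also have "\<dots> = (\<Sum>v\<in>\<sigma>. t v)"
    proof (rule sum.cong)
      fix v assume "v \<in> \<sigma>"
      from u[OF this] obtain l where l: "l < n" "P i l v" "\<And>k. k < n \<Longrightarrow> P i k v \<Longrightarrow> k = l" by blast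
      have Pl: "P i k v \<longleftrightarrow> k = l" if "k < n" for k using l that by blast
      have "(\<Sum>k<n. if P i k v then t v else 0) = (\<Sum>k<n. if k = l then t v else 0)"
        by (rule sum.cong) (simp_all add: Pl)
      then show "(\<Sum>k<n. if P i k v then t v else 0) = t v" using l(1) by simp
    qed simp
    finally show ?thesis using \<sigma>(2) by (simp add: closed_simplex_def)
  qed
  have scont: "continuous_map ?R euclideanreal (\<lambda>t. s i t k)" for i k
    unfolding s_def using continuous_map_label_weight[OF fin] by simp
  have fcont: "continuous_map ?R euclideanreal (\<lambda>t. flag_vec n (s i t) j)" for i j
  proof (cases "j < n")
    case True
    have "continuous_map ?R euclideanreal (\<lambda>t. 2 * real n * Min ((\<lambda>k. s i t k) ` {..<n}) * (\<Sum>k\<in>{j..<n}. s i t k) - real (n - j) / real n)"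
      using n0 by (intro continuous_map_diff continuous_map_real_mult continuous_map_Min continuous_map_sum scont) auto
    then show ?thesis using True by (simp add: flag_vec_def)
  qed (simp add: flag_vec_def)
  have \<psi>cont: "continuous_map ?R (nsphere q) (\<psi> i)" if i: "i \<in> I" for i
    unfolding \<psi>_def
  proof (rule continuous_map_sphere_proj[OF fcont])
    fix t assume t: "t \<in> topspace ?R"
    have "\<exists>j<n. flag_vec n (s i t) j \<noteq> - 0"
    proof (rule flag_vec_neq[OF n0 s0[OF t] sum1[OF i t], where u = "\<lambda>_. 0"])
      show "\<exists>c\<ge>0. \<forall>k<n. 0 = c * (\<Sum>j\<in>{k..<n}. s i t j)" by (intro exI[of _ 0]) auto
      show "0 < s i t k" if "\<And>k. k < n \<Longrightarrow> 0 = real (n - k) / real n" for k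
        using that[OF n0] n0 by simp
    qed
    then show "\<exists>j\<le>q. flag_vec n (s i t) j \<noteq> 0" by (auto simp: n less_Suc_eq_le)
  qed (auto simp: flag_vec_def n)
  have "\<exists>\<phi>. continuous_map ?X (nsphere q) \<phi> \<and> (\<forall>t\<in>topspace ?R. \<phi> (orb t) = \<psi> i t)" if i: "i \<in> I" for i
  proof -
    have "\<psi> i x = \<psi> i y" if xy: "x \<in> topspace ?R" "y \<in> topspace ?R" "orb x = orb y" for x y
    proof -
      have "s i x k = s i y k" if "k < n" for k using inv[OF xy i that] by (simp add: s_def)
      then have "s i x ` {..<n} = s i y ` {..<n}" "\<And>j. sum (s i x) {j..<n} = sum (s i y) {j..<n}"
        by (auto intro!: image_cong sum.cong)
      then have "flag_vec n (s i x) = flag_vec n (s i y)"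
        by (intro ext) (simp add: flag_vec_def)
      then show ?thesis by (simp add: \<psi>_def)
    qed
    note inv_\<psi> = this
    show ?thesis
    proof (rule quotient_map_lift_exists[OF quotient_map_quotient_topology[of ?R orb] \<psi>cont[OF i]])
      show "\<psi> i x = \<psi> i y" if "x \<in> topspace ?R" "y \<in> topspace ?R" "orb x = orb y" for x y
        using that by (rule inv_\<psi>)
    next
      fix g assume "continuous_map ?X (nsphere q) g" "\<And>x. x \<in> topspace ?R \<Longrightarrow> g (orb x) = \<psi> i x"
      then show ?thesis by blast
    qed
  qed
  then obtain \<phi> where \<phi>: "\<And>i. i \<in> I \<Longrightarrow> continuous_map ?X (nsphere q) (\<phi> i)"
    "\<And>i t. i \<in> I \<Longrightarrow> t \<in> topspace ?R \<Longrightarrow> \<phi> i (orb t) = \<psi> i t" by metis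
  let ?\<alpha> = "\<lambda>i. orb \<circ> cube_map n (V i)"
  have ccont: "continuous_map (nsphere q) ?R (cube_map n (V i))" if "i \<in> I" for i
    unfolding n using V_cong simplex that unfolding n by (intro continuous_map_cube_map) blast+
  have cR: "cube_map n (V i) x \<in> topspace ?R" if "i \<in> I" "x \<in> topspace (nsphere q)" for i x
    using ccont[OF that(1)] that(2) by (auto simp: continuous_map_def)
  have sc: "s i (cube_map n (V j) x) k = (\<Sum>S\<in>faces n. if P i k (V j S (\<lambda>i. 0 < x i)) then cube_weight n S x else 0)
      / (\<Sum>S\<in>faces n. cube_weight n S x)" if "x \<in> topspace (nsphere q)" for i j x k
    unfolding s_def n by (rule label_weight_cube_map[OF that])
  show ?thesis
  proof (rule card_le_rank_reduced_homology_if_sphere_maps[OF I, where \<alpha> = ?\<alpha> and \<phi> = \<phi>])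
    show "continuous_map (nsphere q) ?X (?\<alpha> i)" if "i \<in> I" for i
      using ccont[OF that] quotient_imp_continuous_map[OF quotient_map_quotient_topology] by (rule continuous_map_compose)
    show "Brouwer_degree2 q (\<phi> i \<circ> ?\<alpha> j) = 0" if ij: "i \<in> I" "j \<in> I" "i \<noteq> j" for i j
    proof -
      obtain k where k: "k < n" "\<And>S e. S \<in> faces n \<Longrightarrow> \<not> P i k (V j S e)" using off[OF ij] by blast
      have "(\<phi> i \<circ> ?\<alpha> j) x = sphere_proj q (\<lambda>i. if i < n then - (real (n - i) / real n) else 0)"
        if x: "x \<in> topspace (nsphere q)" for x
      proof -
        \<comment> \<open>A label of weight 0 throughout puts the whole apartment on the boundary of
          the open cell, which is sent to one point.\<close>
        have "s i (cube_map n (V j) x) k = 0" using k(2) by (simp add: sc[OF x] sum.neutral)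
        then show ?thesis
          using \<phi>(2)[OF ij(1) cR[OF ij(2) x]] flag_vec_degenerate[OF n0 s0[OF cR[OF ij(2) x]] k(1)]
          by (simp add: \<psi>_def)
      qed
      then have "Brouwer_degree2 q (\<phi> i \<circ> ?\<alpha> j) = Brouwer_degree2 q (\<lambda>x. sphere_proj q (\<lambda>i. if i < n then - (real (n - i) / real n) else 0))"
        by (rule Brouwer_degree2_eq)
      then show ?thesis by (simp only: Brouwer_degree2_const)
    qed
    show "Brouwer_degree2 q (\<phi> i \<circ> ?\<alpha> i) = 1" if i: "i \<in> I" for i
    proof -
      define f where "f = (\<lambda>x. flag_vec n (s i (cube_map n (V i) x)))"
      have "Brouwer_degree2 q (\<lambda>x. sphere_proj q (f x)) = 1"
      proof (rule Brouwer_degree2_sphere_proj_eq_1)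
        show "continuous_map (nsphere q) euclideanreal (\<lambda>x. f x j)" for j
          using continuous_map_compose[OF ccont[OF i] fcont[of i j]] by (simp add: f_def o_def)
        show "f x j = 0" if "j > q" for x j
          using that by (simp add: f_def flag_vec_def n)
      next
        fix x and c :: real assume x: "x \<in> topspace (nsphere q)" and c: "0 \<le> c"
        let ?t = "cube_map n (V i) x"
        define T where "T = (\<Sum>S\<in>faces n. cube_weight n S x)"
        have T: "0 < T"
          unfolding T_def using nsphere_nonzero[OF x] cube_weight_sum_pos[of _ n x] by (auto simp: n)
        have xn: "x n = 0" using x by (auto simp: nsphere n)
        \<comment> \<open>By \<open>own\<close> only the face \<open>{..k}\<close> with positive
          signs contributes to label \<open>k\<close>.\<close>
        have st: "s i ?t k = (if \<forall>j\<le>k. 0 < x j then cube_weight n {..k} x else 0) / T" if k: "k < n" for k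
        proof -
          have "(\<Sum>S\<in>faces n. if P i k (V i S (\<lambda>i. 0 < x i)) then cube_weight n S x else 0)
              = (\<Sum>S\<in>faces n. if S = {..k} then (if \<forall>j\<le>k. 0 < x j then cube_weight n {..k} x else 0) else 0)"
            using own[OF i k] by (intro sum.cong) auto
          moreover have "{..k} \<in> faces n" using k by (auto simp: faces_def)
          ultimately show ?thesis by (simp add: sc[OF x] T_def)
        qed
        have "\<exists>j<n. flag_vec n (s i ?t) j \<noteq> - (c * x j)"
        proof (rule flag_vec_neq[OF n0 s0[OF cR[OF i x]] sum1[OF i cR[OF i x]]])
          assume pos: "\<And>k. k < n \<Longrightarrow> 0 < s i ?t k"
          have xpos: "0 < x j" if "j < n" for j
            using pos[OF that] st[OF that] by (auto split: if_splits)
          have cwpos: "0 < cube_weight n {..k} x" if "k < n" for k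
            using pos[OF that] st[OF that] T by (auto split: if_splits simp: zero_less_divide_iff)
          have dec: "x (Suc k) < x k" if k: "k < n" for k
          proof (cases "Suc k = n")
            case False
            moreover have "{..k} \<in> faces n" using k by (auto simp: faces_def)
            ultimately have "\<bar>x (Suc k)\<bar> < \<bar>x k\<bar>"
              using cwpos[OF k] k by (auto simp: cube_weight_pos_iff)
            then show ?thesis using xpos[OF k] by simp
          qed (use xpos k xn in simp)
          have sx: "s i ?t k = (x k - x (Suc k)) / T" if "k < n" for k
            using st[OF that] xpos that cube_weight_flag(2)[OF dec xn that] by auto
          \<comment> \<open>The gaps telescope: in the open cell \<open>x\<close> is
            \<open>T\<close> times the cube coordinates of its image, which gives the factor
            \<open>c * T\<close> below.\<close>
          have "(\<Sum>j\<in>{k..<n}. s i ?t j) = x k / T" if "k < n" for k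
          proof -
            have "(\<Sum>j\<in>{k..<n}. s i ?t j) = (\<Sum>j\<in>{k..<n}. x j - x (Suc j)) / T"
              unfolding sum_divide_distrib using sx by (intro sum.cong) auto
            also have "(\<Sum>j\<in>{k..<n}. x j - x (Suc j)) = x k - x n"
              using sum_Suc_diff'[of k n "\<lambda>j. - x j"] that by simp
            finally show ?thesis using xn by simp
          qed
          then show "\<exists>c'\<ge>0. \<forall>k<n. c * x k = c' * (\<Sum>j\<in>{k..<n}. s i ?t j)"
            using T c by (intro exI[of _ "c * T"]) auto
        next
          \<comment> \<open>If \<open>c x\<close> is the barycenter, then \<open>c > 0\<close> and
            \<open>x\<close> decreases strictly to 0, so \<open>x\<close> is in the open
            cell.\<close>
          fix k assume cx: "\<And>k. k < n \<Longrightarrow> c * x k = real (n - k) / real n" and k: "k < n"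
          have "c \<noteq> 0" using cx[OF n0] n0 by auto
          then have "c > 0" using c by simp
          then have xk: "x k = real (n - k) / real n / c" if "k < n" for k
          proof -
            have "x k = c * x k / c" using \<open>c > 0\<close> by simp
            then show ?thesis by (simp only: cx[OF that])
          qed
          have dec: "x (Suc k) < x k" if "k < n" for k
          proof (cases "Suc k = n")
            case False
            then show ?thesis using that \<open>c > 0\<close> n0 by (simp add: xk divide_strict_right_mono)
          qed (use xk[OF that] that \<open>c > 0\<close> n0 xn in simp)
          show "0 < s i ?t k"
            using st[OF k] cube_weight_flag[OF dec xn] k dec[OF k] T by auto
        qed (assumption+)
        then show "\<exists>j\<le>q. f x j \<noteq> - c * x j" by (auto simp: f_def n less_Suc_eq_le)
      qed
      moreover have "(\<phi> i \<circ> ?\<alpha> i) x = sphere_proj q (f x)" if "x \<in> topspace (nsphere q)" for x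
        using \<phi>(2)[OF i cR[OF i that]] by (simp add: f_def \<psi>_def)
      ultimately show ?thesis using Brouwer_degree2_eq by metis
    qed
  qed (use \<phi> in auto)
qed

section \<open>The principal congruence subgroup\<close>

lemma sum_lessThan_add:
  fixes f :: "nat \<Rightarrow> 'a::comm_monoid_add"
  shows "(\<Sum>i<m + n. f i) = (\<Sum>i<m. f i) + (\<Sum>i<n. f (m + i))"
  by (induction n) (auto simp: add.assoc)

text \<open>With functions in place of \<open>vec\<close>, integral vectors become rational by
  \<open>of_int\<close> and linear combinations are pointwise; only indices below
  \<open>2 * n\<close> are read.\<close>

definition sform :: "nat \<Rightarrow> (nat \<Rightarrow> 'a::comm_ring_1) \<Rightarrow> (nat \<Rightarrow> 'a) \<Rightarrow> 'a" where
  "sform n u v = (\<Sum>i<n. u i * v (n + i) - u (n + i) * v i)"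

definition mat_app :: "nat \<Rightarrow> int mat \<Rightarrow> (nat \<Rightarrow> 'a::comm_ring_1) \<Rightarrow> nat \<Rightarrow> 'a" where
  "mat_app m A f i = (\<Sum>k<m. of_int (A $$ (i, k)) * f k)"

lemma symp_form_vec: "symp_form n (vec (2*n) u) (vec (2*n) v) = sform n u v"
  by (simp add: symp_form_def sform_def)

lemma sform_cong:
  assumes "\<And>i. i < 2*n \<Longrightarrow> u i = u' i" "\<And>i. i < 2*n \<Longrightarrow> v i = v' i"
  shows "sform n u v = sform n u' v'"
  unfolding sform_def using assms by (intro sum.cong) auto

lemma sform_skew: "sform n u v = - sform n v u"
  unfolding sform_def by (simp add: algebra_simps flip: sum_negf)

lemma sform_self: "sform n u u = 0"
  unfolding sform_def by (simp add: algebra_simps)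

lemma sform_of_int: "sform n (\<lambda>i. of_int (u i)) (\<lambda>i. of_int (v i)) = of_int (sform n u v)"
  by (simp add: sform_def)

lemma sform_add_left: "sform n (\<lambda>i. a * u i + b * w i) v = a * sform n u v + b * sform n w v"
  unfolding sform_def sum_distrib_left sum.distrib[symmetric] by (intro sum.cong) (auto simp: algebra_simps)

lemma sform_add_right: "sform n v (\<lambda>i. a * u i + b * w i) = a * sform n v u + b * sform n v w"
  unfolding sform_def sum_distrib_left sum.distrib[symmetric] by (intro sum.cong) (auto simp: algebra_simps)

lemma sform_diff_left: "sform n (\<lambda>i. u i - w i) v = sform n u v - sform n w v"
  unfolding sform_def sum_subtractf[symmetric] by (intro sum.cong) (auto simp: algebra_simps)

lemma sform_sum_left: "sform n (\<lambda>i. \<Sum>j\<in>S. c j * g j i) v = (\<Sum>j\<in>S. c j * sform n (g j) v)"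
proof -
  have "(\<Sum>j\<in>S. c j * sform n (g j) v) = (\<Sum>j\<in>S. \<Sum>i<n. c j * (g j i * v (n + i) - g j (n + i) * v i))"
    by (simp add: sform_def sum_distrib_left)
  also have "\<dots> = (\<Sum>i<n. \<Sum>j\<in>S. c j * (g j i * v (n + i) - g j (n + i) * v i))"
    by (rule sum.swap)
  also have "\<dots> = sform n (\<lambda>i. \<Sum>j\<in>S. c j * g j i) v"
    unfolding sform_def sum_distrib_right sum_subtractf[symmetric]
    by (intro sum.cong) (auto simp: algebra_simps)
  finally show ?thesis by simp
qed

lemma sform_sum_right: "sform n v (\<lambda>i. \<Sum>j\<in>S. c j * g j i) = (\<Sum>j\<in>S. c j * sform n v (g j))"
  by (subst sform_skew, subst sform_sum_left, subst (2) sform_skew) (simp add: sum_negf)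

lemma mat_app_vec:
  assumes "A \<in> carrier_mat m m"
  shows "map_mat of_int A *\<^sub>v vec m f = vec m (mat_app m A f)"
  using assms by (intro eq_vecI) (auto simp: mat_app_def scalar_prod_def lessThan_atLeast0)

lemma mat_app_vec_int:
  assumes "A \<in> carrier_mat m m"
  shows "A *\<^sub>v vec m f = vec m (mat_app m A f)"
  using assms by (intro eq_vecI) (auto simp: mat_app_def scalar_prod_def lessThan_atLeast0)

lemma mat_app_cong: "(\<And>i. i < m \<Longrightarrow> f i = g i) \<Longrightarrow> mat_app m A f = mat_app m A g"
  by (auto simp: mat_app_def intro!: sum.cong)

lemma mat_app_of_int: "mat_app m A (\<lambda>i. of_int (f i)) i = of_int (mat_app m A f i)"
  by (simp add: mat_app_def)

lemma mat_app_sum: "mat_app m A (\<lambda>i. \<Sum>j\<in>S. c j * g j i) i = (\<Sum>j\<in>S. c j * mat_app m A (g j) i)"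
proof -
  have "mat_app m A (\<lambda>i. \<Sum>j\<in>S. c j * g j i) i = (\<Sum>k<m. \<Sum>j\<in>S. c j * (of_int (A $$ (i, k)) * g j k))"
    by (simp add: mat_app_def sum_distrib_left mult.left_commute)
  also have "\<dots> = (\<Sum>j\<in>S. \<Sum>k<m. c j * (of_int (A $$ (i, k)) * g j k))"
    by (rule sum.swap)
  finally show ?thesis by (simp add: mat_app_def sum_distrib_left)
qed

lemma mat_app_mult:
  assumes "A \<in> carrier_mat m m" "B \<in> carrier_mat m m" "i < m"
  shows "mat_app m (A * B) f i = mat_app m A (mat_app m B f) i"
proof -
  have "mat_app m (A * B) f i = (\<Sum>k<m. \<Sum>l<m. of_int (A $$ (i, l) * B $$ (l, k)) * f k)"
    using assms by (auto simp: mat_app_def scalar_prod_def lessThan_atLeast0 sum_distrib_right intro!: sum.cong)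
  also have "\<dots> = (\<Sum>l<m. \<Sum>k<m. of_int (A $$ (i, l) * B $$ (l, k)) * f k)"
    by (rule sum.swap)
  finally show ?thesis by (simp add: mat_app_def sum_distrib_left mult.assoc)
qed

lemma mat_app_one: "i < m \<Longrightarrow> mat_app m (1\<^sub>m m) f i = f i"
  by (simp add: mat_app_def if_distrib[of "\<lambda>x. of_int x * _"] cong: if_cong)

lemma mat_app_unit: "k < m \<Longrightarrow> mat_app m A (\<lambda>l. if l = k then 1 else 0) i = of_int (A $$ (i, k))"
  by (simp add: mat_app_def if_distrib[of "\<lambda>x. _ * x"] cong: if_cong)

lemma carrier_vec_eq_vec: "u \<in> carrier_vec m \<Longrightarrow> \<exists>f. u = vec m f"
  by (intro exI[of _ "\<lambda>i. u $ i"] eq_vecI) auto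

lemma mem_congruence_subgroup_iff:
  "A \<in> congruence_subgroup n p \<longleftrightarrow> A \<in> carrier_mat (2*n) (2*n) \<and>
    (\<forall>u v :: nat \<Rightarrow> int. sform n (mat_app (2*n) A u) (mat_app (2*n) A v) = sform n u v) \<and>
    (\<forall>f :: nat \<Rightarrow> int. \<forall>i<2*n. [mat_app (2*n) A f i = f i] (mod int p))"
proof (cases "A \<in> carrier_mat (2*n) (2*n)")
  case A: True
  have "(\<forall>u \<in> carrier_vec (2*n). \<forall>v \<in> carrier_vec (2*n). symp_form n (A *\<^sub>v u) (A *\<^sub>v v) = symp_form n u v)
     \<longleftrightarrow> (\<forall>u v. symp_form n (A *\<^sub>v vec (2*n) u) (A *\<^sub>v vec (2*n) v) = symp_form n (vec (2*n) u) (vec (2*n) v))"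
    by (metis carrier_vec_eq_vec vec_carrier)
  also have "\<dots> \<longleftrightarrow> (\<forall>u v :: nat \<Rightarrow> int. sform n (mat_app (2*n) A u) (mat_app (2*n) A v) = sform n u v)"
    by (simp add: mat_app_vec_int[OF A] symp_form_vec)
  finally have 1: "(\<forall>u \<in> carrier_vec (2*n). \<forall>v \<in> carrier_vec (2*n). symp_form n (A *\<^sub>v u) (A *\<^sub>v v) = symp_form n u v)
     \<longleftrightarrow> (\<forall>u v :: nat \<Rightarrow> int. sform n (mat_app (2*n) A u) (mat_app (2*n) A v) = sform n u v)" .
  have "reduce_mat p A = reduce_mat p (1\<^sub>m (2*n)) \<longleftrightarrow>
      (\<forall>i<2*n. \<forall>j<2*n. [A $$ (i, j) = 1\<^sub>m (2*n) $$ (i, j)] (mod int p))"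
    using A by (auto simp: reduce_mat_def mat_eq_iff cong_def)
  also have "\<dots> \<longleftrightarrow> (\<forall>f :: nat \<Rightarrow> int. \<forall>i<2*n. [mat_app (2*n) A f i = f i] (mod int p))"
  proof (intro iffI allI impI)
    fix f :: "nat \<Rightarrow> int" and i
    assume *: "\<forall>i<2*n. \<forall>j<2*n. [A $$ (i, j) = 1\<^sub>m (2*n) $$ (i, j)] (mod int p)" and i: "i < 2*n"
    have "[mat_app (2*n) A f i = mat_app (2*n) (1\<^sub>m (2*n)) f i] (mod int p)"
      unfolding mat_app_def using * i by (intro cong_sum cong_mult) auto
    then show "[mat_app (2*n) A f i = f i] (mod int p)" by (simp only: mat_app_one[OF i])
  next
    fix i j assume *: "\<forall>f :: nat \<Rightarrow> int. \<forall>i<2*n. [mat_app (2*n) A f i = f i] (mod int p)" and ij: "i < 2*n" "j < 2*n"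
    then have "[mat_app (2*n) A (\<lambda>l. if l = j then 1 else 0) i = (if i = j then 1 else 0)] (mod int p)" by blast
    then show "[A $$ (i, j) = 1\<^sub>m (2*n) $$ (i, j)] (mod int p)" using ij by (simp add: mat_app_unit)
  qed
  finally show ?thesis using A 1 by (auto simp: congruence_subgroup_def kernel_def Sp_int_def Sp_mod_def)
next
  case False
  then show ?thesis by (auto simp: congruence_subgroup_def kernel_def Sp_int_def Sp_mod_def)
qed

context
  fixes n p :: nat and A :: "int mat"
  assumes A: "A \<in> congruence_subgroup n p"
begin

lemma congruence_carrier: "A \<in> carrier_mat (2*n) (2*n)"
  using A by (simp add: mem_congruence_subgroup_iff)

lemma congruence_cong: "i < 2*n \<Longrightarrow> [mat_app (2*n) A f i = f i] (mod int p)"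
  using A by (simp add: mem_congruence_subgroup_iff)

text \<open>By bilinearity the form is determined by its values on pairs of columns of
  \<open>A\<close>, and these are integers fixed by the invariance on integral unit vectors; so the
  invariance passes to every commutative ring.\<close>

lemma congruence_sform:
  fixes u v :: "nat \<Rightarrow> 'a::comm_ring_1"
  shows "sform n (mat_app (2*n) A u) (mat_app (2*n) A v) = sform n u v"
proof -
  have exp: "sform n (mat_app (2*n) B u) (mat_app (2*n) B v) =
      (\<Sum>k<2*n. u k * (\<Sum>l<2*n. v l * of_int (sform n (\<lambda>i. B $$ (i, k)) (\<lambda>i. B $$ (i, l)))))" for B
  proof -
    have "mat_app (2*n) B w = (\<lambda>i. \<Sum>k<2*n. w k * of_int (B $$ (i, k)))" for w :: "nat \<Rightarrow> 'a"
      by (auto simp: mat_app_def mult.commute)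
    then show ?thesis by (simp add: sform_sum_left sform_sum_right sform_of_int)
  qed
  have "sform n (\<lambda>i. A $$ (i, k)) (\<lambda>i. A $$ (i, l)) = sform n (\<lambda>i. 1\<^sub>m (2*n) $$ (i, k)) (\<lambda>i. 1\<^sub>m (2*n) $$ (i, l))"
    if "k < 2*n" "l < 2*n" for k l
  proof -
    let ?e = "\<lambda>k l. if l = k then 1 else 0 :: int"
    have "sform n (mat_app (2*n) A (?e k)) (mat_app (2*n) A (?e l)) = sform n (?e k) (?e l)"
      using A by (simp add: mem_congruence_subgroup_iff)
    moreover have "mat_app (2*n) A (?e k) = (\<lambda>i. A $$ (i, k))" "mat_app (2*n) A (?e l) = (\<lambda>i. A $$ (i, l))"
      using that by (auto simp: mat_app_unit)
    moreover have "sform n (?e k) (?e l) = sform n (\<lambda>i. 1\<^sub>m (2*n) $$ (i, k)) (\<lambda>i. 1\<^sub>m (2*n) $$ (i, l))"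
      using that by (intro sform_cong) auto
    ultimately show ?thesis by simp
  qed
  then have "sform n (mat_app (2*n) A u) (mat_app (2*n) A v) = sform n (mat_app (2*n) (1\<^sub>m (2*n)) u) (mat_app (2*n) (1\<^sub>m (2*n)) v)"
    unfolding exp by (intro sum.cong arg_cong2[where f = "(*)"]) auto
  also have "\<dots> = sform n u v"
    by (intro sform_cong) (simp_all add: mat_app_one)
  finally show ?thesis .
qed

text \<open>With \<open>J\<close> the Gram matrix of the form, \<open>A\<^sup>T J A = J\<close> and
  \<open>J J = - 1\<close> yield the integral left inverse \<open>- J A\<^sup>T J\<close>.\<close>

lemma congruence_inverse:
  obtains B where "B \<in> congruence_subgroup n p" "A * B = 1\<^sub>m (2*n)" "B * A = 1\<^sub>m (2*n)"
proof -
  note Ac = congruence_carrier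
  define J :: "int mat" where "J = mat (2*n) (2*n) (\<lambda>(i, j). if j = n + i then 1 else if i = n + j then - 1 else 0)"
  have Jc: "J \<in> carrier_mat (2*n) (2*n)" by (simp add: J_def)
  have Jrow: "(\<Sum>j<2*n. J $$ (i, j) * f j) = (if i < n then f (n + i) else - f (i - n))" if "i < 2*n" for i and f :: "nat \<Rightarrow> int"
  proof (cases "i < n")
    case True
    then have "(\<Sum>j<2*n. J $$ (i, j) * f j) = (\<Sum>j<2*n. if j = n + i then f j else 0)"
      using that by (intro sum.cong) (auto simp: J_def)
    then show ?thesis using True by simp
  next
    case False
    then have "(\<Sum>j<2*n. J $$ (i, j) * f j) = (\<Sum>j<2*n. if j = i - n then - f j else 0)"
      using that by (intro sum.cong) (auto simp: J_def)
    then show ?thesis using False that by simp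
  qed
  have JJ: "J * J = - 1\<^sub>m (2*n)"
  proof (rule eq_matI)
    fix i j assume "i < dim_row (- 1\<^sub>m (2*n) :: int mat)" "j < dim_col (- 1\<^sub>m (2*n) :: int mat)"
    then have ij: "i < 2*n" "j < 2*n" by auto
    have "(J * J) $$ (i, j) = (\<Sum>k<2*n. J $$ (i, k) * J $$ (k, j))"
      using ij Jc by (simp add: scalar_prod_def lessThan_atLeast0)
    also have "\<dots> = (- 1\<^sub>m (2*n)) $$ (i, j)"
      unfolding Jrow[OF ij(1)] using ij by (auto simp: J_def)
    finally show "(J * J) $$ (i, j) = (- 1\<^sub>m (2*n)) $$ (i, j)" .
  qed (use Jc in auto)
  have sJ: "sform n u v = (\<Sum>i<2*n. u i * (\<Sum>j<2*n. J $$ (i, j) * v j))" for u v :: "nat \<Rightarrow> int"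
  proof -
    have "(\<Sum>i<2*n. u i * (\<Sum>j<2*n. J $$ (i, j) * v j)) = (\<Sum>i<n+n. u i * (if i < n then v (n + i) else - v (i - n)))"
      by (intro sum.cong) (auto simp: Jrow)
    also have "\<dots> = (\<Sum>i<n. u i * v (n + i)) + (\<Sum>i<n. u (n + i) * (- v i))"
      unfolding sum_lessThan_add by (intro arg_cong2[where f = "(+)"] sum.cong) auto
    finally show ?thesis by (simp add: sform_def sum_subtractf sum_negf)
  qed
  have ATJA: "A\<^sup>T * (J * A) = J"
  proof (rule eq_matI)
    fix k l assume "k < dim_row J" "l < dim_col J"
    then have kl: "k < 2*n" "l < 2*n" by (auto simp: J_def)
    let ?e = "\<lambda>k l. if l = k then 1 else 0 :: int"
    have "(A\<^sup>T * (J * A)) $$ (k, l) = (\<Sum>i<2*n. A $$ (i, k) * (\<Sum>j<2*n. J $$ (i, j) * A $$ (j, l)))"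
      using kl Jc Ac by (auto simp: scalar_prod_def lessThan_atLeast0 intro!: sum.cong)
    also have "\<dots> = sform n (mat_app (2*n) A (?e k)) (mat_app (2*n) A (?e l))"
      using kl by (simp add: sJ mat_app_unit)
    also have "\<dots> = sform n (?e k) (?e l)"
      by (rule congruence_sform)
    also have "\<dots> = J $$ (k, l)"
      using kl by (simp add: sJ if_distrib[of "\<lambda>x. x * _"] if_distrib[of "\<lambda>x. _ * x"] cong: if_cong)
    finally show "(A\<^sup>T * (J * A)) $$ (k, l) = J $$ (k, l)" .
  qed (use Ac Jc in auto)
  define B where "B = (- J) * (A\<^sup>T * J)"
  have Bc: "B \<in> carrier_mat (2*n) (2*n)" using Jc Ac by (auto simp: B_def)
  have "B * A = (- J) * ((A\<^sup>T * J) * A)"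
    unfolding B_def by (rule assoc_mult_mat) (use Ac Jc in auto)
  also have "(A\<^sup>T * J) * A = A\<^sup>T * (J * A)"
    by (rule assoc_mult_mat) (use Ac Jc in auto)
  also have "(- J) * (A\<^sup>T * (J * A)) = - (J * J)"
    unfolding ATJA by (rule uminus_mult_left_mat) (use Jc in auto)
  also have "\<dots> = 1\<^sub>m (2*n)"
    unfolding JJ by (rule uminus_uminus_mat)
  finally have BA: "B * A = 1\<^sub>m (2*n)" .
  \<comment> \<open>Over a field a left inverse of a square matrix is also a right inverse; the
    identity is taken to the rationals and back.\<close>
  have "map_mat rat_of_int B * map_mat rat_of_int A = 1\<^sub>m (2*n)"
    using BA Bc Ac by (metis of_int_hom.mat_hom_mult of_int_hom.mat_hom_one)
  then have "map_mat rat_of_int A * map_mat rat_of_int B = 1\<^sub>m (2*n)"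
    using Bc Ac by (intro mat_mult_left_right_inverse[of "map_mat rat_of_int B"]) auto
  then have "map_mat rat_of_int (A * B) = map_mat rat_of_int (1\<^sub>m (2*n))"
    using Bc Ac by (simp add: of_int_hom.mat_hom_mult[of A "2*n" "2*n" B "2*n"] of_int_hom.mat_hom_one)
  then have AB: "A * B = 1\<^sub>m (2*n)"
    by (rule of_int_hom.mat_hom_inj)
  have app: "mat_app (2*n) A (mat_app (2*n) B f) i = f i" if "i < 2*n" for f :: "nat \<Rightarrow> int" and i
    using mat_app_mult[OF Ac Bc that, of f] AB that by (simp add: mat_app_one)
  have "B \<in> congruence_subgroup n p"
    unfolding mem_congruence_subgroup_iff
  proof (intro conjI allI impI)
    fix u v :: "nat \<Rightarrow> int"
    have "sform n (mat_app (2*n) B u) (mat_app (2*n) B v)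
        = sform n (mat_app (2*n) A (mat_app (2*n) B u)) (mat_app (2*n) A (mat_app (2*n) B v))"
      by (simp add: congruence_sform)
    also have "\<dots> = sform n u v" by (intro sform_cong app)
    finally show "sform n (mat_app (2*n) B u) (mat_app (2*n) B v) = sform n u v" .
  next
    fix f :: "nat \<Rightarrow> int" and i assume i: "i < 2*n"
    from congruence_cong[OF i, of "mat_app (2*n) B f"] show "[mat_app (2*n) B f i = f i] (mod int p)"
      by (simp add: app[OF i] cong_sym_eq)
  qed (rule Bc)
  with AB BA show thesis using that by blast
qed

end

lemma congruence_one: "1\<^sub>m (2*n) \<in> congruence_subgroup n p"
  unfolding mem_congruence_subgroup_iff
  by (auto simp: mat_app_one intro!: sform_cong)

lemma congruence_mult:
  assumes A: "A \<in> congruence_subgroup n p" and B: "B \<in> congruence_subgroup n p"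
  shows "A * B \<in> congruence_subgroup n p"
  unfolding mem_congruence_subgroup_iff
proof (intro conjI allI impI)
  note c = congruence_carrier[OF A] congruence_carrier[OF B]
  show "A * B \<in> carrier_mat (2*n) (2*n)" using c by simp
  fix u v :: "nat \<Rightarrow> int"
  have "sform n (mat_app (2*n) (A * B) u) (mat_app (2*n) (A * B) v)
      = sform n (mat_app (2*n) A (mat_app (2*n) B u)) (mat_app (2*n) A (mat_app (2*n) B v))"
    by (intro sform_cong mat_app_mult c)
  then show "sform n (mat_app (2*n) (A * B) u) (mat_app (2*n) (A * B) v) = sform n u v"
    by (simp add: congruence_sform[OF A] congruence_sform[OF B])
next
  note c = congruence_carrier[OF A] congruence_carrier[OF B]
  fix f :: "nat \<Rightarrow> int" and i assume i: "i < 2*n"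
  show "[mat_app (2*n) (A * B) f i = f i] (mod int p)"
    unfolding mat_app_mult[OF c i]
    using congruence_cong[OF A i] congruence_cong[OF B i] cong_trans by blast
qed

section \<open>The action on rational spans of integral vectors\<close>

lemma act_subspace_mult:
  assumes "A \<in> carrier_mat m m" "B \<in> carrier_mat m m" "U \<subseteq> carrier_vec m"
  shows "act_subspace (A * B) U = act_subspace A (act_subspace B U)"
proof -
  have "map_mat rat_of_int (A * B) *\<^sub>v u = map_mat rat_of_int A *\<^sub>v (map_mat rat_of_int B *\<^sub>v u)" if "u \<in> U" for u
    using that assms by (auto simp: of_int_hom.mat_hom_mult[of A m m B m] intro!: assoc_mult_mat_vec)
  then show ?thesis by (simp add: act_subspace_def image_image)
qed

lemma act_subspace_one:
  assumes "U \<subseteq> carrier_vec m"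
  shows "act_subspace (1\<^sub>m m) U = U"
proof -
  have "map_mat rat_of_int (1\<^sub>m m) *\<^sub>v u = u" if "u \<in> U" for u
    using that assms by (auto simp: of_int_hom.mat_hom_one)
  then show ?thesis by (simp add: act_subspace_def)
qed

definition span_vec :: "nat \<Rightarrow> nat set \<Rightarrow> (nat \<Rightarrow> nat \<Rightarrow> int) \<Rightarrow> rat vec set" where
  "span_vec m S g = {vec m (\<lambda>i. \<Sum>j\<in>S. c j * of_int (g j i)) | c. True}"

lemma span_vec_range: "span_vec m S g = range (\<lambda>c. vec m (\<lambda>i. \<Sum>j\<in>S. c j * of_int (g j i)))"
  by (auto simp: span_vec_def)

lemma span_vec_carrier: "span_vec m S g \<subseteq> carrier_vec m"
  by (auto simp: span_vec_def)

lemma act_span_vec: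
  assumes A: "A \<in> carrier_mat m m"
  shows "act_subspace A (span_vec m S g) = span_vec m S (\<lambda>j. mat_app m A (g j))"
proof -
  have "map_mat rat_of_int A *\<^sub>v vec m (\<lambda>i. \<Sum>j\<in>S. c j * of_int (g j i))
      = vec m (\<lambda>i. \<Sum>j\<in>S. c j * of_int (mat_app m A (g j) i))" for c
    unfolding mat_app_vec[OF A] mat_app_sum mat_app_of_int ..
  then show ?thesis by (simp add: act_subspace_def span_vec_range image_image)
qed

lemma span_vec_cong:
  assumes "\<And>j i. j \<in> S \<Longrightarrow> i < m \<Longrightarrow> g j i = g' j i"
  shows "span_vec m S g = span_vec m S g'"
proof -
  have "vec m (\<lambda>i. \<Sum>j\<in>S. c j * rat_of_int (g j i)) = vec m (\<lambda>i. \<Sum>j\<in>S. c j * rat_of_int (g' j i))" for c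
    using assms by (intro eq_vecI) (auto intro!: sum.cong)
  then show ?thesis by (simp add: span_vec_def)
qed

lemma span_vec_mono:
  assumes "finite S'" "S \<subseteq> S'"
  shows "span_vec m S g \<subseteq> span_vec m S' g"
proof
  fix v assume "v \<in> span_vec m S g"
  then obtain c where "v = vec m (\<lambda>i. \<Sum>j\<in>S. c j * of_int (g j i))" by (auto simp: span_vec_def)
  also have "\<dots> = vec m (\<lambda>i. \<Sum>j\<in>S'. (if j \<in> S then c j else 0) * of_int (g j i))"
    using assms by (intro eq_vecI) (auto intro!: sum.mono_neutral_cong_left)
  finally show "v \<in> span_vec m S' g"
    unfolding span_vec_def by (intro CollectI exI[of _ "\<lambda>j. if j \<in> S then c j else 0"]) simp
qed

lemma subspace_vec_iff:
  "VectorSpace.subspace class_ring U (module_vec TYPE(rat) m) \<longleftrightarrow>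
    U \<subseteq> carrier_vec m \<and> 0\<^sub>v m \<in> U \<and> (\<forall>u\<in>U. \<forall>v\<in>U. u + v \<in> U) \<and> (\<forall>c. \<forall>u\<in>U. c \<cdot>\<^sub>v u \<in> U)"
proof -
  interpret vec_space "TYPE(rat)" m .
  have "module class_ring (module_vec TYPE(rat) m)" by (rule module_axioms)
  moreover have "vectorspace class_ring (module_vec TYPE(rat) m)" by (rule vectorspace_axioms)
  ultimately show ?thesis
    by (auto simp: VectorSpace.subspace_def submodule_def module_vec_simps)
qed

lemma span_vec_subspace: "VectorSpace.subspace class_ring (span_vec m S g) (module_vec TYPE(rat) m)"
  unfolding subspace_vec_iff
proof (intro conjI ballI allI)
  show "0\<^sub>v m \<in> span_vec m S g"
    unfolding span_vec_def by (auto intro!: exI[of _ "\<lambda>_. 0"])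
next
  fix u v assume "u \<in> span_vec m S g" "v \<in> span_vec m S g"
  then obtain c c' where "u = vec m (\<lambda>i. \<Sum>j\<in>S. c j * of_int (g j i))" "v = vec m (\<lambda>i. \<Sum>j\<in>S. c' j * of_int (g j i))"
    by (auto simp: span_vec_def)
  then have "u + v = vec m (\<lambda>i. \<Sum>j\<in>S. (c j + c' j) * of_int (g j i))"
    by (intro eq_vecI) (auto simp: algebra_simps sum.distrib)
  then show "u + v \<in> span_vec m S g"
    unfolding span_vec_def by (intro CollectI exI[of _ "\<lambda>j. c j + c' j"]) simp
next
  fix a u assume "u \<in> span_vec m S g"
  then obtain c where "u = vec m (\<lambda>i. \<Sum>j\<in>S. c j * of_int (g j i))"
    by (auto simp: span_vec_def)
  then have "a \<cdot>\<^sub>v u = vec m (\<lambda>i. \<Sum>j\<in>S. (a * c j) * of_int (g j i))"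
    by (intro eq_vecI) (auto simp: sum_distrib_left mult.assoc)
  then show "a \<cdot>\<^sub>v u \<in> span_vec m S g"
    unfolding span_vec_def by (intro CollectI exI[of _ "\<lambda>j. a * c j"]) simp
qed (use span_vec_carrier in auto)

lemma det_cong:
  fixes A B :: "int mat"
  assumes "A \<in> carrier_mat k k" "B \<in> carrier_mat k k"
    and "\<And>i j. i < k \<Longrightarrow> j < k \<Longrightarrow> [A $$ (i, j) = B $$ (i, j)] (mod m)"
  shows "[det A = det B] (mod m)"
  unfolding det_def'[OF assms(1)] det_def'[OF assms(2)]
  by (intro cong_sum cong_mult cong_refl cong_prod assms(3)) (auto simp: permutes_in_image)

lemma det_zero_col:
  fixes A :: "int mat"
  assumes A: "A \<in> carrier_mat k k" and j: "j < k" and z: "\<And>i. i < k \<Longrightarrow> A $$ (i, j) = 0"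
  shows "det A = 0"
proof -
  have "A *\<^sub>v unit_vec k j = 0\<^sub>v k"
    using A j z by (intro eq_vecI) auto
  moreover have "unit_vec k j \<noteq> (0\<^sub>v k :: int vec)"
    using j by (metis index_unit_vec(2) index_zero_vec(1) zero_neq_one)
  ultimately show ?thesis
    using det_0_iff_vec_prod_zero[OF A] by (metis unit_vec_carrier)
qed

section \<open>Dimensions of rational subspaces\<close>

text \<open>Vectors of all lengths share the type \<open>rat vec\<close>, which is therefore no
  vector space as a whole. Extension by zero embeds each \<open>carrier_vec m\<close> into one space
  of functions, where dimensions are taken.\<close>

interpretation fv: vector_space "\<lambda>(c::rat) (f::nat \<Rightarrow> rat) i. c * f i"
  by unfold_locales (auto simp: plus_fun_def algebra_simps)

definition vec_fun :: "rat vec \<Rightarrow> nat \<Rightarrow> rat" where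
  "vec_fun v i = (if i < dim_vec v then vec_index v i else 0)"

definition sdim :: "rat vec set \<Rightarrow> nat" where
  "sdim U = fv.dim (vec_fun ` U)"

lemma sum_fun_eq: "(\<Sum>j\<in>S. g j) = (\<lambda>i::nat. \<Sum>j\<in>S. (g j i :: rat))"
  by (induction S rule: infinite_finite_induct) (auto simp: zero_fun_def plus_fun_def)

lemma inj_on_vec_fun: "inj_on vec_fun (carrier_vec m)"
proof (rule inj_onI)
  fix u v assume uv: "u \<in> carrier_vec m" "v \<in> carrier_vec m" and eq: "vec_fun u = vec_fun v"
  show "u = v"
  proof (rule eq_vecI)
    fix i assume "i < dim_vec v"
    then show "u $ i = v $ i" using fun_cong[OF eq, of i] uv by (auto simp: vec_fun_def)
  qed (use uv in auto)
qed

lemma vec_fun_span_units: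
  "vec_fun ` carrier_vec m \<subseteq> fv.span ((\<lambda>j i. if i = j then 1 else 0) ` {..<m})"
proof (clarify)
  fix v :: "rat vec" assume v: "v \<in> carrier_vec m"
  have "vec_fun v = (\<Sum>j<m. (\<lambda>i. v $ j * (if i = j then 1 else 0)))"
    using v by (auto simp: sum_fun_eq vec_fun_def if_distrib[of "\<lambda>x. _ * x"] cong: if_cong)
  moreover have "\<dots> \<in> fv.span ((\<lambda>j i. if i = j then 1 else 0) ` {..<m})"
    by (rule fv.span_sum, rule fv.span_scale, rule fv.span_base, erule imageI)
  ultimately show "vec_fun v \<in> fv.span ((\<lambda>j i. if i = j then 1 else 0) ` {..<m})" by simp
qed

lemma vec_fun_subspace:
  assumes "VectorSpace.subspace class_ring U (module_vec TYPE(rat) m)"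
  shows "fv.subspace (vec_fun ` U)"
proof (rule fv.subspaceI)
  note U = assms[unfolded subspace_vec_iff]
  have "vec_fun (0\<^sub>v m) = 0" by (auto simp: vec_fun_def)
  then show "0 \<in> vec_fun ` U" using U by (metis imageI)
  have "vec_fun u + vec_fun v = vec_fun (u + v)" if "u \<in> U" "v \<in> U" for u v
  proof -
    have "dim_vec u = m" "dim_vec v = m" using that U by auto
    then show ?thesis by (auto simp: vec_fun_def plus_fun_def fun_eq_iff)
  qed
  then show "x + y \<in> vec_fun ` U" if "x \<in> vec_fun ` U" "y \<in> vec_fun ` U" for x y
    using that U by auto
  have "(\<lambda>i. c * vec_fun u i) = vec_fun (c \<cdot>\<^sub>v u)" for u c
    by (auto simp: vec_fun_def)
  then show "(\<lambda>i. c * x i) \<in> vec_fun ` U" if "x \<in> vec_fun ` U" for c x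
    using that U by auto
qed

text \<open>The function space is infinite dimensional, so finiteness has to come from the
  \<open>m\<close> unit functions that span the image of \<open>carrier_vec m\<close>.\<close>

lemma finite_independent_subset:
  assumes "B \<subseteq> vec_fun ` carrier_vec m" "fv.independent B"
  shows "finite B"
  using fv.independent_span_bound[OF finite_imageI[OF finite_lessThan] assms(2)
      subset_trans[OF assms(1) vec_fun_span_units]] by (rule conjunct1)

lemma sdim_mono:
  assumes "U \<subseteq> W" "W \<subseteq> carrier_vec m"
  shows "sdim U \<le> sdim W"
proof -
  obtain C where C: "C \<subseteq> vec_fun ` W" "fv.independent C" "vec_fun ` W \<subseteq> fv.span C" "card C = fv.dim (vec_fun ` W)"
    using fv.basis_exists by blast
  have "C \<subseteq> vec_fun ` carrier_vec m" using C(1) assms(2) by (meson image_mono subset_trans)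
  then have "finite C" using C(2) by (rule finite_independent_subset)
  moreover have "vec_fun ` U \<subseteq> fv.span C" using C(3) assms(1) by (meson image_mono subset_trans)
  ultimately show ?thesis unfolding sdim_def C(4)[symmetric] by (intro fv.dim_le_card)
qed

text \<open>A vector of \<open>W\<close> outside \<open>U\<close> would extend a basis of
  \<open>U\<close> to an independent set larger than a basis of \<open>W\<close> allows.\<close>

lemma subspace_eq_if_sdim:
  assumes U: "VectorSpace.subspace class_ring U (module_vec TYPE(rat) m)"
    and "U \<subseteq> W" "W \<subseteq> carrier_vec m" "sdim W \<le> sdim U"
  shows "U = W"
proof -
  obtain B where B: "B \<subseteq> vec_fun ` U" "fv.independent B" "vec_fun ` U \<subseteq> fv.span B" "card B = sdim U"
    using fv.basis_exists unfolding sdim_def by blast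
  obtain C where C: "C \<subseteq> vec_fun ` W" "fv.independent C" "vec_fun ` W \<subseteq> fv.span C" "card C = sdim W"
    using fv.basis_exists unfolding sdim_def by blast
  have "C \<subseteq> vec_fun ` carrier_vec m" "B \<subseteq> vec_fun ` carrier_vec m"
    using B(1) C(1) assms(2,3) by (meson image_mono subset_trans)+
  then have fin: "finite B" "finite C" using B(2) C(2) finite_independent_subset by auto
  have sp: "fv.span B \<subseteq> vec_fun ` U"
    using B(1) vec_fun_subspace[OF U] by (rule fv.span_minimal)
  have "vec_fun ` W \<subseteq> fv.span B"
  proof (rule subsetI, rule ccontr)
    fix w assume w: "w \<in> vec_fun ` W" "w \<notin> fv.span B"
    have "fv.independent (insert w B)" using w(2) B(2) by (rule fv.independent_insertI)
    moreover have "insert w B \<subseteq> fv.span C" using w(1) B(1) C(3) assms(2) by blast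
    ultimately have "card (insert w B) \<le> card C" using fv.independent_span_bound[OF fin(2)] by blast
    moreover have "w \<notin> B" using w(2) fv.span_base by blast
    ultimately show False using fin(1) B(4) C(4) assms(4) by simp
  qed
  then have im: "vec_fun ` W \<subseteq> vec_fun ` U" using sp by blast
  have "W \<subseteq> U"
  proof
    fix w assume w: "w \<in> W"
    then obtain u where u: "u \<in> U" "vec_fun w = vec_fun u" using im by blast
    then have "w = u" using inj_on_vec_fun[of m] w assms(2,3) by (auto dest: inj_onD)
    then show "w \<in> U" using u by simp
  qed
  then show ?thesis using assms(2) by blast
qed

lemma sdim_pos:
  assumes U: "VectorSpace.subspace class_ring U (module_vec TYPE(rat) m)" and "U \<noteq> {0\<^sub>v m}"
  shows "0 < sdim U"
proof (rule ccontr)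
  assume "\<not> 0 < sdim U"
  then have "{0\<^sub>v m} = U"
    using U by (intro subspace_eq_if_sdim[of _ m]) (auto simp: subspace_vec_iff)
  then show False using assms(2) by simp
qed

text \<open>Independence of an indexed family, which also excludes repeated vectors; hence
  dimensions can be counted by \<open>card S\<close>.\<close>

definition indep_on :: "nat \<Rightarrow> nat set \<Rightarrow> (nat \<Rightarrow> nat \<Rightarrow> int) \<Rightarrow> bool" where
  "indep_on m S g \<longleftrightarrow> (\<forall>c :: nat \<Rightarrow> rat. (\<forall>i<m. (\<Sum>j\<in>S. c j * of_int (g j i)) = 0) \<longrightarrow> (\<forall>j\<in>S. c j = 0))"

lemma vec_fun_span_vec:
  "vec_fun ` span_vec m S g \<subseteq> fv.span ((\<lambda>j i. if i < m then of_int (g j i) else 0) ` S)"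
proof (clarsimp simp: span_vec_def)
  fix c :: "nat \<Rightarrow> rat"
  have "vec_fun (vec m (\<lambda>i. \<Sum>j\<in>S. c j * of_int (g j i))) = (\<Sum>j\<in>S. (\<lambda>i. c j * (if i < m then of_int (g j i) else 0)))"
    by (auto simp: sum_fun_eq vec_fun_def)
  moreover have "\<dots> \<in> fv.span ((\<lambda>j i. if i < m then of_int (g j i) else 0) ` S)"
    by (rule fv.span_sum, rule fv.span_scale, rule fv.span_base, erule imageI)
  ultimately show "vec_fun (vec m (\<lambda>i. \<Sum>j\<in>S. c j * of_int (g j i))) \<in> fv.span ((\<lambda>j i. if i < m then of_int (g j i) else 0) ` S)"
    by simp
qed

lemma sdim_span_vec_le:
  assumes "finite S"
  shows "sdim (span_vec m S g) \<le> card S"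
  unfolding sdim_def
  using fv.dim_le_card[OF vec_fun_span_vec[of m S g] finite_imageI[OF assms]] card_image_le[OF assms]
  by (rule order_trans)

lemma vec_in_span_vec:
  assumes "finite S" "j \<in> S"
  shows "vec m (\<lambda>i. of_int (g j i)) \<in> span_vec m S g"
proof -
  have "vec m (\<lambda>i. of_int (g j i)) = vec m (\<lambda>i. \<Sum>k\<in>S. (if k = j then 1 else 0) * rat_of_int (g k i))"
    using assms by (intro eq_vecI) (auto simp: if_distrib[of "\<lambda>x. x * _"] cong: if_cong)
  then show ?thesis unfolding span_vec_def by (intro CollectI exI[of _ "\<lambda>k. if k = j then 1 else 0"]) simp
qed

lemma sdim_span_vec:
  assumes S: "finite S" and ind: "indep_on m S g"
  shows "sdim (span_vec m S g) = card S"
proof -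
  let ?\<gamma> = "\<lambda>j i. if i < m then rat_of_int (g j i) else 0"
  have inj: "inj_on ?\<gamma> S"
  proof (rule inj_onI, rule ccontr)
    fix j k assume jk: "j \<in> S" "k \<in> S" "?\<gamma> j = ?\<gamma> k" "j \<noteq> k"
    define c :: "nat \<Rightarrow> rat" where "c = (\<lambda>l. if l = j then 1 else if l = k then - 1 else 0)"
    have "(\<Sum>l\<in>S. c l * of_int (g l i)) = 0" if "i < m" for i
    proof -
      have "(\<Sum>l\<in>S. c l * of_int (g l i)) = (\<Sum>l\<in>S. (if l = j then of_int (g j i) else 0) - (if l = k then of_int (g k i) else 0))"
        using jk(4) by (intro sum.cong) (auto simp: c_def)
      also have "\<dots> = rat_of_int (g j i) - of_int (g k i)" using S jk by (simp add: sum_subtractf)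
      finally show ?thesis using fun_cong[OF jk(3), of i] that by simp
    qed
    then have "c j = 0" using ind[unfolded indep_on_def, rule_format, of c j] jk(1) by simp
    then show False by (simp add: c_def)
  qed
  have "fv.independent (?\<gamma> ` S)"
  proof (rule fv.independent_if_scalars_zero)
    fix u :: "(nat \<Rightarrow> rat) \<Rightarrow> rat" and x
    assume z: "(\<Sum>x\<in>?\<gamma> ` S. (\<lambda>i. u x * x i)) = 0" and "x \<in> ?\<gamma> ` S"
    then obtain j where j: "j \<in> S" "x = ?\<gamma> j" by auto
    have "(\<Sum>j\<in>S. u (?\<gamma> j) * of_int (g j i)) = 0" if "i < m" for i
    proof -
      have "(\<Sum>j\<in>S. u (?\<gamma> j) * of_int (g j i)) = (\<Sum>x\<in>?\<gamma> ` S. u x * x i)"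
        using that by (subst sum.reindex[OF inj]) simp
      also have "\<dots> = 0" using fun_cong[OF z, of i] by (simp add: sum_fun_eq)
      finally show ?thesis .
    qed
    then have "\<forall>j\<in>S. u (?\<gamma> j) = 0"
      by (intro ind[unfolded indep_on_def, rule_format, of "\<lambda>j. u (?\<gamma> j)"] ballI)
    then show "u x = 0" using j by simp
  qed (use S in simp)
  moreover have "?\<gamma> ` S \<subseteq> vec_fun ` span_vec m S g"
  proof clarify
    fix j assume "j \<in> S"
    have "?\<gamma> j = vec_fun (vec m (\<lambda>i. of_int (g j i)))" by (auto simp: vec_fun_def)
    then show "?\<gamma> j \<in> vec_fun ` span_vec m S g" using vec_in_span_vec[OF S \<open>j \<in> S\<close>] by blast
  qed
  ultimately have "card (?\<gamma> ` S) = sdim (span_vec m S g)"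
    unfolding sdim_def using vec_fun_span_vec[of m S g] by (intro fv.basis_card_eq_dim) auto
  then show ?thesis using card_image[OF inj] by simp
qed

section \<open>Frames and their apartments\<close>

text \<open>\<open>E\<close>, \<open>U\<close> is a symplectic basis of \<open>\<int>\<^sup>2\<^sup>n\<close> adapted to the flag of the \<open>e\<^sub>i\<close>: \<open>E j\<close> lies in the
  span of the \<open>e\<^sub>i\<close>, and \<open>U j\<close> has \<open>f\<close>-coordinates that are zero before position \<open>j\<close>.\<close>

locale symplectic_frame =
  fixes n p :: nat and E U :: "nat \<Rightarrow> nat \<Rightarrow> int" and d :: "nat \<Rightarrow> int"
  assumes prime_p: "prime p"
    and d: "j < n \<Longrightarrow> 0 < d j" "j < n \<Longrightarrow> 2 * d j < int p"
    and EE: "i < n \<Longrightarrow> j < n \<Longrightarrow> sform n (E i) (E j) = 0"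
    and UU: "i < n \<Longrightarrow> j < n \<Longrightarrow> sform n (U i) (U j) = 0"
    and EU: "i < n \<Longrightarrow> j < n \<Longrightarrow> sform n (E i) (U j) = (if i = j then 1 else 0)"
    and nondeg: "(\<And>j. j < n \<Longrightarrow> sform n x (\<lambda>i. rat_of_int (E j i)) = 0) \<Longrightarrow>
      (\<And>j. j < n \<Longrightarrow> sform n x (\<lambda>i. rat_of_int (U j i)) = 0) \<Longrightarrow> i < 2 * n \<Longrightarrow> x i = 0"
    and E_low: "i < n \<Longrightarrow> j < n \<Longrightarrow> E j (n + i) = 0"
    and U_tri: "i < j \<Longrightarrow> j < n \<Longrightarrow> U j (n + i) = 0"
    and U_diag: "j < n \<Longrightarrow> U j (n + j) = 1"
begin

definition F :: "nat \<Rightarrow> nat \<Rightarrow> int" where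
  "F j i = int p * E j i + d j * U j i"

text \<open>\<open>e j\<close> is the sign of cube coordinate \<open>j\<close>: \<open>E j\<close>
  and \<open>F j\<close> span the antipodal vertices on axis \<open>j\<close>, and the constant
  \<open>True\<close> gives the chamber of the \<open>F j\<close>.\<close>

definition frame :: "(nat \<Rightarrow> bool) \<Rightarrow> nat \<Rightarrow> nat \<Rightarrow> int" where
  "frame e j = (if e j then F j else E j)"

definition V :: "nat set \<Rightarrow> (nat \<Rightarrow> bool) \<Rightarrow> rat vec set" where
  "V S e = span_vec (2*n) S (frame e)"

abbreviation D :: "nat \<Rightarrow> rat vec set" where
  "D k \<equiv> V {..k} (\<lambda>_. True)"

lemma frame_U: "i < n \<Longrightarrow> j < n \<Longrightarrow> sform n (frame e i) (U j) = (if i = j then (if e j then int p else 1) else 0)"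
  unfolding frame_def F_def[abs_def] by (auto simp: sform_add_left EU UU)

lemma E_frame: "i < n \<Longrightarrow> j < n \<Longrightarrow> sform n (E i) (frame e j) = (if i = j \<and> e j then d j else 0)"
  unfolding frame_def F_def[abs_def] by (auto simp: sform_add_right EU EE)

lemma U_frame: "i < n \<Longrightarrow> j < n \<Longrightarrow> i \<noteq> j \<Longrightarrow> sform n (U i) (frame e j) = 0"
  by (subst sform_skew) (simp add: frame_U)

lemma frame_frame:
  assumes "i < n" "j < n"
  shows "sform n (frame e i) (frame e j) = 0"
proof (cases "i = j")
  case False
  have "sform n (F i) (frame e j) = 0"
    unfolding F_def[abs_def] sform_add_left using assms False by (simp add: E_frame U_frame)
  then show ?thesis using assms False E_frame[OF assms, of e] by (simp add: frame_def[of e i])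
qed (simp add: sform_self)

lemma comb_U:
  fixes c :: "nat \<Rightarrow> rat"
  assumes S: "S \<subseteq> {..<n}" and k: "k \<in> S"
  shows "sform n (\<lambda>i. \<Sum>j\<in>S. c j * of_int (frame e j i)) (\<lambda>i. of_int (U k i)) = c k * of_int (if e k then int p else 1)"
proof -
  have "sform n (\<lambda>i. \<Sum>j\<in>S. c j * of_int (frame e j i)) (\<lambda>i. of_int (U k i))
      = (\<Sum>j\<in>S. if j = k then c k * of_int (if e k then int p else 1) else 0)"
    unfolding sform_sum_left sform_of_int using S k by (intro sum.cong) (auto simp: frame_U subset_iff)
  then show ?thesis using k finite_subset[OF S] by simp
qed

lemma E_comb:
  fixes c :: "nat \<Rightarrow> rat"
  assumes S: "S \<subseteq> {..<n}" and k: "k \<in> S"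
  shows "sform n (\<lambda>i. of_int (E k i)) (\<lambda>i. \<Sum>j\<in>S. c j * of_int (frame e j i)) = (if e k then c k * of_int (d k) else 0)"
proof -
  have "sform n (\<lambda>i. of_int (E k i)) (\<lambda>i. \<Sum>j\<in>S. c j * of_int (frame e j i))
      = (\<Sum>j\<in>S. if j = k then (if e k then c k * of_int (d k) else 0) else 0)"
    unfolding sform_sum_right sform_of_int using S k by (intro sum.cong) (auto simp: E_frame subset_iff)
  then show ?thesis using k finite_subset[OF S] by simp
qed

lemma p_pos: "0 < p"
  using prime_p prime_gt_0_nat by blast

lemma coprime_d: "j < n \<Longrightarrow> coprime (int p) (d j)"
  using prime_p d[of j] by (intro prime_imp_coprime) (auto dest: zdvd_imp_le)

lemma frame_indep:
  assumes S: "S \<subseteq> {..<n}"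
  shows "indep_on (2*n) S (frame e)"
  unfolding indep_on_def
proof (intro allI impI ballI)
  fix c :: "nat \<Rightarrow> rat" and k
  assume z: "\<forall>i<2*n. (\<Sum>j\<in>S. c j * of_int (frame e j i)) = 0" and k: "k \<in> S"
  have "c k * of_int (if e k then int p else 1) = sform n (\<lambda>i. 0) (\<lambda>i. of_int (U k i))"
    unfolding comb_U[OF S k, of c e, symmetric] using z by (intro sform_cong) auto
  then show "c k = 0" using p_pos by (auto simp: sform_def split: if_splits)
qed

text \<open>For \<open>e k\<close> true, pairing with \<open>U k\<close> shows that
  \<open>c k * p\<close> is integral, and pairing with \<open>E k\<close> that
  \<open>c k * d k\<close> is; since \<open>p\<close> and \<open>d k\<close> are coprime, so is
  \<open>c k\<close>. For \<open>e k\<close> false the pairing with \<open>U k\<close> gives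
  \<open>c k\<close> itself. Thus the frame vectors are a lattice basis of the integral points of
  their span.\<close>

lemma frame_coeff_Ints:
  fixes c :: "nat \<Rightarrow> rat"
  assumes S: "S \<subseteq> {..<n}" and k: "k \<in> S"
    and z: "\<And>i. i < 2*n \<Longrightarrow> (\<Sum>j\<in>S. c j * of_int (frame e j i)) = of_int (z i)"
  shows "c k \<in> \<int>"
proof -
  have "c k * of_int (if e k then int p else 1) = sform n (\<lambda>i. of_int (z i)) (\<lambda>i. of_int (U k i))"
    unfolding comb_U[OF S k, of c e, symmetric] using z by (intro sform_cong) auto
  then have 1: "c k * of_int (if e k then int p else 1) \<in> \<int>" by (simp add: sform_of_int)
  have "(if e k then c k * of_int (d k) else 0) = sform n (\<lambda>i. of_int (E k i)) (\<lambda>i. of_int (z i))"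
    unfolding E_comb[OF S k, of c e, symmetric] using z by (intro sform_cong) auto
  then have 2: "(if e k then c k * of_int (d k) else 0) \<in> \<int>" by (simp add: sform_of_int)
  show ?thesis
  proof (cases "e k")
    case True
    obtain a b where ab: "a * int p + b * d k = 1"
      using coprime_d[of k] S k by (metis bezout_int coprime_imp_gcd_eq_1 lessThan_iff subsetD)
    have "c k = c k * of_int (a * int p + b * d k)" unfolding ab by simp
    also have "\<dots> = of_int a * (c k * of_int (int p)) + of_int b * (c k * of_int (d k))"
      by (simp add: algebra_simps)
    also have "\<dots> \<in> \<int>"
      using 1 2 unfolding if_P[OF True] by (intro Ints_add Ints_mult[OF Ints_of_int])
    finally show ?thesis .
  qed (use 1 in simp)
qed

lemma sdim_V: "S \<subseteq> {..<n} \<Longrightarrow> sdim (V S e) = card S"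
  unfolding V_def by (intro sdim_span_vec frame_indep finite_subset[OF _ finite_lessThan])

lemma V_in_tits_poset:
  assumes S: "S \<subseteq> {..<n}" "S \<noteq> {}"
  shows "V S e \<in> tits_poset n"
proof -
  have iso: "symp_form n u v = 0" if uv: "u \<in> V S e" "v \<in> V S e" for u v
  proof -
    obtain c c' where "u = vec (2*n) (\<lambda>i. \<Sum>j\<in>S. c j * of_int (frame e j i))" "v = vec (2*n) (\<lambda>i. \<Sum>j\<in>S. c' j * of_int (frame e j i))"
      using uv by (auto simp: V_def span_vec_def)
    moreover have "sform n (\<lambda>i. \<Sum>j\<in>S. c j * rat_of_int (frame e j i)) (\<lambda>i. \<Sum>j\<in>S. c' j * of_int (frame e j i)) = 0"
      unfolding sform_sum_left sform_sum_right sform_of_int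
      using S by (intro sum.neutral ballI) (auto simp: frame_frame subset_iff sum.neutral)
    ultimately show ?thesis by (simp add: symp_form_vec)
  qed
  obtain k where k: "k \<in> S" "k < n" using S by auto
  have "card S \<noteq> 0" using S finite_subset[OF S(1)] by auto
  moreover have "sdim {0\<^sub>v (2*n)} = 0"
    using sdim_span_vec_le[of "{}" "2*n" "\<lambda>_ _. 0"] by (simp add: span_vec_def zero_vec_def)
  ultimately have "V S e \<noteq> {0\<^sub>v (2*n)}" using sdim_V[OF S(1), of e] by auto
  moreover have "V S e \<noteq> carrier_vec (2*n)"
  proof
    assume "V S e = carrier_vec (2*n)"
    then have "symp_form n (vec (2*n) (\<lambda>i. rat_of_int (E k i))) (vec (2*n) (\<lambda>i. of_int (U k i))) = 0"
      by (intro iso) auto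
    then show False using k by (simp add: symp_form_vec sform_of_int EU)
  qed
  ultimately show ?thesis
    using iso span_vec_subspace by (auto simp: tits_poset_def isotropic_subspaces_def V_def)
qed

lemma V_chain:
  assumes C: "C \<subseteq> Pow {..<n} - {{}}" "C \<noteq> {}" "chain\<^sub>\<subseteq> C"
  shows "(\<lambda>S. V S e) ` C \<in> tits_building n"
proof -
  have "finite C" using C(1) by (rule finite_subset) simp
  have mono: "V S e \<subseteq> V S' e" if "S \<subseteq> S'" "S' \<in> C" for S S'
    unfolding V_def using that C(1) finite_subset[of S' "{..<n}"] by (intro span_vec_mono) auto
  have "chain\<^sub>\<subseteq> ((\<lambda>S. V S e) ` C)"
    unfolding chain_subset_def
  proof (intro ballI)
    fix x y assume "x \<in> (\<lambda>S. V S e) ` C" "y \<in> (\<lambda>S. V S e) ` C"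
    then obtain S S' where S: "S \<in> C" "x = V S e" "S' \<in> C" "y = V S' e" by auto
    then have "S \<subseteq> S' \<or> S' \<subseteq> S" using C(3) by (auto simp: chain_subset_def)
    then show "x \<subseteq> y \<or> y \<subseteq> x" using mono S by auto
  qed
  with \<open>finite C\<close> show ?thesis
    using C V_in_tits_poset by (auto simp: tits_building_def order_complex_def)
qed

lemma V_cong: "(\<And>j. j \<in> S \<Longrightarrow> e j = e' j) \<Longrightarrow> V S e = V S e'"
  unfolding V_def by (intro span_vec_cong) (auto simp: frame_def)

text \<open>\<open>D k\<close> has dimension \<open>k + 1\<close>.\<close>

definition in_orbit :: "nat \<Rightarrow> rat vec set \<Rightarrow> bool" where
  "in_orbit k v \<longleftrightarrow> (\<exists>A\<in>congruence_subgroup n p. v = act_subspace A (D k))"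

lemma D_carrier: "D k \<subseteq> carrier_vec (2*n)"
  unfolding V_def by (rule span_vec_carrier)

lemma in_orbit_act:
  assumes A: "A \<in> congruence_subgroup n p" and v: "v \<subseteq> carrier_vec (2*n)"
  shows "in_orbit k (act_subspace A v) \<longleftrightarrow> in_orbit k v"
proof
  assume "in_orbit k v"
  then obtain B where B: "B \<in> congruence_subgroup n p" "v = act_subspace B (D k)" by (auto simp: in_orbit_def)
  then have "act_subspace A v = act_subspace (A * B) (D k)"
    by (simp add: act_subspace_mult[OF congruence_carrier[OF A] congruence_carrier[OF B(1)] D_carrier])
  then show "in_orbit k (act_subspace A v)" using congruence_mult[OF A B(1)] by (auto simp: in_orbit_def)
next
  assume "in_orbit k (act_subspace A v)"
  then obtain B where B: "B \<in> congruence_subgroup n p" "act_subspace A v = act_subspace B (D k)" by (auto simp: in_orbit_def)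
  obtain A' where A': "A' \<in> congruence_subgroup n p" "A' * A = 1\<^sub>m (2*n)"
    using congruence_inverse[OF A] by metis
  have "v = act_subspace (A' * A) v" by (simp add: A'(2) act_subspace_one[OF v])
  also have "\<dots> = act_subspace A' (act_subspace B (D k))"
    using B(2) by (simp add: act_subspace_mult[OF congruence_carrier[OF A'(1)] congruence_carrier[OF A] v])
  also have "\<dots> = act_subspace (A' * B) (D k)"
    by (simp add: act_subspace_mult[OF congruence_carrier[OF A'(1)] congruence_carrier[OF B(1)] D_carrier])
  finally show "in_orbit k v" using congruence_mult[OF A'(1) B(1)] by (auto simp: in_orbit_def)
qed

lemma act_indep:
  assumes A: "A \<in> congruence_subgroup n p" and ind: "indep_on (2*n) S g"
  shows "indep_on (2*n) S (\<lambda>j. mat_app (2*n) A (g j))"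
  unfolding indep_on_def
proof (intro allI impI)
  fix c :: "nat \<Rightarrow> rat"
  assume z: "\<forall>i<2*n. (\<Sum>j\<in>S. c j * of_int (mat_app (2*n) A (g j) i)) = 0"
  obtain B where B: "B \<in> congruence_subgroup n p" "B * A = 1\<^sub>m (2*n)"
    using congruence_inverse[OF A] by metis
  let ?x = "\<lambda>i. \<Sum>j\<in>S. c j * rat_of_int (g j i)"
  have zA: "mat_app (2*n) A ?x i = 0" if "i < 2*n" for i
    using z that by (simp add: mat_app_sum mat_app_of_int)
  have "?x i = 0" if i: "i < 2*n" for i
  proof -
    have "?x i = mat_app (2*n) (B * A) ?x i" by (simp only: B(2) mat_app_one[OF i])
    also have "\<dots> = mat_app (2*n) B (mat_app (2*n) A ?x) i"
      by (rule mat_app_mult[OF congruence_carrier[OF B(1)] congruence_carrier[OF A] i])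
    also have "\<dots> = mat_app (2*n) B (\<lambda>_. 0) i" by (rule fun_cong[OF mat_app_cong]) (rule zA)
    finally show ?thesis by (simp add: mat_app_def)
  qed
  then show "\<forall>j\<in>S. c j = 0" using ind[unfolded indep_on_def, rule_format, of c] by blast
qed

lemma sdim_in_orbit:
  assumes "in_orbit k v" "k < n"
  shows "sdim v = Suc k"
proof -
  obtain A where A: "A \<in> congruence_subgroup n p" "v = act_subspace A (D k)" using assms by (auto simp: in_orbit_def)
  have "indep_on (2*n) {..k} (frame (\<lambda>_. True))" using assms by (intro frame_indep) auto
  from sdim_span_vec[OF _ act_indep[OF A(1) this]] show ?thesis
    by (simp add: A(2) V_def act_span_vec[OF congruence_carrier[OF A(1)]])
qed

text \<open>\<open>D (n - 1)\<close> is Lagrangian. A vector of \<open>W\<close>, moved back by the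
  inverse of \<open>A\<close>, is orthogonal to every \<open>F j\<close>; subtracting a combination
  of the \<open>F j\<close> makes it orthogonal to every \<open>E j\<close> too, hence to every
  \<open>U j\<close>, and \<open>nondeg\<close> makes the difference zero.\<close>

lemma isotropic_maximal:
  assumes w: "W \<in> isotropic_subspaces n" and v: "in_orbit (n - 1) v" and sub: "v \<subseteq> W" and n: "0 < n"
  shows "W = v"
proof -
  obtain A where A: "A \<in> congruence_subgroup n p" "v = act_subspace A (D (n - 1))" using v by (auto simp: in_orbit_def)
  note Ac = congruence_carrier[OF A(1)]
  obtain B where B: "B \<in> congruence_subgroup n p" "A * B = 1\<^sub>m (2*n)"
    using congruence_inverse[OF A(1)] by metis
  note Bc = congruence_carrier[OF B(1)]
  have "W \<subseteq> v"
  proof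
    fix w assume w: "w \<in> W"
    then have "w \<in> carrier_vec (2*n)" using assms(1) by (auto simp: isotropic_subspaces_def subspace_vec_iff)
    then obtain f where f: "w = vec (2*n) f" using carrier_vec_eq_vec by blast
    define x where "x = mat_app (2*n) B f"
    have Ax: "mat_app (2*n) A x i = f i" if "i < 2*n" for i
      unfolding x_def mat_app_mult[OF Ac Bc that, symmetric] B(2) by (rule mat_app_one[OF that])
    have xF: "sform n x (\<lambda>i. of_int (F j i)) = 0" if j: "j < n" for j
    proof -
      have "vec (2*n) (\<lambda>i. of_int (mat_app (2*n) A (F j) i)) \<in> span_vec (2*n) {..n - 1} (\<lambda>j. mat_app (2*n) A (frame (\<lambda>_. True) j))"
        using vec_in_span_vec[of "{..n-1}" j "2*n" "\<lambda>j. mat_app (2*n) A (frame (\<lambda>_. True) j)"] j by (simp add: frame_def)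
      moreover have fun_eq: "(\<lambda>i. rat_of_int (mat_app (2*n) A (F j) i)) = mat_app (2*n) A (\<lambda>i. of_int (F j i))"
        by (simp add: mat_app_of_int fun_eq_iff)
      ultimately have "vec (2*n) (mat_app (2*n) A (\<lambda>i. of_int (F j i))) \<in> v"
        unfolding A(2) V_def act_span_vec[OF Ac] by simp
      then have "symp_form n w (vec (2*n) (mat_app (2*n) A (\<lambda>i. of_int (F j i)))) = 0"
        using assms(1) w sub by (auto simp: isotropic_subspaces_def)
      then have "sform n f (mat_app (2*n) A (\<lambda>i. of_int (F j i))) = 0" by (simp add: f symp_form_vec)
      also have "sform n f (mat_app (2*n) A (\<lambda>i. of_int (F j i))) = sform n (mat_app (2*n) A x) (mat_app (2*n) A (\<lambda>i. of_int (F j i)))"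
        by (intro sform_cong) (simp_all add: Ax)
      finally show ?thesis by (simp add: congruence_sform[OF A(1)])
    qed
    \<comment> \<open>\<open>E j\<close> pairs with \<open>F j\<close> to \<open>d j\<close> and
      with the other \<open>F i\<close> to 0, so these coefficients match the pairings of
      \<open>x\<close> with the \<open>E j\<close>.\<close>
    define c where "c j = sform n (\<lambda>i. of_int (E j i)) x / of_int (d j)" for j
    let ?y = "\<lambda>i. \<Sum>j\<in>{..n-1}. c j * of_int (frame (\<lambda>_. True) j i)"
    have S: "{..n-1} \<subseteq> {..<n}" using n by auto
    have dz: "rat_of_int (d j) \<noteq> 0" if "j < n" for j using d(1)[OF that] by simp
    have E0: "sform n (\<lambda>i. x i - ?y i) (\<lambda>i. of_int (E j i)) = 0" if j: "j < n" for j
    proof -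
      have "sform n (\<lambda>i. of_int (E j i)) ?y = c j * of_int (d j)"
        using E_comb[OF S, of j c "\<lambda>_. True"] j by simp
      then have "sform n (\<lambda>i. of_int (E j i)) ?y = sform n (\<lambda>i. of_int (E j i)) x"
        using dz[OF j] by (simp add: c_def)
      then show ?thesis
        using sform_skew[of n ?y "\<lambda>i. of_int (E j i)"] sform_skew[of n x "\<lambda>i. of_int (E j i)"]
        unfolding sform_diff_left by simp
    qed
    have F0: "sform n (\<lambda>i. x i - ?y i) (\<lambda>i. of_int (F j i)) = 0" if j: "j < n" for j
    proof -
      have "sform n ?y (\<lambda>i. of_int (F j i)) = 0"
        unfolding sform_sum_left using frame_frame[OF _ j, of _ "\<lambda>_. True"] S
        by (intro sum.neutral) (auto simp: sform_of_int frame_def)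
      then show ?thesis unfolding sform_diff_left using xF[OF j] by simp
    qed
    have U0: "sform n (\<lambda>i. x i - ?y i) (\<lambda>i. of_int (U j i)) = 0" if j: "j < n" for j
    proof -
      have "(\<lambda>i. rat_of_int (F j i)) = (\<lambda>i. of_int (int p) * of_int (E j i) + of_int (d j) * of_int (U j i))"
        by (simp add: F_def)
      then show ?thesis using F0[OF j] E0[OF j] dz[OF j] by (simp only: sform_add_right) simp
    qed
    have "x i = ?y i" if "i < 2*n" for i
      using nondeg[of "\<lambda>i. x i - ?y i", OF E0 U0 that] by simp
    then have "vec (2*n) x \<in> D (n - 1)"
      unfolding V_def span_vec_def by (intro CollectI exI[of _ c]) auto
    moreover have "w = map_mat of_int A *\<^sub>v vec (2*n) x"
      unfolding mat_app_vec[OF Ac] f by (intro eq_vecI) (auto simp: Ax)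
    ultimately show "w \<in> v" unfolding A(2) act_subspace_def by blast
  qed
  then show ?thesis using sub by blast
qed

text \<open>A vertex with label \<open>k\<close> has dimension \<open>k + 1\<close>, which gives
  uniqueness. For existence, a chain with all labels has a vertex of each dimension from 1 to
  \<open>n\<close>; the one of dimension \<open>n\<close> is maximal isotropic, so no further
  dimension occurs, and in a chain equal dimension means equality.\<close>

lemma in_orbit_chain:
  assumes \<sigma>: "\<sigma> \<in> tits_building n" and in_orbit: "\<And>k. k < n \<Longrightarrow> \<exists>v\<in>\<sigma>. in_orbit k v" and v: "v \<in> \<sigma>"
  shows "\<exists>!k. k < n \<and> in_orbit k v"
proof -
  have n: "0 < n"
  proof (rule ccontr)
    assume "\<not> 0 < n"
    moreover have "w = 0\<^sub>v 0" if "w \<in> carrier_vec 0" for w :: "rat vec"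
      using that by (intro eq_vecI) auto
    moreover have "v \<subseteq> carrier_vec (2*n)" "0\<^sub>v (2*n) \<in> v" "v \<noteq> {0\<^sub>v (2*n)}"
      using \<sigma> v by (auto simp: tits_building_def order_complex_def tits_poset_def isotropic_subspaces_def subspace_vec_iff)
    ultimately show False by auto
  qed
  have sub: "VectorSpace.subspace class_ring w (module_vec TYPE(rat) (2*n))" "w \<noteq> {0\<^sub>v (2*n)}" "w \<in> isotropic_subspaces n"
    "w \<subseteq> carrier_vec (2*n)" if "w \<in> \<sigma>" for w
    using that \<sigma> by (auto simp: tits_building_def order_complex_def tits_poset_def isotropic_subspaces_def subspace_vec_iff)
  have chain: "w \<subseteq> w' \<or> w' \<subseteq> w" if "w \<in> \<sigma>" "w' \<in> \<sigma>" for w w'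
    using that \<sigma> by (auto simp: tits_building_def order_complex_def chain_subset_def)
  have eq: "w = w'" if "w \<in> \<sigma>" "w' \<in> \<sigma>" "sdim w = sdim w'" for w w'
    using chain[OF that(1,2)] subspace_eq_if_sdim[OF sub(1)[OF that(1)] _ sub(4)[OF that(2)]]
      subspace_eq_if_sdim[OF sub(1)[OF that(2)] _ sub(4)[OF that(1)]] that(3) by auto
  obtain t where t: "t \<in> \<sigma>" "in_orbit (n - 1) t" using in_orbit[of "n - 1"] n by auto
  have "sdim v \<le> n"
  proof (cases "v \<subseteq> t")
    case True
    then show ?thesis using sdim_mono[OF True sub(4)[OF t(1)]] sdim_in_orbit[OF t(2)] n by simp
  next
    case False
    then have "v = t" using chain[OF v t(1)] isotropic_maximal[OF sub(3)[OF v] t(2) _ n] by blast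
    then show ?thesis using sdim_in_orbit[OF t(2)] n by simp
  qed
  moreover have "0 < sdim v" using sdim_pos[OF sub(1,2)[OF v]] .
  ultimately have k: "sdim v - 1 < n" "Suc (sdim v - 1) = sdim v" by auto
  obtain w where w: "w \<in> \<sigma>" "in_orbit (sdim v - 1) w" using in_orbit[OF k(1)] by blast
  have "w = v" using eq[OF w(1) v] sdim_in_orbit[OF w(2) k(1)] k(2) by simp
  show ?thesis
  proof (rule ex1I[of _ "sdim v - 1"])
    show "sdim v - 1 < n \<and> in_orbit (sdim v - 1) v" using w(2) k(1) \<open>w = v\<close> by simp
    show "k = sdim v - 1" if "k < n \<and> in_orbit k v" for k using that sdim_in_orbit[of k v] by simp
  qed
qed

end

section \<open>Comparing a chamber with the apartment of another frame\<close>

lemma det_upper_triangular_mat: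
  fixes u :: "nat \<Rightarrow> nat \<Rightarrow> int"
  assumes "\<And>i j. i < j \<Longrightarrow> j \<le> k \<Longrightarrow> u j i = 0"
  shows "det (mat (Suc k) (Suc k) (\<lambda>(i, j). u i j)) = (\<Prod>i\<le>k. u i i)"
proof -
  have "det (mat (Suc k) (Suc k) (\<lambda>(i, j). u i j)) = prod_list (diag_mat (mat (Suc k) (Suc k) (\<lambda>(i, j). u i j)))"
    by (rule det_upper_triangular[of _ "Suc k"]) (use assms in auto)
  then show ?thesis by (simp add: prod_list_diag_prod atLeast0LessThan lessThan_Suc_atMost)
qed

text \<open>The frame \<open>f\<close> supplies the apartment, and \<open>f'\<close> the chamber
  whose orbit is sought in it.\<close>

locale two_frames =
  f: symplectic_frame n p E U d + f': symplectic_frame n p E' U' d'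
  for n p E U d E' U' d'
begin

text \<open>By \<open>frame_coeff_Ints\<close> the images of the \<open>F'\<close> are integral
  combinations of the frame of \<open>f\<close>. Since \<open>A\<close> is the identity modulo
  \<open>p\<close>, comparing the first \<open>k + 1\<close> of the \<open>f\<close>-coordinates
  gives a matrix congruence whose right side is triangular with unit diagonal entries
  \<open>d'\<close>. So no column of the coefficient matrix may vanish, which forces
  \<open>F j\<close> to be used for all \<open>j \<le> k\<close>; the dimension excludes further
  indices.\<close>

lemma transition:
  assumes A: "A \<in> congruence_subgroup n p" and k: "k < n" and S: "S \<subseteq> {..<n}"
    and eq: "act_subspace A (f'.D k) = f.V S e"
  shows "S = {..k}" "\<And>j. j \<le> k \<Longrightarrow> e j"
    "\<exists>M. (\<forall>i\<le>k. \<forall>l<2*n. mat_app (2*n) A (f'.F i) l = (\<Sum>j\<le>k. M i j * f.F j l)) \<and>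
      [det (mat (Suc k) (Suc k) (\<lambda>(i, j). M i j)) * (\<Prod>j\<le>k. d j) = (\<Prod>j\<le>k. d' j)] (mod int p)"
proof -
  note Ac = congruence_carrier[OF A]
  have fS: "finite S" using S finite_lessThan by (rule finite_subset)
  have act: "act_subspace A (f'.D k) = span_vec (2*n) {..k} (\<lambda>j. mat_app (2*n) A (f'.F j))"
    by (simp add: f'.V_def f'.frame_def act_span_vec[OF Ac])
  have "\<exists>M. \<forall>l<2*n. mat_app (2*n) A (f'.F i) l = (\<Sum>j\<in>S. M j * f.frame e j l)" if i: "i \<le> k" for i
  proof -
    have "vec (2*n) (\<lambda>l. of_int (mat_app (2*n) A (f'.F i) l)) \<in> f.V S e"
      unfolding eq[symmetric] act using i by (intro vec_in_span_vec) auto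
    then obtain c where "vec (2*n) (\<lambda>l. of_int (mat_app (2*n) A (f'.F i) l)) = vec (2*n) (\<lambda>l. \<Sum>j\<in>S. c j * rat_of_int (f.frame e j l))"
      by (auto simp: f.V_def span_vec_def)
    note ceq = this
    have c: "(\<Sum>j\<in>S. c j * rat_of_int (f.frame e j l)) = of_int (mat_app (2*n) A (f'.F i) l)" if "l < 2*n" for l
      using arg_cong[OF ceq, of "\<lambda>v. v $ l"] that by simp
    have fl: "of_int \<lfloor>c j\<rfloor> = c j" if "j \<in> S" for j
    proof -
      have "c j \<in> \<int>" by (rule f.frame_coeff_Ints[OF S that]) (rule c)
      then show ?thesis by (elim Ints_cases) simp
    qed
    have "(\<Sum>j\<in>S. rat_of_int (\<lfloor>c j\<rfloor> * f.frame e j l)) = of_int (mat_app (2*n) A (f'.F i) l)" if "l < 2*n" for l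
      unfolding c[OF that, symmetric] by (rule sum.cong) (simp_all add: fl)
    then have "(\<Sum>j\<in>S. \<lfloor>c j\<rfloor> * f.frame e j l) = mat_app (2*n) A (f'.F i) l" if "l < 2*n" for l
      using that by (simp only: of_int_sum[symmetric] of_int_eq_iff)
    then show ?thesis by (intro exI[of _ "\<lambda>j. \<lfloor>c j\<rfloor>"]) simp
  qed
  then obtain M where M: "\<And>i l. i \<le> k \<Longrightarrow> l < 2*n \<Longrightarrow> mat_app (2*n) A (f'.F i) l = (\<Sum>j\<in>S. M i j * f.frame e j l)"
    by metis
  \<comment> \<open>Columns of indices outside \<open>S\<close>, or of indices where the frame has
    \<open>E j\<close>, are set to zero; they are invisible in the
    \<open>f\<close>-coordinates.\<close>
  define M' where "M' i j = (if j \<in> S \<and> e j then M i j else 0)" for i j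
  \<comment> \<open>At position \<open>m \<le> k\<close> every \<open>E j\<close> vanishes, and so
    does \<open>U j\<close> for \<open>j > k\<close>; the columns \<open>j \<le> k\<close> of
    \<open>M'\<close> remain.\<close>
  have bottom: "[(\<Sum>j\<le>k. M' i j * (d j * U j (n + m))) = d' i * U' i (n + m)] (mod int p)" if im: "i \<le> k" "m \<le> k" for i m
  proof -
    have m: "m < n" "n + m < 2*n" "i < n" using im k by auto
    have fr: "M i j * f.frame e j (n + m) = M' i j * (d j * U j (n + m))" if "j \<in> S" for j
      using that S m f.E_low[of m j] by (auto simp: M'_def f.frame_def f.F_def)
    have "(\<Sum>j\<in>S. M i j * f.frame e j (n + m)) = (\<Sum>j\<in>S. M' i j * (d j * U j (n + m)))"
      using fr by (intro sum.cong) auto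
    also have "\<dots> = (\<Sum>j<n. M' i j * (d j * U j (n + m)))"
      using S by (intro sum.mono_neutral_left) (auto simp: M'_def)
    also have "\<dots> = (\<Sum>j\<le>k. M' i j * (d j * U j (n + m)))"
      using im k f.U_tri[of m] by (intro sum.mono_neutral_right) auto
    finally have "mat_app (2*n) A (f'.F i) (n + m) = (\<Sum>j\<le>k. M' i j * (d j * U j (n + m)))"
      using M[OF im(1) m(2)] by simp
    moreover have "f'.F i (n + m) = d' i * U' i (n + m)" using f'.E_low[of m i] m by (simp add: f'.F_def)
    ultimately show ?thesis using congruence_cong[OF A m(2), of "f'.F i"] by simp
  qed
  define MM where "MM = mat (Suc k) (Suc k) (\<lambda>(i, j). M' i j)"
  define L where "L = mat (Suc k) (Suc k) (\<lambda>(j, m). d j * U j (n + m))"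
  define L' where "L' = mat (Suc k) (Suc k) (\<lambda>(j, m). d' j * U' j (n + m))"
  have c: "MM \<in> carrier_mat (Suc k) (Suc k)" "L \<in> carrier_mat (Suc k) (Suc k)" "L' \<in> carrier_mat (Suc k) (Suc k)"
    by (auto simp: MM_def L_def L'_def)
  have "[det (MM * L) = det L'] (mod int p)"
  proof (rule det_cong[of _ "Suc k"])
    fix i m assume im: "i < Suc k" "m < Suc k"
    have "(MM * L) $$ (i, m) = (\<Sum>j\<le>k. M' i j * (d j * U j (n + m)))"
      using im by (simp add: MM_def L_def scalar_prod_def atLeast0LessThan lessThan_Suc_atMost)
    then show "[(MM * L) $$ (i, m) = L' $$ (i, m)] (mod int p)"
      using bottom[of i m] im by (simp add: L'_def)
  qed (use c in auto)
  moreover have "det L = (\<Prod>j\<le>k. d j * U j (n + j))"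
    unfolding L_def by (rule det_upper_triangular_mat) (use f.U_tri k in auto)
  then have "det L = (\<Prod>j\<le>k. d j)" using f.U_diag k by simp
  moreover have "det L' = (\<Prod>j\<le>k. d' j * U' j (n + j))"
    unfolding L'_def by (rule det_upper_triangular_mat) (use f'.U_tri k in auto)
  then have "det L' = (\<Prod>j\<le>k. d' j)" using f'.U_diag k by simp
  ultimately have det: "[det MM * (\<Prod>j\<le>k. d j) = (\<Prod>j\<le>k. d' j)] (mod int p)"
    using det_mult[OF c(1,2)] by simp
  have nz: "\<not> [0 = (\<Prod>j\<le>k. d' j)] (mod int p)"
  proof
    assume "[0 = (\<Prod>j\<le>k. d' j)] (mod int p)"
    from cong_sym[OF this] have "int p dvd (\<Prod>j\<le>k. d' j)" by (simp only: cong_0_iff)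
    moreover have "prime (int p)" using f.prime_p by simp
    ultimately obtain j where "j \<le> k" "int p dvd d' j" by (auto simp: prime_dvd_prod_iff)
    then show False using f'.d[of j] k zdvd_imp_le[of "int p" "d' j"] by auto
  qed
  have all: "j \<in> S \<and> e j" if j: "j \<le> k" for j
  proof (rule ccontr)
    assume "\<not> ?thesis"
    then have "det MM = 0"
      using j by (intro det_zero_col[OF c(1), of j]) (auto simp: MM_def M'_def)
    with det nz show False by simp
  qed
  have "card S = sdim (act_subspace A (f'.D k))" unfolding eq f.sdim_V[OF S] ..
  also have "\<dots> \<le> Suc k" unfolding act using sdim_span_vec_le[of "{..k}"] by simp
  finally have "{..k} = S" using all by (intro card_seteq[OF fS]) auto
  then show Sk: "S = {..k}" ..
  show ej: "\<And>j. j \<le> k \<Longrightarrow> e j" using all by blast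
  have "mat_app (2*n) A (f'.F i) l = (\<Sum>j\<le>k. M i j * f.F j l)" if "i \<le> k" "l < 2*n" for i l
    unfolding M[OF that] Sk using ej by (intro sum.cong) (auto simp: f.frame_def)
  moreover have "MM = mat (Suc k) (Suc k) (\<lambda>(i, j). M i j)"
    using all by (intro eq_matI) (auto simp: MM_def M'_def)
  ultimately show "\<exists>M. (\<forall>i\<le>k. \<forall>l<2*n. mat_app (2*n) A (f'.F i) l = (\<Sum>j\<le>k. M i j * f.F j l)) \<and>
      [det (mat (Suc k) (Suc k) (\<lambda>(i, j). M i j)) * (\<Prod>j\<le>k. d j) = (\<Prod>j\<le>k. d' j)] (mod int p)"
    using det by (intro exI[of _ M]) auto
qed

text \<open>The matrix \<open>M\<close> of the transition is invertible over \<open>\<int>\<close>, so its determinant is a sign.\<close>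

lemma transition_unimodular:
  assumes A: "A \<in> congruence_subgroup n p" and k: "k < n" and S: "S \<subseteq> {..<n}"
    and eq: "act_subspace A (f'.D k) = f.V S e"
  shows "\<exists>M. (\<forall>i\<le>k. \<forall>l<2*n. mat_app (2*n) A (f'.F i) l = (\<Sum>j\<le>k. M i j * f.F j l)) \<and>
    ([(\<Prod>j\<le>k. d j) = (\<Prod>j\<le>k. d' j)] (mod int p) \<or> [- (\<Prod>j\<le>k. d j) = (\<Prod>j\<le>k. d' j)] (mod int p))"
proof -
  \<comment> \<open>The inverse of \<open>A\<close> carries the chamber of \<open>f\<close> back to
    that of \<open>f'\<close>, so \<open>transition\<close> with exchanged roles gives an integral
    matrix \<open>N\<close> for the way back.\<close>
  interpret r: two_frames n p E' U' d' E U d by unfold_locales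
  note t = transition[OF assms]
  from t(3) obtain M where M0: "\<forall>i\<le>k. \<forall>l<2*n. mat_app (2*n) A (f'.F i) l = (\<Sum>j\<le>k. M i j * f.F j l)"
    and detM: "[det (mat (Suc k) (Suc k) (\<lambda>(i, j). M i j)) * (\<Prod>j\<le>k. d j) = (\<Prod>j\<le>k. d' j)] (mod int p)"
    by (elim exE conjE)
  have M: "mat_app (2*n) A (f'.F i) l = (\<Sum>j\<le>k. M i j * f.F j l)" if "i \<le> k" "l < 2*n" for i l
    using M0 that by simp
  obtain B where B: "B \<in> congruence_subgroup n p" "A * B = 1\<^sub>m (2*n)" "B * A = 1\<^sub>m (2*n)"
    using congruence_inverse[OF A] .
  note c = congruence_carrier[OF A] congruence_carrier[OF B(1)]
  have "f.V S e = f.D k" using t(1,2) f.V_cong[of S e "\<lambda>_. True"] by simp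
  then have "act_subspace B (f.D k) = act_subspace (B * A) (f'.D k)"
    using eq by (simp add: act_subspace_mult[OF c(2,1) f'.D_carrier])
  then have "act_subspace B (f.D k) = f'.V {..k} (\<lambda>_. True)"
    by (simp add: B(3) act_subspace_one[OF f'.D_carrier])
  note actB = this
  have "{..k} \<subseteq> {..<n}" using k by auto
  from r.transition(3)[OF B(1) k this actB]
  obtain N where N0: "\<forall>i\<le>k. \<forall>l<2*n. mat_app (2*n) B (f.F i) l = (\<Sum>j\<le>k. N i j * f'.F j l)"
    by (elim exE conjE)
  have N: "mat_app (2*n) B (f.F i) l = (\<Sum>j\<le>k. N i j * f'.F j l)" if "i \<le> k" "l < 2*n" for i l
    using N0 that by simp
  \<comment> \<open>Going back and forth fixes each \<open>F i\<close>, and the \<open>F i\<close>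
    are independent, so coefficients can be compared.\<close>
  have NM: "(\<Sum>j\<le>k. N i j * M j r) = (if i = r then 1 else 0)" if ir: "i \<le> k" "r \<le> k" for i r
  proof -
    have "(\<Sum>r\<le>k. of_int ((\<Sum>j\<le>k. N i j * M j r) - (if r = i then 1 else 0)) * rat_of_int (f.frame (\<lambda>_. True) r l)) = 0" if l: "l < 2*n" for l
    proof -
      have "f.F i l = mat_app (2*n) A (mat_app (2*n) B (f.F i)) l"
        using mat_app_mult[OF c l, of "f.F i"] by (simp add: B(2) mat_app_one[OF l])
      also have "\<dots> = mat_app (2*n) A (\<lambda>l. \<Sum>j\<le>k. N i j * f'.F j l) l"
        by (rule fun_cong[OF mat_app_cong]) (rule N[OF ir(1)])
      also have "\<dots> = (\<Sum>j\<le>k. N i j * (\<Sum>r\<le>k. M j r * f.F r l))"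
        unfolding mat_app_sum using M l by (intro sum.cong) auto
      also have "\<dots> = (\<Sum>j\<le>k. \<Sum>r\<le>k. N i j * M j r * f.F r l)"
        by (simp add: sum_distrib_left mult.assoc)
      also have "\<dots> = (\<Sum>r\<le>k. (\<Sum>j\<le>k. N i j * M j r) * f.F r l)"
        unfolding sum_distrib_right by (rule sum.swap)
      finally have "(\<Sum>r\<le>k. (\<Sum>j\<le>k. N i j * M j r) * f.F r l) - (\<Sum>r\<le>k. if r = i then f.F i l else 0) = 0"
        using ir by simp
      moreover have "(\<Sum>r\<le>k. ((\<Sum>j\<le>k. N i j * M j r) - (if r = i then 1 else 0)) * f.F r l)
          = (\<Sum>r\<le>k. (\<Sum>j\<le>k. N i j * M j r) * f.F r l) - (\<Sum>r\<le>k. if r = i then f.F i l else 0)"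
        unfolding sum_subtractf[symmetric] by (intro sum.cong) (auto simp: algebra_simps)
      ultimately have "rat_of_int (\<Sum>r\<le>k. ((\<Sum>j\<le>k. N i j * M j r) - (if r = i then 1 else 0)) * f.F r l) = 0"
        by simp
      then show ?thesis by (simp add: f.frame_def)
    qed
    note rel = this
    have ind: "indep_on (2*n) {..k} (f.frame (\<lambda>_. True))" using k by (intro f.frame_indep) auto
    have "rat_of_int ((\<Sum>j\<le>k. N i j * M j r) - (if r = i then 1 else 0)) = 0"
    proof (rule ind[unfolded indep_on_def, rule_format, of "\<lambda>r. rat_of_int ((\<Sum>j\<le>k. N i j * M j r) - (if r = i then 1 else 0))" r])
      show "r \<in> {..k}" using ir(2) by simp
    qed (rule rel)
    then show ?thesis by (simp only: of_int_eq_0_iff) auto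
  qed
  let ?M = "mat (Suc k) (Suc k) (\<lambda>(i, j). M i j)" and ?N = "mat (Suc k) (Suc k) (\<lambda>(i, j). N i j)"
  have "?N * ?M = 1\<^sub>m (Suc k)"
  proof (rule eq_matI)
    fix i r assume "i < dim_row (1\<^sub>m (Suc k) :: int mat)" "r < dim_col (1\<^sub>m (Suc k) :: int mat)"
    then show "(?N * ?M) $$ (i, r) = 1\<^sub>m (Suc k) $$ (i, r)"
      using NM[of i r] by (simp add: scalar_prod_def atLeast0LessThan lessThan_Suc_atMost)
  qed auto
  then have "det ?N * det ?M = 1"
    using det_mult[of ?N "Suc k" ?M] by simp
  then have "det ?M = 1 \<or> det ?M = - 1" using zmult_eq_1_iff by blast
  then have "[(\<Prod>j\<le>k. d j) = (\<Prod>j\<le>k. d' j)] (mod int p) \<or> [- (\<Prod>j\<le>k. d j) = (\<Prod>j\<le>k. d' j)] (mod int p)"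
    using detM by auto
  with M0 show ?thesis by (intro exI[of _ M] conjI)
qed

text \<open>Dividing the products for successive \<open>k\<close> gives \<open>d k = d' k\<close> up
  to sign modulo \<open>p\<close>, and the bound \<open>p / 2\<close> removes the sign. Then the
  \<open>f\<close>-coordinates, triangular in both frames, show that row \<open>k\<close> of
  \<open>M\<close> is a unit vector modulo \<open>p\<close>; hence \<open>F' k\<close> and
  \<open>F k\<close> agree modulo \<open>p\<close>, and \<open>d k\<close> cancels. The matrix
  \<open>A\<close> may differ for each \<open>k\<close>, since it only enters as the identity modulo
  \<open>p\<close>.\<close>

lemma frames_cong:
  assumes in_orbit: "\<And>k. k < n \<Longrightarrow> \<exists>S e. S \<subseteq> {..<n} \<and> f'.in_orbit k (f.V S e)"
  shows "k < n \<Longrightarrow> d' k = d k" and "k < n \<Longrightarrow> l < 2*n \<Longrightarrow> [U' k l = U k l] (mod int p)"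
proof -
  have pp: "prime (int p)" using f.prime_p by simp
  have ex: "\<exists>A M. A \<in> congruence_subgroup n p \<and>
      (\<forall>i\<le>k. \<forall>l<2*n. mat_app (2*n) A (f'.F i) l = (\<Sum>j\<le>k. M i j * f.F j l)) \<and>
      ([(\<Prod>j\<le>k. d j) = (\<Prod>j\<le>k. d' j)] (mod int p) \<or> [- (\<Prod>j\<le>k. d j) = (\<Prod>j\<le>k. d' j)] (mod int p))" if k: "k < n" for k
  proof -
    obtain S e A where A: "S \<subseteq> {..<n}" "A \<in> congruence_subgroup n p" "f.V S e = act_subspace A (f'.D k)"
      using in_orbit[OF k] by (auto simp: f'.in_orbit_def)
    from transition_unimodular[OF A(2) k A(1) A(3)[symmetric]]
    obtain M where M: "(\<forall>i\<le>k. \<forall>l<2*n. mat_app (2*n) A (f'.F i) l = (\<Sum>j\<le>k. M i j * f.F j l)) \<and>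
      ([(\<Prod>j\<le>k. d j) = (\<Prod>j\<le>k. d' j)] (mod int p) \<or> [- (\<Prod>j\<le>k. d j) = (\<Prod>j\<le>k. d' j)] (mod int p))" ..
    show ?thesis by (rule exI[of _ A], rule exI[of _ M], rule conjI[OF A(2) M])
  qed
  have deq: "d' k = d k" if "k < n" for k
    using that
  proof (induction k rule: less_induct)
    case (less k)
    let ?Q = "\<Prod>j<k. d j"
    have "(\<Prod>j<k. d' j) = ?Q" using less by (intro prod.cong) auto
    then have pr: "(\<Prod>j\<le>k. d j) = ?Q * d k" "(\<Prod>j\<le>k. d' j) = ?Q * d' k"
      by (simp_all add: lessThan_Suc_atMost[symmetric] mult.commute)
    have cop: "coprime ?Q (int p)"
      using f.coprime_d less.prems by (intro prod_coprime_left) (auto simp: coprime_commute)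
    have "[?Q * d k = ?Q * d' k] (mod int p) \<or> [?Q * (- d k) = ?Q * d' k] (mod int p)"
      using ex[OF less.prems] unfolding pr by auto
    then have "[d k = d' k] (mod int p) \<or> [- d k = d' k] (mod int p)"
      using cong_mult_lcancel[OF cop] by blast
    then have "int p dvd d k - d' k \<or> int p dvd - d k - d' k"
      by (simp add: cong_iff_dvd_diff)
    then have "int p dvd d k - d' k \<or> int p dvd d k + d' k"
      by (metis dvd_minus_iff minus_diff_eq add.commute diff_minus_eq_add minus_minus)
    \<comment> \<open>The sum lies strictly between 0 and \<open>p\<close>, and the difference
      strictly between \<open>- p\<close> and \<open>p\<close>, so only the difference can be
      divisible, and then it is 0.\<close>
    moreover have "0 < d k" "2 * d k < int p" "0 < d' k" "2 * d' k < int p"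
      using f.d f'.d less.prems by auto
    ultimately show ?case
      using zdvd_imp_le[of "int p" "d k + d' k"] zdvd_imp_le[of "int p" "d k - d' k"] zdvd_imp_le[of "int p" "d' k - d k"]
      by (smt (verit) dvd_minus_iff)
  qed
  then show "k < n \<Longrightarrow> d' k = d k" .
  show "[U' k l = U k l] (mod int p)" if k: "k < n" and l: "l < 2*n"
  proof -
    obtain A M where A: "A \<in> congruence_subgroup n p"
      and M: "\<And>l. l < 2*n \<Longrightarrow> mat_app (2*n) A (f'.F k) l = (\<Sum>j\<le>k. M k j * f.F j l)"
      using ex[OF k] by (elim exE conjE) simp
    have cop: "coprime (d j) (int p)" if "j < n" for j using f.coprime_d[OF that] by (simp add: coprime_commute)
    have row: "[f'.F k l = (\<Sum>j\<le>k. M k j * f.F j l)] (mod int p)" if "l < 2*n" for l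
      using congruence_cong[OF A that, of "f'.F k"] M[OF that] by (simp add: cong_sym_eq)
    have F_low: "f.F j (n + m) = d j * U j (n + m)" "f'.F j (n + m) = d' j * U' j (n + m)" if "j < n" "m < n" for j m
      using f.E_low[OF that(2,1)] f'.E_low[OF that(2,1)] by (simp_all add: f.F_def f'.F_def)
    have diag: "[d' k * U' k (n + m) = M k m * d m] (mod int p)"
      if m: "m \<le> k" and z: "\<And>j. j < m \<Longrightarrow> [M k j = 0] (mod int p)" for m
    proof -
      have mn: "m < n" using m k by simp
      have "[(\<Sum>j\<le>k. M k j * f.F j (n + m)) = (\<Sum>j\<le>k. if j = m then M k m * d m else 0)] (mod int p)"
      proof (rule cong_sum)
        fix j assume j: "j \<in> {..k}"
        consider "j < m" | "j = m" | "m < j" by linarith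
        then show "[M k j * f.F j (n + m) = (if j = m then M k m * d m else 0)] (mod int p)"
        proof cases
          case 1
          then show ?thesis using cong_mult[OF z[OF 1] cong_refl, of "f.F j (n + m)"] by simp
        next
          case 2
          then show ?thesis using F_low(1)[OF mn mn] f.U_diag[OF mn] by simp
        next
          case 3
          then have "f.F j (n + m) = 0" using F_low(1)[of j m] f.U_tri[of m j] j k mn by simp
          then show ?thesis using 3 by simp
        qed
      qed
      then have "[f'.F k (n + m) = M k m * d m] (mod int p)"
        using row[of "n + m"] mn m cong_trans by fastforce
      then show ?thesis using F_low(2)[OF k mn] by simp
    qed
    \<comment> \<open>Forward substitution: \<open>U' k\<close> vanishes at position
      \<open>m < k\<close>, and the earlier entries of the row are already zero modulo
      \<open>p\<close>.\<close>
    have M0: "[M k m = 0] (mod int p)" if "m < k" for m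
      using that
    proof (induction m rule: less_induct)
      case (less m)
      have "U' k (n + m) = 0" using f'.U_tri[OF less.prems k] .
      then have "[M k m * d m = 0 * d m] (mod int p)"
        using diag[of m] less by (simp add: cong_sym_eq)
      moreover have "m < n" using less.prems k by simp
      ultimately show ?case by (simp only: cong_mult_rcancel[OF cop])
    qed
    have "[1 * d k = M k k * d k] (mod int p)"
      using diag[OF order_refl M0] f'.U_diag[OF k] deq[OF k] by simp
    then have "[1 = M k k] (mod int p)" by (simp only: cong_mult_rcancel[OF cop[OF k]])
    then have M1: "[M k k = 1] (mod int p)" by (rule cong_sym)
    have "[(\<Sum>j\<le>k. M k j * f.F j l) = (\<Sum>j\<le>k. if j = k then f.F k l else 0)] (mod int p)"
    proof (rule cong_sum)
      fix j assume j: "j \<in> {..k}"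
      show "[M k j * f.F j l = (if j = k then f.F k l else 0)] (mod int p)"
      proof (cases "j = k")
        case True
        then show ?thesis using cong_mult[OF M1 cong_refl, of "f.F k l"] by simp
      next
        case False
        then show ?thesis using cong_mult[OF M0[of j] cong_refl, of "f.F j l"] j by simp
      qed
    qed
    then have "[f'.F k l = f.F k l] (mod int p)"
      using row[OF l] cong_trans by fastforce
    note FF = this
    have e: "[int p * x + y = y] (mod int p)" for x y :: int by (simp add: cong_iff_dvd_diff)
    have "[d k * U' k l = f'.F k l] (mod int p)"
      unfolding f'.F_def deq[OF k] by (rule cong_sym[OF e])
    also have "[f'.F k l = f.F k l] (mod int p)" by (rule FF)
    also have "[f.F k l = d k * U k l] (mod int p)"
      unfolding f.F_def by (rule e)
    finally have "[d k * U' k l = d k * U k l] (mod int p)" .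
    then show ?thesis by (simp only: cong_mult_lcancel[OF cop[OF k]])
  qed
qed

end

section \<open>A family of inequivalent frames\<close>

text \<open>The entries of one function \<open>a\<close> on pairs are shared out: those below the
  diagonal fill a unitriangular matrix \<open>Q\<close>, the others, in \<open>sym_entry\<close>, a
  symmetric matrix \<open>B\<close>. In blocks the symplectic matrix has first rows
  \<open>Q^-T\<close>, \<open>B Q\<close> and last rows \<open>0\<close>, \<open>Q\<close>; its
  columns are \<open>Evec\<close> and \<open>Uvec\<close>.\<close>

definition unitri :: "(nat \<times> nat \<Rightarrow> int) \<Rightarrow> nat \<Rightarrow> nat \<Rightarrow> int" where
  "unitri a i j = (if i = j then 1 else if j < i then a (i, j) else 0)"

definition sym_entry :: "(nat \<times> nat \<Rightarrow> int) \<Rightarrow> nat \<Rightarrow> nat \<Rightarrow> int" where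
  "sym_entry a i j = a (min i j, max i j)"

text \<open>The transposed inverse of \<open>unitri\<close>: as the determinant is 1, the adjugate
  is the inverse, and it is integral.\<close>

definition unitri_dual :: "nat \<Rightarrow> (nat \<times> nat \<Rightarrow> int) \<Rightarrow> nat \<Rightarrow> nat \<Rightarrow> int" where
  "unitri_dual n a i j = adj_mat (mat n n (\<lambda>(i, j). unitri a i j)) $$ (j, i)"

lemma unitri_dual_inverse:
  "k < n \<Longrightarrow> j < n \<Longrightarrow> (\<Sum>i<n. unitri_dual n a i k * unitri a i j) = (if k = j then 1 else 0)"
  "i < n \<Longrightarrow> k < n \<Longrightarrow> (\<Sum>j<n. unitri a i j * unitri_dual n a k j) = (if i = k then 1 else 0)"
proof -
  let ?Q = "mat n n (\<lambda>(i, j). unitri a i j)"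
  have Qc: "?Q \<in> carrier_mat n n" by simp
  have "det ?Q = prod_list (diag_mat ?Q)"
    by (rule det_lower_triangular[of n]) (auto simp: unitri_def)
  also have "\<dots> = 1" by (simp add: prod_list_diag_prod unitri_def)
  finally have det: "det ?Q = 1" .
  note adj = adj_mat[OF Qc, unfolded det]
  have ac: "dim_row (adj_mat ?Q) = n" "dim_col (adj_mat ?Q) = n" using adj(1) by auto
  show "(\<Sum>i<n. unitri_dual n a i k * unitri a i j) = (if k = j then 1 else 0)" if kj: "k < n" "j < n"
  proof -
    have "(adj_mat ?Q * ?Q) $$ (k, j) = (\<Sum>i<n. unitri_dual n a i k * unitri a i j)"
      using kj ac by (simp add: scalar_prod_def unitri_dual_def lessThan_atLeast0)
    then show ?thesis using kj unfolding adj(3) by simp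
  qed
  show "(\<Sum>j<n. unitri a i j * unitri_dual n a k j) = (if i = k then 1 else 0)" if ik: "i < n" "k < n"
  proof -
    have "(?Q * adj_mat ?Q) $$ (i, k) = (\<Sum>j<n. unitri a i j * unitri_dual n a k j)"
      using ik ac by (simp add: scalar_prod_def unitri_dual_def lessThan_atLeast0)
    then show ?thesis using ik unfolding adj(2) by simp
  qed
qed

text \<open>Recovers an entry of \<open>x\<close> from the products of \<open>x\<close> with the
  columns of \<open>Q\<close>, where \<open>R\<close> acts as column \<open>k\<close> of the
  inverse; in particular \<open>x k\<close> vanishes when these products do.\<close>

lemma sum_delta_double:
  fixes x :: "nat \<Rightarrow> 'a::comm_ring_1"
  assumes "k < n" "\<And>i. i < n \<Longrightarrow> (\<Sum>j<n. of_int (Q i j) * of_int (R j)) = (if i = k then 1 else 0 :: 'a)"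
  shows "x k = (\<Sum>j<n. (\<Sum>i<n. x i * of_int (Q i j)) * of_int (R j))"
proof -
  have "(\<Sum>i<n. x i * (\<Sum>j<n. of_int (Q i j) * of_int (R j))) = (\<Sum>i<n. if i = k then x i else 0)"
    by (rule sum.cong) (simp_all add: assms(2))
  also have "\<dots> = x k" using assms(1) by simp
  finally have "x k = (\<Sum>i<n. x i * (\<Sum>j<n. of_int (Q i j) * of_int (R j)))" ..
  also have "\<dots> = (\<Sum>i<n. \<Sum>j<n. x i * of_int (Q i j) * of_int (R j))"
    by (simp add: sum_distrib_left mult.assoc)
  also have "\<dots> = (\<Sum>j<n. (\<Sum>i<n. x i * of_int (Q i j)) * of_int (R j))"
    unfolding sum_distrib_right by (rule sum.swap)
  finally show ?thesis .
qed

definition Evec :: "nat \<Rightarrow> (nat \<times> nat \<Rightarrow> int) \<Rightarrow> nat \<Rightarrow> nat \<Rightarrow> int" where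
  "Evec n a j i = (if i < n then unitri_dual n a i j else 0)"

definition Uvec :: "nat \<Rightarrow> (nat \<times> nat \<Rightarrow> int) \<Rightarrow> nat \<Rightarrow> nat \<Rightarrow> int" where
  "Uvec n a j i = (if i < n then \<Sum>l<n. sym_entry a i l * unitri a l j else unitri a (i - n) j)"

lemma unitri_dual_of_int:
  assumes "i < n" "k < n"
  shows "(\<Sum>j<n. of_int (unitri a i j) * of_int (unitri_dual n a k j)) = (if i = k then 1 else 0 :: 'a::comm_ring_1)"
  using arg_cong[OF unitri_dual_inverse(2)[OF assms, of a], of "of_int :: int \<Rightarrow> 'a"] by (cases "i = k") simp_all

text \<open>Symmetry of \<open>sym_entry\<close> makes the \<open>Uvec\<close> isotropic. For
  nondegeneracy, orthogonality to the \<open>Evec\<close> kills the \<open>f\<close>-part of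
  \<open>x\<close> since \<open>unitri_dual\<close> is invertible; then orthogonality to the
  \<open>Uvec\<close> only involves \<open>unitri\<close> and kills the
  \<open>e\<close>-part.\<close>

lemma symplectic_frame_Evec_Uvec:
  assumes p: "prime p" and d: "\<And>j. j < n \<Longrightarrow> 0 < d j" "\<And>j. j < n \<Longrightarrow> 2 * d j < int p"
  shows "symplectic_frame n p (Evec n a) (Uvec n a) d"
proof
  show "sform n (Evec n a i) (Evec n a j) = 0" for i j
    by (simp add: sform_def Evec_def)
  show "sform n (Evec n a i) (Uvec n a j) = (if i = j then 1 else 0)" if "i < n" "j < n" for i j
    using unitri_dual_inverse(1)[OF that, of a] by (simp add: sform_def Evec_def Uvec_def)
  show "sform n (Uvec n a i) (Uvec n a j) = 0" for i j
  proof -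
    have "(\<Sum>u<n. Uvec n a i u * Uvec n a j (n + u)) = (\<Sum>u<n. \<Sum>l<n. sym_entry a u l * unitri a l i * unitri a u j)"
      by (simp add: Uvec_def sum_distrib_right)
    also have "\<dots> = (\<Sum>l<n. \<Sum>u<n. sym_entry a u l * unitri a l i * unitri a u j)" by (rule sum.swap)
    also have "\<dots> = (\<Sum>l<n. \<Sum>u<n. unitri a l i * (sym_entry a l u * unitri a u j))"
      by (intro sum.cong) (auto simp: sym_entry_def min.commute max.commute)
    also have "\<dots> = (\<Sum>u<n. Uvec n a i (n + u) * Uvec n a j u)"
      by (simp add: Uvec_def sum_distrib_left)
    finally show ?thesis by (simp add: sform_def sum_subtractf)
  qed
  show "Evec n a j (n + i) = 0" for i j by (simp add: Evec_def)
  show "Uvec n a j (n + i) = 0" if "i < j" for i j using that by (simp add: Uvec_def unitri_def)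
  show "Uvec n a j (n + j) = 1" for j by (simp add: Uvec_def unitri_def)
  fix x :: "nat \<Rightarrow> rat" and i
  assume E: "\<And>j. j < n \<Longrightarrow> sform n x (\<lambda>i. rat_of_int (Evec n a j i)) = 0"
    and U: "\<And>j. j < n \<Longrightarrow> sform n x (\<lambda>i. rat_of_int (Uvec n a j i)) = 0" and i: "i < 2 * n"
  have "(\<Sum>i<n. x (n + i) * of_int (unitri_dual n a i j)) = 0" if "j < n" for j
    using E[OF that] by (simp add: sform_def Evec_def sum_negf)
  note z1 = this
  have hi: "x (n + k) = 0" if k: "k < n" for k
  proof -
    have "(\<Sum>j<n. rat_of_int (unitri_dual n a i j) * of_int (unitri a k j)) = (if i = k then 1 else 0)" if "i < n" for i
      using unitri_dual_of_int[OF k that, of a, where 'a = rat] by (auto simp: mult.commute)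
    from sum_delta_double[OF k this, where x = "\<lambda>i. x (n + i)"] show ?thesis
      by (simp add: z1)
  qed
  have "(\<Sum>i<n. x i * of_int (unitri a i j)) = 0" if "j < n" for j
    using U[OF that] hi by (simp add: sform_def Uvec_def)
  note z2 = this
  have lo: "x k = 0" if k: "k < n" for k
  proof -
    have "(\<Sum>j<n. rat_of_int (unitri a i j) * of_int (unitri_dual n a k j)) = (if i = k then 1 else 0)" if "i < n" for i
      using that k by (rule unitri_dual_of_int)
    from sum_delta_double[OF k this, where x = x] show ?thesis
      by (simp add: z2)
  qed
  show "x i = 0"
  proof (cases "i < n")
    case False
    then show ?thesis using hi[of "i - n"] i by simp
  qed (rule lo)
qed (use p d in auto)

text \<open>The \<open>f\<close>-part shows the entries of \<open>unitri\<close>, and residues in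
  the range below \<open>p\<close> are equal once congruent. With \<open>unitri\<close> known,
  multiplying the \<open>e\<close>-part by its inverse recovers \<open>sym_entry\<close> modulo
  \<open>p\<close>.\<close>

lemma Uvec_cong_imp_eq:
  assumes a: "\<And>i j. i < n \<Longrightarrow> j < n \<Longrightarrow> 0 \<le> a (i, j) \<and> a (i, j) < int p"
    and a': "\<And>i j. i < n \<Longrightarrow> j < n \<Longrightarrow> 0 \<le> a' (i, j) \<and> a' (i, j) < int p"
    and U: "\<And>k l. k < n \<Longrightarrow> l < 2*n \<Longrightarrow> [Uvec n a' k l = Uvec n a k l] (mod int p)"
    and ij: "i < n" "j < n"
  shows "a' (i, j) = a (i, j)"
proof -
  have eqI: "a' (i, j) = a (i, j)" if "i < n" "j < n" "[a' (i, j) = a (i, j)] (mod int p)" for i j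
    using cong_less_imp_eq_int[OF _ _ _ _ that(3)] a[OF that(1,2)] a'[OF that(1,2)] by simp
  have unitri: "a' (i, j) = a (i, j)" if "i < n" "j < i" for i j
    using U[of j "n + i"] that by (intro eqI) (auto simp: Uvec_def unitri_def)
  then have lowe: "unitri a' i j = unitri a i j" if "i < n" for i j using that by (auto simp: unitri_def)
  have symc: "[sym_entry a' i m = sym_entry a i m] (mod int p)" if im: "i < n" "m < n" for i m
  proof -
    have s: "sym_entry b i m = (\<Sum>k<n. (\<Sum>l<n. sym_entry b i l * unitri a l k) * unitri_dual n a m k)" for b
    proof -
      have "(\<Sum>j<n. of_int (unitri a l j) * of_int (unitri_dual n a m j)) = (if l = m then 1 else 0 :: int)" if "l < n" for l
        using that im(2) by (rule unitri_dual_of_int)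
      from sum_delta_double[OF im(2) this, where x = "\<lambda>l. sym_entry b i l"] show ?thesis by simp
    qed
    have "[(\<Sum>l<n. sym_entry a' i l * unitri a l k) = (\<Sum>l<n. sym_entry a i l * unitri a l k)] (mod int p)" if "k < n" for k
      using U[OF that, of i] im(1) lowe by (simp add: Uvec_def)
    note uc = this
    show ?thesis unfolding s by (rule cong_sum, rule cong_mult[OF uc cong_refl]) simp
  qed
  show ?thesis
  proof (cases "j < i")
    case False
    then show ?thesis using symc[OF ij] ij by (intro eqI) (auto simp: sym_entry_def min_def max_def not_less)
  qed (use unitri ij in auto)
qed

section \<open>Invariance of orbit weights\<close>

lemma label_weight_act:
  assumes x: "x \<in> topspace (realization (tits_building n))"
    and Q: "\<And>v. v \<subseteq> carrier_vec (2*n) \<Longrightarrow> Q (act_subspace A v) \<longleftrightarrow> Q v"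
  shows "label_weight Q (realization_map (act_subspace A) x) = label_weight Q x"
proof -
  obtain \<sigma> where \<sigma>: "\<sigma> \<in> tits_building n" "x \<in> closed_simplex \<sigma>" using x by (auto simp: topspace_realization)
  define F where "F = {v. x v \<noteq> 0}"
  have F: "F \<subseteq> \<sigma>" using \<sigma>(2) by (auto simp: F_def closed_simplex_def)
  have finF: "finite F" using F \<sigma>(1) finite_subset[of F \<sigma>] by (simp add: tits_building_def order_complex_def)
  have FQ: "Q (act_subspace A v) \<longleftrightarrow> Q v" if "v \<in> F" for v
    using that F \<sigma>(1) by (intro Q) (auto simp: tits_building_def order_complex_def tits_poset_def isotropic_subspaces_def subspace_vec_iff)
  define r where "r = realization_map (act_subspace A) x"
  have r: "r w = (\<Sum>v\<in>{v \<in> F. act_subspace A v = w}. x v)" for w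
    by (simp add: r_def realization_map_def F_def)
  have r0: "r w = 0" if "w \<notin> act_subspace A ` F" for w
    using that unfolding r by (intro sum.neutral) auto
  have "label_weight Q r = (\<Sum>w\<in>{w \<in> act_subspace A ` F. Q w}. r w)"
    unfolding label_weight_def using finF r0 by (intro sum.mono_neutral_left) auto
  also have "\<dots> = (\<Sum>w\<in>act_subspace A ` F. if Q w then r w else 0)"
    using finF by (simp add: sum.inter_filter)
  also have "\<dots> = (\<Sum>w\<in>act_subspace A ` F. \<Sum>v\<in>{v \<in> F. act_subspace A v = w}. if Q v then x v else 0)"
  proof (rule sum.cong)
    fix w
    have "(if Q w then r w else 0) = (\<Sum>v\<in>{v \<in> F. act_subspace A v = w}. if Q w then x v else 0)"
      by (simp add: r)
    also have "\<dots> = (\<Sum>v\<in>{v \<in> F. act_subspace A v = w}. if Q v then x v else 0)"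
      using FQ by (intro sum.cong) auto
    finally show "(if Q w then r w else 0) = (\<Sum>v\<in>{v \<in> F. act_subspace A v = w}. if Q v then x v else 0)" .
  qed simp
  also have "\<dots> = (\<Sum>v\<in>F. if Q v then x v else 0)"
    using finF by (intro sum.group) auto
  also have "\<dots> = (\<Sum>v\<in>{v \<in> F. Q v}. x v)"
    using finF by (simp add: sum.inter_filter)
  also have "\<dots> = label_weight Q x" by (simp add: label_weight_def F_def)
  finally show ?thesis by (simp add: r_def)
qed

lemma label_weight_orbit:
  assumes x: "x \<in> topspace (realization (tits_building n))" and y: "y \<in> topspace (realization (tits_building n))"
    and orb: "building_orbit n p x = building_orbit n p y"
    and Q: "\<And>A v. A \<in> congruence_subgroup n p \<Longrightarrow> v \<subseteq> carrier_vec (2*n) \<Longrightarrow> Q (act_subspace A v) \<longleftrightarrow> Q v"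
  shows "label_weight Q x = label_weight Q y"
proof -
  \<comment> \<open>Equal orbits are compared as sets: the image of \<open>x\<close> under the
    identity matrix is the image of \<open>y\<close> under some \<open>B\<close>, and neither action
    changes the weight.\<close>
  have "realization_map (act_subspace (1\<^sub>m (2*n))) x \<in> building_orbit n p x"
    unfolding building_orbit_def using congruence_one by blast
  then obtain B where B: "B \<in> congruence_subgroup n p"
    "realization_map (act_subspace (1\<^sub>m (2*n))) x = realization_map (act_subspace B) y"
    unfolding orb by (auto simp: building_orbit_def)
  have "label_weight Q x = label_weight Q (realization_map (act_subspace (1\<^sub>m (2*n))) x)"
    using label_weight_act[OF x, of Q] Q[OF congruence_one] by simp
  also have "\<dots> = label_weight Q y"
    unfolding B(2) using label_weight_act[OF y, of Q B] Q[OF B(1)] by simp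
  finally show ?thesis .
qed

section \<open>The parameters of the chambers and the final count\<close>

definition params :: "nat \<Rightarrow> nat \<Rightarrow> ((nat \<times> nat \<Rightarrow> int) \<times> (nat \<Rightarrow> int)) set" where
  "params n p = ({..<n} \<times> {..<n} \<rightarrow>\<^sub>E {0..<int p}) \<times> ({..<n} \<rightarrow>\<^sub>E {1..(int p - 1) div 2})"

lemma finite_params: "finite (params n p)"
  by (simp add: params_def finite_PiE)

lemma params_fst: "i \<in> params n p \<Longrightarrow> fst i \<in> {..<n} \<times> {..<n} \<rightarrow>\<^sub>E {0..<int p}"
  by (simp add: params_def mem_Times_iff)

lemma params_snd: "i \<in> params n p \<Longrightarrow> snd i \<in> {..<n} \<rightarrow>\<^sub>E {1..(int p - 1) div 2}"
  by (simp add: params_def mem_Times_iff)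

lemma card_params: "card (params n p) = p ^ (n ^ 2) * nat ((int p - 1) div 2) ^ n"
  by (simp add: params_def card_cartesian_product card_PiE power2_eq_square)

abbreviation "frame_V n p i \<equiv> symplectic_frame.V n p (Evec n (fst i)) (Uvec n (fst i)) (snd i)"
abbreviation "frame_orbit n p i \<equiv> symplectic_frame.in_orbit n p (Evec n (fst i)) (Uvec n (fst i)) (snd i)"

lemma symplectic_frame_params:
  assumes "prime p" "i \<in> params n p"
  shows "symplectic_frame n p (Evec n (fst i)) (Uvec n (fst i)) (snd i)"
proof (rule symplectic_frame_Evec_Uvec[OF assms(1)])
  fix j assume "j < n"
  then have "1 \<le> snd i j" "snd i j \<le> (int p - 1) div 2"
    using PiE_mem[OF params_snd[OF assms(2)], of j] by simp_all
  then show "0 < snd i j" "2 * snd i j < int p" by linarith+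
qed

lemma card_params_le_rank:
  assumes p: "prime p" and n: "n = Suc q"
  shows "enat (card (params n p)) \<le> abelian_rank (reduced_homology_group (int q) (tits_quotient n p))"
  unfolding tits_quotient_def
proof (rule card_le_rank_quotient_if_flags[OF finite_params n, where V = "frame_V n p" and P = "frame_orbit n p"])
  show "finite \<sigma>" if "\<sigma> \<in> tits_building n" for \<sigma>
    using that by (simp add: tits_building_def order_complex_def)
next
  fix i S and e e' :: "nat \<Rightarrow> bool"
  assume i: "i \<in> params n p" and e: "\<And>j. j \<in> S \<Longrightarrow> e j = e' j"
  interpret symplectic_frame n p "Evec n (fst i)" "Uvec n (fst i)" "snd i" by (rule symplectic_frame_params[OF p i])
  show "V S e = V S e'" using e by (rule V_cong)
next
  fix i C and e :: "nat \<Rightarrow> bool"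
  assume i: "i \<in> params n p" and C: "C \<subseteq> faces n" "C \<noteq> {}" "chain\<^sub>\<subseteq> C"
  interpret symplectic_frame n p "Evec n (fst i)" "Uvec n (fst i)" "snd i" by (rule symplectic_frame_params[OF p i])
  show "(\<lambda>S. V S e) ` C \<in> tits_building n" using C unfolding faces_def by (rule V_chain)
next
  fix i k S and e :: "nat \<Rightarrow> bool"
  assume i: "i \<in> params n p" and k: "k < n" and S: "S \<in> faces n"
  interpret symplectic_frame n p "Evec n (fst i)" "Uvec n (fst i)" "snd i" by (rule symplectic_frame_params[OF p i])
  \<comment> \<open>The chamber is compared with its own apartment.\<close>
  interpret two_frames n p "Evec n (fst i)" "Uvec n (fst i)" "snd i" "Evec n (fst i)" "Uvec n (fst i)" "snd i" by unfold_locales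
  have S': "S \<subseteq> {..<n}" using S by (simp add: faces_def)
  show "in_orbit k (V S e) \<longleftrightarrow> S = {..k} \<and> (\<forall>j\<le>k. e j)"
  proof
    assume "in_orbit k (V S e)"
    then obtain A where "A \<in> congruence_subgroup n p" "act_subspace A (D k) = V S e" by (auto simp: in_orbit_def)
    from transition(1,2)[OF this(1) k S' this(2)] show "S = {..k} \<and> (\<forall>j\<le>k. e j)" by blast
  next
    assume *: "S = {..k} \<and> (\<forall>j\<le>k. e j)"
    then have "V S e = D k" using V_cong[of S e "\<lambda>_. True"] by simp
    then have "V S e = act_subspace (1\<^sub>m (2*n)) (D k)" by (simp add: act_subspace_one[OF D_carrier])
    then show "in_orbit k (V S e)" unfolding in_orbit_def using congruence_one by blast
  qed
next
  fix i j assume i: "i \<in> params n p" and j: "j \<in> params n p" and ne: "i \<noteq> j"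
  \<comment> \<open>The apartment is that of \<open>j\<close>, the chamber that of \<open>i\<close>.
    If each label of \<open>i\<close> occurred, the two frames would agree modulo \<open>p\<close>
    and hence have the same parameters.\<close>
  interpret two_frames n p "Evec n (fst j)" "Uvec n (fst j)" "snd j" "Evec n (fst i)" "Uvec n (fst i)" "snd i"
    by (intro two_frames.intro symplectic_frame_params[OF p] i j)
  show "\<exists>k<n. \<forall>S\<in>faces n. \<forall>e. \<not> f'.in_orbit k (f.V S e)"
  proof (rule ccontr)
    assume "\<not> ?thesis"
    then have ex: "\<exists>S e. S \<subseteq> {..<n} \<and> f'.in_orbit k (f.V S e)" if "k < n" for k
      using that by (auto simp: faces_def)
    have bound: "0 \<le> fst c (k, l) \<and> fst c (k, l) < int p" if "c \<in> params n p" "k < n" "l < n" for c k l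
      using PiE_mem[OF params_fst[OF that(1)], of "(k, l)"] that by simp
    have "fst i (k, l) = fst j (k, l)" if "k < n" "l < n" for k l
      by (rule Uvec_cong_imp_eq[OF bound[OF j] bound[OF i] frames_cong(2)[OF ex] that])
    then have "fst i = fst j"
      by (intro PiE_ext[OF params_fst[OF i] params_fst[OF j]]) (simp add: mem_Times_iff split_paired_all)
    moreover have "snd i = snd j"
      by (intro PiE_ext[OF params_snd[OF i] params_snd[OF j]] frames_cong(1)[OF ex]) simp_all
    ultimately show False using ne by (simp add: prod_eq_iff)
  qed
next
  fix x y i k
  assume xy: "x \<in> topspace (realization (tits_building n))" "y \<in> topspace (realization (tits_building n))"
    "building_orbit n p x = building_orbit n p y" and i: "i \<in> params n p"
  interpret symplectic_frame n p "Evec n (fst i)" "Uvec n (fst i)" "snd i" by (rule symplectic_frame_params[OF p i])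
  show "label_weight (in_orbit k) x = label_weight (in_orbit k) y"
    using xy in_orbit_act by (rule label_weight_orbit)
next
  fix i \<sigma> v
  assume i: "i \<in> params n p" and \<sigma>: "\<sigma> \<in> tits_building n" "\<And>k. k < n \<Longrightarrow> \<exists>v\<in>\<sigma>. frame_orbit n p i k v" "v \<in> \<sigma>"
  interpret symplectic_frame n p "Evec n (fst i)" "Uvec n (fst i)" "snd i" by (rule symplectic_frame_params[OF p i])
  show "\<exists>!k. k < n \<and> in_orbit k v" using \<sigma> by (rule in_orbit_chain)
qed

theorem corollary1:
  fixes p n :: nat
  assumes "prime p" and "p \<ge> 3" and "n \<ge> 1"
  shows "ereal_of_enat (t_omega n p) \<ge> ereal (real p ^ (n ^ 2) * ((real p - 1) / 2) ^ n)"
proof -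
  obtain q where n: "n = Suc q" using assms(3) by (cases n) auto
  \<comment> \<open>For odd \<open>p\<close> the integer quotient \<open>(p - 1) div 2\<close> in
    the count is the real quotient of the bound.\<close>
  have "odd p" using assms prime_odd_nat by simp
  then obtain m where m: "p = 2 * m + 1" by (elim oddE)
  have "enat (card (params n p)) \<le> t_omega n p"
    using card_params_le_rank[OF assms(1) n] by (simp add: t_omega_def n)
  then have "ereal_of_enat (enat (card (params n p))) \<le> ereal_of_enat (t_omega n p)"
    by (simp only: ereal_of_enat_le_iff)
  moreover have "real (card (params n p)) = real p ^ (n ^ 2) * ((real p - 1) / 2) ^ n"
    unfolding card_params by (simp add: m)
  ultimately show ?thesis by simp
qed

end
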